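(* Let $\lambda\in\mathbb{C}$ and $N,P\ge 0$, and put $\beta_c = \max\{2-2P, \tfrac{4-2N}{3}\}$, $\beta_0=\max\{\beta_c,1\}$. Suppose that either (a) $\beta_0=\beta_c>1$ and $n=2$, or (b) $\beta_c<1$ and $\lambda\notin\mathbb{R}_{\ge0}$. Then there exist complex-valued potentials $V:\mathbb{R}^n\to\mathbb{C}$ and $W:\mathbb{R}^n\to\mathbb{C}^n$, at least one of which is identically zero, and a non-zero solution $u:\mathbb{R}^n\to\mathbb{C}$ of $$-\Delta u+W\cdot\nabla u+Vu=\lambda u\quad\text{in }\mathbb{R}^n$$ such that $|V(x)|\le C\langle x\rangle^{-N}$ and $|W(x)|\le C\langle x\rangle^{-P}$ for all $x\in\mathbb{R}^n$, and such that, for all sufficiently large $|x|$, $$|u(x)|\le C\exp\left(-c|x|^{\beta_0}(\log|x|)^{A}\right)$$ for some constant $A\in\{-1,0\}$ and some constants $C,c>0$.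
   Context: $\langle x\rangle=\sqrt{1+|x|^2}$. *)

theory Defs
  imports "HOL-Analysis.Analysis"
begin

definition japanese_bracket :: "'a::real_normed_vector \<Rightarrow> real" where
  "japanese_bracket x = sqrt (1 + (norm x)\<^sup>2)"

definition beta_c :: "real \<Rightarrow> real \<Rightarrow> real" where
  "beta_c N P = max (2 - 2 * P) ((4 - 2 * N) / 3)"

definition beta_0 :: "real \<Rightarrow> real \<Rightarrow> real" where
  "beta_0 N P = max (beta_c N P) 1"

definition partial :: "'n \<Rightarrow> (real ^ 'n::finite \<Rightarrow> complex) \<Rightarrow> real ^ 'n \<Rightarrow> complex" where
  "partial j u x = frechet_derivative u (at x) (axis j 1)"

definition gradient :: "(real ^ 'n::finite \<Rightarrow> complex) \<Rightarrow> real ^ 'n \<Rightarrow> complex ^ 'n" where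
  "gradient u x = (\<chi> j. partial j u x)"

definition laplacian :: "(real ^ 'n::finite \<Rightarrow> complex) \<Rightarrow> real ^ 'n \<Rightarrow> complex" where
  "laplacian u x = (\<Sum>j\<in>UNIV. partial j (partial j u) x)"

definition C1 :: "(real ^ 'n::finite \<Rightarrow> complex) \<Rightarrow> bool" where
  "C1 u \<longleftrightarrow> (\<forall>x. u differentiable (at x)) \<and> (\<forall>j. continuous_on UNIV (partial j u))"

definition C2 :: "(real ^ 'n::finite \<Rightarrow> complex) \<Rightarrow> bool" where
  "C2 u \<longleftrightarrow> C1 u \<and> (\<forall>j. C1 (partial j u))"

(* The complex-bilinear product, with no conjugation: the inner product of the library
   on complex vectors is real-valued and is not the dot in W . grad u. *)
definition cdot :: "complex ^ 'n::finite \<Rightarrow> complex ^ 'n \<Rightarrow> complex" where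
  "cdot w z = (\<Sum>j\<in>UNIV. w $ j * z $ j)"

(* Solutions are classical: u is twice continuously differentiable and the equation holds
   at every point. For such u, requiring V and W to be measurable would change nothing when
   only one of them is nonzero: at each point they can be replaced by the values of smallest
   norm, V = g / u (where u x is nonzero) or W = g * cnj (grad u) / |grad u|^2 (where the
   gradient is nonzero), and 0 elsewhere, with g = lambda u + laplacian u. *)
definition eigen_solution ::
  "(real ^ 'n::finite \<Rightarrow> complex) \<Rightarrow> (real ^ 'n \<Rightarrow> complex ^ 'n) \<Rightarrow> complex
    \<Rightarrow> (real ^ 'n \<Rightarrow> complex) \<Rightarrow> bool" where
  "eigen_solution V W l u \<longleftrightarrow>
     C2 u \<and>
     (\<forall>x. - laplacian u x + cdot (W x) (gradient u x) + V x * u x = l * u x)"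

end

theory Submission
  imports Defs
begin

text \<open>
  Case (b): for \<open>u = exp (\<phi> s)\<close> with \<open>s = \<langle>x\<rangle>\<close> the equation \<open>\<Delta>u = k\<^sup>2 u\<close>, \<open>k\<^sup>2 = - \<lambda>\<close>, is a Riccati
  equation for \<open>\<phi>'\<close>. It has a polynomial solution in \<open>1 / s\<close> with constant term \<open>- k\<close> up to an
  error of any prescribed order, and the error is the potential.

  Case (a): put \<open>\<mu> = \<beta>\<^sub>0 / 2\<close> and \<open>t = r\<^bsup>\<mu>\<^esup>\<close>. Following Meshkov, \<open>u = exp (- \<Phi>) g\<close> where \<open>g\<close> passes,
  as \<open>t\<close> runs through \<open>[j, j + 1]\<close>, from the angular mode \<open>\<plusminus> j\<^sup>2\<close> to the mode \<open>\<mp> (j + 1)\<^sup>2\<close>. With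
  \<open>\<Phi>'\<close> close to \<open>t\<^sup>2\<close> in the variable \<open>log r\<close>, one of the two modes is nearly holomorphic and the other
  nearly antiholomorphic, so their gradients cannot cancel, and \<open>r\<^sup>2 (\<Delta> + \<lambda>) u\<close> is of size \<open>t\<^sup>3 exp (- \<Phi>)\<close>. The function \<open>u\<close> itself does
  vanish, at points with \<open>t = j + 1 / 2\<close>; a small third harmonic makes the error vanish there as well, so that
  it is bounded by \<open>t\<^sup>3 |u|\<close>. One function thus serves both kinds of potentials: the bound by \<open>|u|\<close> gives \<open>V\<close> and
  the bound by the gradient gives \<open>W\<close>.
\<close>

section \<open>Local second-order data and potentials\<close>

text \<open>In \<rho> = log r and \<theta> the operator r^2 \<Delta> is the sum of the two pure
  second derivatives. Conjugation by exp (- \<Phi>) gives a mode of frequency q the factor \<Phi>'^2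
  - q^2, about t^4 - q^2. For |q| = j^2 this mismatch is of order t^3 on a unit interval of t, and
  so is the term with \<Phi>' times the \<rho>-derivative of an amplitude that switches within that
  interval: squares as frequencies balance the two costs. Dividing t^3 by r^2 gives r^(3\<mu> - 2),
  that is N = 2 - 3\<mu>; dividing t^3 / r^2 by the size t^2 / r of the gradient gives r^(\<mu> -
  1), that is P = 1 - \<mu>. With 2\<mu> in place of the exponent these are the two entries of the
  maximum \<open>beta_c\<close>. The term \<lambda> r^2 is small against t^4 = r^(4\<mu>) since
  \<mu> > 1/2. Zeros are forced: the winding number of u changes from one circle to the next. For V
  the error therefore has to vanish where u does, at the same rate; this is the obstacle that shapes
  the estimates. No logarithm is lost, so A = 0 in both cases.\<close>

definition has2 :: "(real ^ 'n::finite) set \<Rightarrow> (real ^ 'n \<Rightarrow> complex) \<Rightarrow> ('n \<Rightarrow> real ^ 'n \<Rightarrow> complex)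
    \<Rightarrow> (real ^ 'n \<Rightarrow> complex) \<Rightarrow> bool" where
  "has2 A u p L \<longleftrightarrow> open A \<and>
     (\<forall>x\<in>A. (u has_derivative (\<lambda>h. \<Sum>j\<in>UNIV. h $ j *\<^sub>R p j x)) (at x)) \<and>
     (\<exists>q. (\<forall>j. \<forall>x\<in>A. (p j has_derivative (\<lambda>h. \<Sum>k\<in>UNIV. h $ k *\<^sub>R q j k x)) (at x)) \<and>
          (\<forall>j k. continuous_on A (q j k)) \<and> (\<forall>x\<in>A. L x = (\<Sum>j\<in>UNIV. q j j x)))"

text \<open>The second partials are hidden behind an existential in \<open>has2\<close>, since later
  only their trace \<open>L\<close> matters; here they are opened for the rules that combine such
  data.\<close>

lemma has2E:
  assumes "has2 A u p L"
  obtains q where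
    "\<And>j x. x \<in> A \<Longrightarrow> (p j has_derivative (\<lambda>h. \<Sum>k\<in>UNIV. h $ k *\<^sub>R q j k x)) (at x)"
    "\<And>j k. continuous_on A (q j k)" "\<And>x. x \<in> A \<Longrightarrow> L x = (\<Sum>j\<in>UNIV. q j j x)"
proof -
  have "\<exists>q. (\<forall>j. \<forall>x\<in>A. (p j has_derivative (\<lambda>h. \<Sum>k\<in>UNIV. h $ k *\<^sub>R q j k x)) (at x)) \<and>
      (\<forall>j k. continuous_on A (q j k)) \<and> (\<forall>x\<in>A. L x = (\<Sum>j\<in>UNIV. q j j x))"
    using assms unfolding has2_def by (elim conjE)
  then show thesis using that by (elim exE conjE) auto
qed

lemma partial_eq:
  fixes u :: "real ^ 'n::finite \<Rightarrow> complex"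
  assumes "(u has_derivative (\<lambda>h. \<Sum>j\<in>UNIV. h $ j *\<^sub>R p j)) (at x)"
  shows "partial j u x = p j"
proof -
  have "frechet_derivative u (at x) = (\<lambda>h. \<Sum>j\<in>UNIV. h $ j *\<^sub>R p j)"
    using frechet_derivative_at[OF assms] by simp
  then have "partial j u x = (\<Sum>k\<in>UNIV. (axis j (1::real) $ k) *\<^sub>R p k)"
    by (simp add: partial_def)
  also have "\<dots> = (\<Sum>k\<in>UNIV. if k = j then p k else 0)"
    by (intro sum.cong) (auto simp: axis_def)
  finally show ?thesis by simp
qed

lemma has2_partial:
  assumes "has2 A u p L" "x \<in> A"
  shows "partial j u x = p j x"
  using assms unfolding has2_def by (intro partial_eq) blast

lemma has2_second:
  fixes u :: "real ^ 'n::finite \<Rightarrow> complex"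
  assumes "has2 A u p L"
  obtains q where
    "\<And>j x. x \<in> A \<Longrightarrow> (partial j u has_derivative (\<lambda>h. \<Sum>k\<in>UNIV. h $ k *\<^sub>R q j k x)) (at x)"
    "\<And>j k. continuous_on A (q j k)" "\<And>x. x \<in> A \<Longrightarrow> L x = (\<Sum>j\<in>UNIV. q j j x)"
proof -
  obtain q where q: "\<And>j x. x \<in> A \<Longrightarrow> (p j has_derivative (\<lambda>h. \<Sum>k\<in>UNIV. h $ k *\<^sub>R q j k x)) (at x)"
    "\<And>j k. continuous_on A (q j k)" "\<And>x. x \<in> A \<Longrightarrow> L x = (\<Sum>j\<in>UNIV. q j j x)"
    by (fact has2E[OF assms])
  have "(partial j u has_derivative (\<lambda>h. \<Sum>k\<in>UNIV. h $ k *\<^sub>R q j k x)) (at x)" if "x \<in> A" for j x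
    using assms that has2_partial[OF assms]
    by (intro has_derivative_transform_within_open[OF q(1)[OF that], of A])
       (auto simp: has2_def)
  with q(2,3) show thesis using that by blast
qed

lemma has2_gradient:
  assumes "has2 A u p L" "x \<in> A"
  shows "gradient u x = (\<chi> j. p j x)"
  using has2_partial[OF assms] by (simp add: gradient_def)

lemma has2_laplacian:
  assumes "has2 A u p L" "x \<in> A"
  shows "laplacian u x = L x"
proof -
  obtain q where q: "\<And>j x. x \<in> A \<Longrightarrow> (partial j u has_derivative (\<lambda>h. \<Sum>k\<in>UNIV. h $ k *\<^sub>R q j k x)) (at x)"
    "\<And>j k. continuous_on A (q j k)" "\<And>x. x \<in> A \<Longrightarrow> L x = (\<Sum>j\<in>UNIV. q j j x)"
    by (fact has2_second[OF assms(1)])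
  have "partial j (partial j u) x = q j j x" for j
    using partial_eq[OF q(1)[OF assms(2)]] by simp
  then show ?thesis using q(3)[OF assms(2)] by (simp add: laplacian_def)
qed

text \<open>The planar solution has one formula near the origin and others away from it, so
  \<open>p\<close> and \<open>L\<close> may change with the point. Overlaps need no check, because
  partial derivatives are unique.\<close>

lemma C2_if_locally_has2:
  fixes u :: "real ^ 'n::finite \<Rightarrow> complex"
  assumes loc: "\<And>x. \<exists>A p L. x \<in> A \<and> has2 A u p L"
  shows "C2 u"
proof -
  have d0: "u differentiable (at x)" for x
    using loc[of x] unfolding has2_def differentiable_def by blast
  have d1: "partial j u differentiable (at x)" for j x
  proof -
    obtain A p L where A: "x \<in> A" "has2 A u p L" using loc by blast
    obtain q where "\<And>j x. x \<in> A \<Longrightarrow> (partial j u has_derivative (\<lambda>h. \<Sum>k\<in>UNIV. h $ k *\<^sub>R q j k x)) (at x)"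
      "\<And>j k. continuous_on A (q j k)" "\<And>x. x \<in> A \<Longrightarrow> L x = (\<Sum>j\<in>UNIV. q j j x)"
      by (fact has2_second[OF A(2)])
    then show ?thesis using A(1) unfolding differentiable_def by blast
  qed
  have c2: "isCont (partial k (partial j u)) x" for j k x
  proof -
    obtain A p L where A: "x \<in> A" "has2 A u p L" using loc by blast
    obtain q where q: "\<And>j x. x \<in> A \<Longrightarrow> (partial j u has_derivative (\<lambda>h. \<Sum>k\<in>UNIV. h $ k *\<^sub>R q j k x)) (at x)"
      "\<And>j k. continuous_on A (q j k)" "\<And>x. x \<in> A \<Longrightarrow> L x = (\<Sum>j\<in>UNIV. q j j x)"
      by (fact has2_second[OF A(2)])
    have op: "open A" using A(2) by (simp add: has2_def)
    have eq: "\<And>y. y \<in> A \<Longrightarrow> partial k (partial j u) y = q j k y"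
      using partial_eq[OF q(1)] by simp
    have "continuous_on A (partial k (partial j u))"
      using q(2)[of j k] eq continuous_on_cong[of A A "partial k (partial j u)" "q j k"] by simp
    then show ?thesis using op A(1) continuous_on_eq_continuous_at by blast
  qed
  show ?thesis
    unfolding C2_def C1_def
    using d0 d1 c2 differentiable_imp_continuous_within[OF d1]
    by (auto intro!: continuous_at_imp_continuous_on)
qed

lemma has2_cong:
  assumes "has2 A u p L" "\<And>x. x \<in> A \<Longrightarrow> v x = u x"
  shows "has2 A v p L"
proof -
  have op: "open A" using assms(1) by (simp add: has2_def)
  have "(v has_derivative (\<lambda>h. \<Sum>j\<in>UNIV. h $ j *\<^sub>R p j x)) (at x)" if x: "x \<in> A" for x
  proof (rule has_derivative_transform_within_open[OF _ op x])
    show "(u has_derivative (\<lambda>h. \<Sum>j\<in>UNIV. h $ j *\<^sub>R p j x)) (at x)"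
      using assms(1) x by (simp add: has2_def)
  qed (use assms(2) in auto)
  then show ?thesis using assms(1) unfolding has2_def by simp
qed

lemma has2_subset:
  assumes "has2 A u p L" "B \<subseteq> A" "open B"
  shows "has2 B u p L"
proof -
  obtain q where q: "\<And>j x. x \<in> A \<Longrightarrow> (p j has_derivative (\<lambda>h. \<Sum>k\<in>UNIV. h $ k *\<^sub>R q j k x)) (at x)"
    "\<And>j k. continuous_on A (q j k)" "\<And>x. x \<in> A \<Longrightarrow> L x = (\<Sum>j\<in>UNIV. q j j x)"
    by (fact has2E[OF assms(1)])
  show ?thesis
    unfolding has2_def
  proof (intro conjI exI[of _ q] allI ballI)
    show "continuous_on B (q j k)" for j k
      using q(2) assms(2) continuous_on_subset by blast
  qed (use assms q in \<open>auto simp: has2_def\<close>)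
qed

lemma has2_add:
  assumes "has2 A u p L" "has2 A v p' L'"
  shows "has2 A (\<lambda>x. u x + v x) (\<lambda>j x. p j x + p' j x) (\<lambda>x. L x + L' x)"
proof -
  obtain q where q: "\<And>j x. x \<in> A \<Longrightarrow> (p j has_derivative (\<lambda>h. \<Sum>k\<in>UNIV. h $ k *\<^sub>R q j k x)) (at x)"
    "\<And>j k. continuous_on A (q j k)" "\<And>x. x \<in> A \<Longrightarrow> L x = (\<Sum>j\<in>UNIV. q j j x)"
    by (fact has2E[OF assms(1)])
  obtain q' where q': "\<And>j x. x \<in> A \<Longrightarrow> (p' j has_derivative (\<lambda>h. \<Sum>k\<in>UNIV. h $ k *\<^sub>R q' j k x)) (at x)"
    "\<And>j k. continuous_on A (q' j k)" "\<And>x. x \<in> A \<Longrightarrow> L' x = (\<Sum>j\<in>UNIV. q' j j x)"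
    by (fact has2E[OF assms(2)])
  show ?thesis
    unfolding has2_def
  proof (intro conjI exI[of _ "\<lambda>j k x. q j k x + q' j k x"] allI ballI)
    fix x assume x: "x \<in> A"
    show "((\<lambda>x. u x + v x) has_derivative (\<lambda>h. \<Sum>j\<in>UNIV. h $ j *\<^sub>R (p j x + p' j x))) (at x)"
      unfolding scaleR_add_right sum.distrib
      using assms x unfolding has2_def by (intro has_derivative_add) auto
    show "((\<lambda>x. p j x + p' j x) has_derivative (\<lambda>h. \<Sum>k\<in>UNIV. h $ k *\<^sub>R (q j k x + q' j k x))) (at x)" for j
      unfolding scaleR_add_right sum.distrib
      using q(1) q'(1) x by (intro has_derivative_add) auto
    show "L x + L' x = (\<Sum>j\<in>UNIV. q j j x + q' j j x)"
      using q(3) q'(3) x by (simp add: sum.distrib)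
  qed (use assms q q' in \<open>auto simp: has2_def intro!: continuous_intros\<close>)
qed

lemma has2_cmult:
  assumes "has2 A u p L"
  shows "has2 A (\<lambda>x. c * u x) (\<lambda>j x. c * p j x) (\<lambda>x. c * L x)"
proof -
  obtain q where q: "\<And>j x. x \<in> A \<Longrightarrow> (p j has_derivative (\<lambda>h. \<Sum>k\<in>UNIV. h $ k *\<^sub>R q j k x)) (at x)"
    "\<And>j k. continuous_on A (q j k)" "\<And>x. x \<in> A \<Longrightarrow> L x = (\<Sum>j\<in>UNIV. q j j x)"
    by (fact has2E[OF assms])
  have dist: "(\<lambda>h. \<Sum>j\<in>UNIV. h $ j *\<^sub>R (c * f j)) = (\<lambda>h. c * (\<Sum>j\<in>UNIV. h $ j *\<^sub>R f j))" for f :: "'a \<Rightarrow> complex"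
    by (simp add: sum_distrib_left)
  show ?thesis
    unfolding has2_def
  proof (intro conjI exI[of _ "\<lambda>j k x. c * q j k x"] allI ballI)
    fix x assume x: "x \<in> A"
    show "((\<lambda>x. c * u x) has_derivative (\<lambda>h. \<Sum>j\<in>UNIV. h $ j *\<^sub>R (c * p j x))) (at x)"
      unfolding dist
      using assms x unfolding has2_def by (intro has_derivative_mult_right) auto
    show "((\<lambda>x. c * p j x) has_derivative (\<lambda>h. \<Sum>k\<in>UNIV. h $ k *\<^sub>R (c * q j k x))) (at x)" for j
      unfolding dist
      using q(1) x by (intro has_derivative_mult_right) auto
    show "c * L x = (\<Sum>j\<in>UNIV. c * q j j x)"
      using q(3) x by (simp add: sum_distrib_left)
  qed (use assms q in \<open>auto simp: has2_def intro!: continuous_intros\<close>)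
qed

lemma has2_sum:
  assumes "finite I" "open A" "\<And>i. i \<in> I \<Longrightarrow> has2 A (u i) (p i) (L i)"
  shows "has2 A (\<lambda>x. \<Sum>i\<in>I. u i x) (\<lambda>j x. \<Sum>i\<in>I. p i j x) (\<lambda>x. \<Sum>i\<in>I. L i x)"
  using assms(1,3)
proof (induction I rule: finite_induct)
  case empty
  show ?case using assms(2)
    unfolding has2_def by (auto intro!: exI[of _ "\<lambda>_ _ _. 0"])
next
  case (insert i I)
  then show ?case using has2_add[of A "u i" "p i" "L i"] by auto
qed

section \<open>Potentials read off from pointwise bounds on the error\<close>

lemma exists_potential:
  fixes u :: "real ^ 'n::finite \<Rightarrow> complex"
  assumes "C2 u" "\<And>x. norm (laplacian u x + l * u x) \<le> C * b x * norm (u x)"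
    and "C > 0" "\<And>x. b x \<ge> 0"
  shows "\<exists>V. eigen_solution V (\<lambda>_. 0) l u \<and> (\<forall>x. norm (V x) \<le> C * b x)"
proof (intro exI conjI allI)
  \<comment> \<open>Where \<open>u\<close> vanishes the assumed bound forces
    \<open>laplacian u x + l * u x = 0\<close>, so the default 0 still solves the equation.\<close>
  let ?V = "\<lambda>x. if u x = 0 then 0 else (laplacian u x + l * u x) / u x"
  show "eigen_solution ?V (\<lambda>_. 0) l u"
    unfolding eigen_solution_def
  proof (intro conjI allI)
    fix x
    show "- laplacian u x + cdot 0 (gradient u x) + ?V x * u x = l * u x"
      using assms(2)[of x] by (auto simp: cdot_def)
  qed (use assms in auto)
  show "norm (?V x) \<le> C * b x" for x
  proof (cases "u x = 0")
    case True
    then show ?thesis using assms(3) assms(4)[of x] by simp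
  next
    case False
    then have "norm (u x) > 0" by simp
    then have "norm (laplacian u x + l * u x) / norm (u x) \<le> C * b x"
      using assms(2)[of x] by (metis pos_divide_le_eq)
    then show ?thesis using False by (simp add: norm_divide)
  qed
qed

lemma cdot_cnj_self:
  fixes z :: "complex ^ 'n::finite"
  shows "cdot (\<chi> j. cnj (z $ j)) z = of_real ((norm z)\<^sup>2)"
proof -
  have "cdot (\<chi> j. cnj (z $ j)) z = (\<Sum>j\<in>UNIV. of_real ((norm (z $ j))\<^sup>2))"
    unfolding cdot_def
    by (intro sum.cong) (auto simp: complex_norm_square mult.commute simp del: of_real_power)
  then show ?thesis
    by (simp add: norm_vec_def L2_set_def sum_nonneg)
qed

lemma norm_cmult_cnj:
  fixes z :: "complex ^ 'n::finite"
  shows "norm (\<chi> j. c * (\<chi> j. cnj (z $ j)) $ j) = norm c * norm z"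
  by (simp add: norm_vec_def L2_set_def norm_mult power_mult_distrib real_sqrt_mult
      flip: sum_distrib_left)

text \<open>The drift is a multiple of the conjugate gradient: the bilinear \<open>cdot\<close> of a
  nonzero complex vector with itself may be 0, but with its conjugate it is the squared
  norm.\<close>

lemma exists_drift:
  fixes u :: "real ^ 'n::finite \<Rightarrow> complex"
  assumes "C2 u" "\<And>x. norm (laplacian u x + l * u x) \<le> C * b x * norm (gradient u x)"
    and "C > 0" "\<And>x. b x \<ge> 0"
  shows "\<exists>W. eigen_solution (\<lambda>_. 0) W l u \<and> (\<forall>x. norm (W x) \<le> C * b x)"
proof (intro exI conjI allI)
  let ?g = "\<lambda>x. laplacian u x + l * u x"
  let ?n = "\<lambda>x. norm (gradient u x)"
  let ?W = "\<lambda>x. if ?n x = 0 then 0 else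
    (\<chi> j. ?g x / of_real ((?n x)\<^sup>2) * (\<chi> j. cnj (gradient u x $ j)) $ j)"
  have "cdot (?W x) (gradient u x) = ?g x" for x
  proof (cases "?n x = 0")
    case True
    then show ?thesis using assms(2)[of x] by (simp add: cdot_def)
  next
    case False
    then have "cdot (?W x) (gradient u x) =
        ?g x / of_real ((?n x)\<^sup>2) * cdot (\<chi> j. cnj (gradient u x $ j)) (gradient u x)"
      by (simp add: cdot_def sum_distrib_left mult.assoc)
    then show ?thesis using False by (simp only: cdot_cnj_self) simp
  qed
  then show "eigen_solution (\<lambda>_. 0) ?W l u"
    unfolding eigen_solution_def using assms(1) by simp
  have nw: "norm (?W x) = norm (?g x) / ?n x" if "?n x \<noteq> 0" for x
  proof -
    have "norm (?W x) = norm (?g x / of_real ((?n x)\<^sup>2)) * ?n x"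
      unfolding if_not_P[OF that] by (rule norm_cmult_cnj)
    also have "\<dots> = norm (?g x) / (?n x)\<^sup>2 * ?n x"
      by (simp add: norm_divide norm_power del: of_real_power)
    finally show ?thesis using that by (simp add: power2_eq_square)
  qed
  show "norm (?W x) \<le> C * b x" for x
  proof (cases "?n x = 0")
    case True
    then show ?thesis using assms(3) assms(4)[of x] by simp
  next
    case False
    then have "?n x > 0" by simp
    then show ?thesis unfolding nw[OF False]
      using assms(2)[of x] by (metis pos_divide_le_eq)
  qed
qed

section \<open>Fast decaying potentials outside the spectrum\<close>

text \<open>Here t = 1 / s and p(t) is \<phi>' for u = exp (\<phi> s): |grad s|^2 = 1 - t^2,
  \<Delta> s = d * t + t^3 with d the dimension minus 1, and \<phi>'' = - t^2 p'(t). The left side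
  is thus \<Delta> u / u. Each induction step gains one power of t, because the linearization at
  p(0) = - k is to leading order multiplication by - 2 k, invertible for nonzero k.\<close>

lemma riccati_poly:
  fixes k d :: complex
  assumes "k \<noteq> 0"
  shows "\<exists>p r. poly p 0 = - k \<and>
    (\<forall>t. ((poly p t)\<^sup>2 - t\<^sup>2 * poly (pderiv p) t) * (1 - t\<^sup>2) + poly p t * (d * t + t ^ 3)
       = k\<^sup>2 + t ^ Suc m * poly r t)"
proof (induction m)
  case 0
  have "poly [:- k:] 0 = - k \<and> (\<forall>t. ((poly [:- k:] t)\<^sup>2 - t\<^sup>2 * poly (pderiv [:- k:]) t) * (1 - t\<^sup>2)
      + poly [:- k:] t * (d * t + t ^ 3) = k\<^sup>2 + t ^ Suc 0 * poly [:- k * d, - k\<^sup>2, - k:] t)"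
    by (simp add: pderiv_pCons) algebra
  then show ?case by blast
next
  case (Suc m)
  then obtain p r where p: "poly p 0 = - k"
    "\<And>t. ((poly p t)\<^sup>2 - t\<^sup>2 * poly (pderiv p) t) * (1 - t\<^sup>2) + poly p t * (d * t + t ^ 3)
       = k\<^sup>2 + t ^ Suc m * poly r t" by blast
  \<comment> \<open>Adding c t^M changes the coefficient of t^M by 2 p(0) c = - 2 k c, which for
    this \<open>c\<close> cancels r(0).\<close>
  define c where "c = poly r 0 / (2 * k)"
  define M where "M = Suc m"
  define e where "e = monom c M"
  define q where "q = p + e"
  \<comment> \<open>The new remainder divided by t^M; all but the first two summands carry an
    explicit factor t, so its value at 0 is r(0) - 2 k c = 0.\<close>
  define r' where "r' = r + smult (2 * c) p + [:0, 1:] *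
      ((monom (c\<^sup>2) m - smult (c * of_nat M) 1) * [:1, 0, -1:] - smult (2 * c) ([:0, 1:] * p)
       + smult c [:d, 0, 1:])"
  have "poly r' 0 = 0"
    using assms p(1) by (simp add: r'_def c_def)
  then have "[:0, 1:] dvd r'" using dvd_iff_poly_eq_0[of 0 r'] by simp
  then obtain r'' where r'': "r' = [:0, 1:] * r''" by (elim dvdE)
  have e: "poly e t = c * t ^ M" "t\<^sup>2 * poly (pderiv e) t = c * of_nat M * (t ^ M * t)" for t
    by (auto simp: e_def M_def poly_monom pderiv_monom power2_eq_square)
  have "((poly q t)\<^sup>2 - t\<^sup>2 * poly (pderiv q) t) * (1 - t\<^sup>2) + poly q t * (d * t + t ^ 3)
      = k\<^sup>2 + t ^ Suc M * poly r'' t" for t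
  proof -
    have tM: "t ^ M = t * t ^ m" by (simp add: M_def)
    have "((poly q t)\<^sup>2 - t\<^sup>2 * poly (pderiv q) t) * (1 - t\<^sup>2) + poly q t * (d * t + t ^ 3)
      = (((poly p t)\<^sup>2 - t\<^sup>2 * poly (pderiv p) t) * (1 - t\<^sup>2) + poly p t * (d * t + t ^ 3))
        + (2 * poly p t * poly e t + (poly e t)\<^sup>2 - t\<^sup>2 * poly (pderiv e) t) * (1 - t\<^sup>2)
        + poly e t * (d * t + t ^ 3)"
      unfolding q_def pderiv_add poly_add by algebra
    also have "\<dots> = k\<^sup>2 + t ^ M * poly r t + (2 * poly p t * poly e t + (poly e t)\<^sup>2 - t\<^sup>2 * poly (pderiv e) t) * (1 - t\<^sup>2)
        + poly e t * (d * t + t ^ 3)"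
      unfolding p(2) M_def ..
    also have "\<dots> = k\<^sup>2 + t ^ M * poly r' t"
      unfolding e r'_def by (simp add: poly_monom tM) algebra
    also have "\<dots> = k\<^sup>2 + t ^ Suc M * poly r'' t"
      unfolding r'' by simp
    finally show ?thesis .
  qed
  moreover have "poly q 0 = - k" using p(1) e(1)[of 0] by (simp add: q_def M_def)
  ultimately show ?case unfolding M_def by blast
qed

section \<open>Radial functions of the Japanese bracket\<close>

lemma japanese_bracket_ge_1: "japanese_bracket x \<ge> 1"
  by (simp add: japanese_bracket_def)

lemma norm_le_japanese_bracket: "norm x \<le> japanese_bracket x"
  unfolding japanese_bracket_def by (rule real_le_rsqrt) simp

lemma japanese_bracket_power2: "(japanese_bracket x)\<^sup>2 = 1 + (norm x)\<^sup>2"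
  by (simp add: japanese_bracket_def add_nonneg_nonneg)

lemma inner_eq_sum_nth: "x \<bullet> h = (\<Sum>j\<in>UNIV. x $ j * h $ j)" for x h :: "real ^ 'n::finite"
  by (simp add: inner_vec_def)

lemma has_derivative_japanese_bracket:
  fixes x :: "'a::real_inner"
  shows "(japanese_bracket has_derivative (\<lambda>h. (x \<bullet> h) / japanese_bracket x)) (at x)"
proof -
  have "0 < 1 + x \<bullet> x" by (simp add: add_pos_nonneg)
  then have "((\<lambda>x. sqrt (1 + x \<bullet> x)) has_derivative (\<lambda>h. (x \<bullet> h) / sqrt (1 + x \<bullet> x))) (at x)"
    by (auto intro!: derivative_eq_intros simp: inner_commute field_simps)
  then show ?thesis unfolding japanese_bracket_def power2_norm_eq_inner .
qed

text \<open>\<open>R\<close> stands for f'(s) / s: since grad s = x / s, the gradient of f(s) is x *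
  R(s), and its divergence involves only \<open>R\<close> and \<open>R1\<close>.\<close>

lemma has2_radial:
  fixes f R R1 :: "real \<Rightarrow> complex"
  assumes f: "\<And>s. s > 0 \<Longrightarrow> (f has_vector_derivative s *\<^sub>R R s) (at s)"
    and R: "\<And>s. s > 0 \<Longrightarrow> (R has_vector_derivative R1 s) (at s)"
    and R1: "continuous_on {0<..} R1"
  shows "has2 UNIV (\<lambda>x :: real ^ 'n::finite. f (japanese_bracket x))
    (\<lambda>j x. x $ j *\<^sub>R R (japanese_bracket x))
    (\<lambda>x. real CARD('n) *\<^sub>R R (japanese_bracket x)
       + ((norm x)\<^sup>2 / japanese_bracket x) *\<^sub>R R1 (japanese_bracket x))"
  unfolding has2_def
proof (intro conjI ballI allI exI[of _ "\<lambda>j k x. (if j = k then R (japanese_bracket x) else 0)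
    + (x $ j * x $ k / japanese_bracket x) *\<^sub>R R1 (japanese_bracket x)"])
  fix x :: "real ^ 'n"
  let ?s = "japanese_bracket x"
  have s: "?s > 0" using japanese_bracket_ge_1[of x] by linarith
  have "((\<lambda>x. f (japanese_bracket x)) has_derivative (\<lambda>h. ((x \<bullet> h) / ?s) *\<^sub>R (?s *\<^sub>R R ?s))) (at x)"
    using has_derivative_compose[OF has_derivative_japanese_bracket[of x],
        of f "\<lambda>y. y *\<^sub>R (?s *\<^sub>R R ?s)"] f[OF s]
    unfolding has_vector_derivative_def by simp
  moreover have "(\<lambda>h. ((x \<bullet> h) / ?s) *\<^sub>R (?s *\<^sub>R R ?s)) = (\<lambda>h. \<Sum>j\<in>UNIV. h $ j *\<^sub>R x $ j *\<^sub>R R ?s)"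
    using s by (simp add: fun_eq_iff inner_eq_sum_nth scaleR_sum_left mult.commute)
  ultimately show "((\<lambda>x. f (japanese_bracket x)) has_derivative (\<lambda>h. \<Sum>j\<in>UNIV. h $ j *\<^sub>R x $ j *\<^sub>R R ?s)) (at x)"
    by simp
  fix j :: 'n
  have dR: "((\<lambda>x. R (japanese_bracket x)) has_derivative (\<lambda>h. ((x \<bullet> h) / ?s) *\<^sub>R R1 ?s)) (at x)"
    using has_derivative_compose[OF has_derivative_japanese_bracket[of x],
        of R "\<lambda>y. y *\<^sub>R R1 ?s"] R[OF s]
    unfolding has_vector_derivative_def by simp
  have dj: "((\<lambda>x. x $ j) has_derivative (\<lambda>h. h $ j)) (at x)"
    by (intro bounded_linear_imp_has_derivative bounded_linear_vec_nth)
  have "((\<lambda>x. x $ j *\<^sub>R R (japanese_bracket x)) has_derivative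
      (\<lambda>h. x $ j *\<^sub>R (((x \<bullet> h) / ?s) *\<^sub>R R1 ?s) + h $ j *\<^sub>R R ?s)) (at x)"
    by (rule has_derivative_scaleR[OF dj dR])
  moreover have "(\<lambda>h. x $ j *\<^sub>R (((x \<bullet> h) / ?s) *\<^sub>R R1 ?s) + h $ j *\<^sub>R R ?s) =
      (\<lambda>h. \<Sum>k\<in>UNIV. h $ k *\<^sub>R ((if j = k then R ?s else 0) + (x $ j * x $ k / ?s) *\<^sub>R R1 ?s))"
  proof
    fix h :: "real ^ 'n"
    have "(\<Sum>k\<in>UNIV. h $ k *\<^sub>R ((if j = k then R ?s else 0) + (x $ j * x $ k / ?s) *\<^sub>R R1 ?s))
      = (\<Sum>k\<in>UNIV. (if j = k then h $ k *\<^sub>R R ?s else 0)) + (\<Sum>k\<in>UNIV. (x $ k * h $ k * (x $ j / ?s)) *\<^sub>R R1 ?s)"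
      unfolding scaleR_add_right sum.distrib
      by (intro arg_cong2[of _ _ _ _ "(+)"] sum.cong) (auto simp: field_simps)
    moreover have "(\<Sum>k\<in>UNIV. (x $ k * h $ k * (x $ j / ?s)) *\<^sub>R R1 ?s) = ((x \<bullet> h) * (x $ j / ?s)) *\<^sub>R R1 ?s"
      by (simp only: inner_eq_sum_nth sum_distrib_right scaleR_sum_left)
    ultimately show "x $ j *\<^sub>R (((x \<bullet> h) / ?s) *\<^sub>R R1 ?s) + h $ j *\<^sub>R R ?s =
      (\<Sum>k\<in>UNIV. h $ k *\<^sub>R ((if j = k then R ?s else 0) + (x $ j * x $ k / ?s) *\<^sub>R R1 ?s))"
      by (simp add: mult.commute)
  qed
  ultimately show "((\<lambda>x. x $ j *\<^sub>R R (japanese_bracket x)) has_derivative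
      (\<lambda>h. \<Sum>k\<in>UNIV. h $ k *\<^sub>R ((if j = k then R ?s else 0) + (x $ j * x $ k / ?s) *\<^sub>R R1 ?s))) (at x)"
    by simp
next
  fix x :: "real ^ 'n"
  let ?s = "japanese_bracket x"
  have "(\<Sum>j\<in>UNIV. (x $ j * x $ j / ?s) *\<^sub>R R1 ?s) = ((norm x)\<^sup>2 / ?s) *\<^sub>R R1 ?s"
    by (simp add: power2_norm_eq_inner inner_eq_sum_nth flip: scaleR_sum_left sum_divide_distrib)
  then show "real CARD('n) *\<^sub>R R ?s + ((norm x)\<^sup>2 / ?s) *\<^sub>R R1 ?s =
      (\<Sum>j\<in>UNIV. (if j = j then R ?s else 0) + (x $ j * x $ j / ?s) *\<^sub>R R1 ?s)"
    by (simp add: sum.distrib scaleR_conv_of_real)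
next
  have cs: "continuous_on UNIV (japanese_bracket :: real ^ 'n \<Rightarrow> real)"
    unfolding japanese_bracket_def by (intro continuous_intros)
  have pos: "japanese_bracket x > 0" for x :: "real ^ 'n"
    using japanese_bracket_ge_1[of x] by linarith
  have "continuous_on {0<..} R"
    using R has_vector_derivative_continuous
    by (blast intro!: continuous_at_imp_continuous_on)
  then have cR: "continuous_on UNIV (\<lambda>x :: real ^ 'n. R (japanese_bracket x))"
    using continuous_on_compose2[OF _ cs] pos by auto
  have cR1: "continuous_on UNIV (\<lambda>x :: real ^ 'n. R1 (japanese_bracket x))"
    using continuous_on_compose2[OF R1 cs] pos by auto
  show "continuous_on UNIV (\<lambda>x :: real ^ 'n. (if j = k then R (japanese_bracket x) else 0)
    + (x $ j * x $ k / japanese_bracket x) *\<^sub>R R1 (japanese_bracket x))" for j k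
    using cR cR1 cs pos by (cases "j = k") (auto intro!: continuous_intros simp: dual_order.strict_implies_not_eq[OF pos])
qed auto

text \<open>Half of the limiting rate absorbs the error in the limit of \<psi>: Re \<phi> + (Re k /
  2) s is nonincreasing from some point on.\<close>

lemma norm_exp_decay:
  fixes \<phi> \<psi> :: "real \<Rightarrow> complex"
  assumes "\<And>s. s > 0 \<Longrightarrow> (\<phi> has_vector_derivative \<psi> s) (at s)"
    and "(\<psi> \<longlongrightarrow> - k) at_top" and "Re k > 0"
  shows "\<exists>C>0. \<forall>\<^sub>F s in at_top. norm (exp (\<phi> s)) \<le> C * exp (- (Re k / 2) * s)"
proof -
  have "((\<lambda>s. Re (\<psi> s)) \<longlongrightarrow> - Re k) at_top"
    using tendsto_Re[OF assms(2)] by simp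
  then have "\<forall>\<^sub>F s in at_top. Re (\<psi> s) < - (Re k / 2)"
    using assms(3) by (intro order_tendstoD(2)) auto
  then obtain a where a: "\<And>s. s \<ge> a \<Longrightarrow> Re (\<psi> s) < - (Re k / 2)"
    unfolding eventually_at_top_linorder by blast
  define b where "b = max a 1"
  have dRe: "((\<lambda>s. Re (\<phi> s) + (Re k / 2) * s) has_real_derivative Re (\<psi> s) + Re k / 2) (at s)" if "s > 0" for s
  proof -
    have "((\<lambda>s. Re (\<phi> s)) has_vector_derivative Re (\<psi> s)) (at s)"
      using bounded_linear.has_vector_derivative[OF bounded_linear_Re assms(1)[OF that]] .
    then have "((\<lambda>s. Re (\<phi> s)) has_real_derivative Re (\<psi> s)) (at s)"
      by (simp add: has_real_derivative_iff_has_vector_derivative)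
    from DERIV_add[OF this DERIV_cmult_Id[of "Re k / 2"]] show ?thesis .
  qed
  have mono: "Re (\<phi> s) + (Re k / 2) * s \<le> Re (\<phi> b) + (Re k / 2) * b" if "s \<ge> b" for s
  proof (rule DERIV_nonpos_imp_nonincreasing[OF that])
    fix y assume "b \<le> y" "y \<le> s"
    then have "y > 0" "y \<ge> a" by (auto simp: b_def)
    then show "\<exists>d. ((\<lambda>s. Re (\<phi> s) + (Re k / 2) * s) has_real_derivative d) (at y) \<and> d \<le> 0"
      using dRe[of y] a[of y] by (intro exI[of _ "Re (\<psi> y) + Re k / 2"]) auto
  qed
  have "\<forall>\<^sub>F s in at_top. norm (exp (\<phi> s)) \<le> exp (Re (\<phi> b) + (Re k / 2) * b) * exp (- (Re k / 2) * s)"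
    unfolding eventually_at_top_linorder norm_exp_eq_Re exp_add[symmetric]
    using mono by (intro exI[of _ b]) fastforce
  then show ?thesis using exp_gt_zero by blast
qed

lemma filterlim_japanese_bracket:
  "filterlim (japanese_bracket :: 'a::real_normed_vector \<Rightarrow> real) at_top at_infinity"
  using filterlim_at_top_mono[OF filterlim_norm_at_top]
  by (metis always_eventually norm_le_japanese_bracket)

lemma fast_decaying_potential:
  fixes l :: complex and N :: real
  assumes l: "l \<notin> \<real>\<^sub>\<ge>\<^sub>0"
  shows "\<exists>(V :: real ^ 'n::finite \<Rightarrow> complex) u. (\<forall>x. u x \<noteq> 0) \<and> eigen_solution V (\<lambda>_. 0) l u \<and>
     (\<exists>C>0. \<forall>x. norm (V x) \<le> C * japanese_bracket x powr (- N)) \<and>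
     (\<exists>C>0. \<exists>c>0. \<forall>\<^sub>F x in at_infinity. norm (u x) \<le> C * exp (- c * norm x))"
proof -
  define k where "k = csqrt (- l)"
  have k2: "k\<^sup>2 = - l" by (simp add: k_def)
  \<comment> \<open>The principal root has Re k >= 0, and Re k = 0 would make - l = k^2 a
    nonpositive real. This is where the hypothesis on \<open>l\<close> enters.\<close>
  have Rek: "Re k > 0"
  proof (rule ccontr)
    assume "\<not> Re k > 0"
    then have "Re k = 0" using csqrt_principal[of "- l"] by (auto simp: k_def)
    then have "l = of_real ((Im k)\<^sup>2)"
      using k2 by (auto simp: complex_eq_iff power2_eq_square)
    then have "l \<in> \<real>\<^sub>\<ge>\<^sub>0" using nonneg_Reals_of_real_iff zero_le_power2 by metis
    then show False using l by blast
  qed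
  then have k0: "k \<noteq> 0" by auto
  \<comment> \<open>The error will be of order s^-(m + 1), and m + 1 >= N.\<close>
  define m where "m = nat \<lceil>N\<rceil>"
  define d :: complex where "d = of_real (real CARD('n) - 1)"
  obtain p r where p: "poly p 0 = - k"
    "\<And>t. ((poly p t)\<^sup>2 - t\<^sup>2 * poly (pderiv p) t) * (1 - t\<^sup>2) + poly p t * (d * t + t ^ 3)
       = k\<^sup>2 + t ^ Suc m * poly r t"
    using riccati_poly[OF k0, of d m] by blast
  define \<psi> where "\<psi> = (\<lambda>s::real. poly p (of_real (1 / s)))"
  have d\<psi>: "(\<psi> has_vector_derivative - (poly (pderiv p) (of_real (1 / s)) / of_real (s\<^sup>2))) (at s)" if "s > 0" for s
  proof -
    have "((\<lambda>s::real. 1 / s) has_real_derivative - (1 / s\<^sup>2)) (at s)"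
      using that by (auto intro!: derivative_eq_intros simp: power2_eq_square)
    then have "((\<lambda>s. complex_of_real (1 / s)) has_vector_derivative of_real (- (1 / s\<^sup>2))) (at s)"
      by (rule has_vector_derivative_of_real)
    from field_vector_diff_chain_at[OF this poly_DERIV[of p]]
    show ?thesis by (simp add: \<psi>_def o_def)
  qed
  have "isCont \<psi> s" if "s > 0" for s
    using has_vector_derivative_continuous[OF d\<psi>[OF that]] .
  \<comment> \<open>A polynomial in 1 / s may be singular at 0, but the bracket stays at least 1, so
    an antiderivative on s > 0 suffices.\<close>
  then obtain \<phi> where \<phi>: "\<And>s. s > 0 \<Longrightarrow> (\<phi> has_vector_derivative \<psi> s) (at s)"
    using einterval_antiderivative[of 0 \<infinity> \<psi>] by auto
  define f where "f = (\<lambda>s. exp (\<phi> s))"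
  define R where "R = (\<lambda>s. \<psi> s * f s / of_real s)"
  define R1 where "R1 = (\<lambda>s. (- (poly (pderiv p) (of_real (1 / s)) / of_real (s\<^sup>2)) + (\<psi> s)\<^sup>2 - \<psi> s / of_real s) * f s / of_real s)"
  have df: "(f has_vector_derivative \<psi> s * f s) (at s)" if "s > 0" for s
    using field_vector_diff_chain_at[OF \<phi>[OF that] DERIV_exp]
    by (simp add: f_def o_def)
  have df': "(f has_vector_derivative s *\<^sub>R R s) (at s)" if "s > 0" for s
    using df[OF that] that by (simp add: R_def scaleR_conv_of_real)
  have dR: "(R has_vector_derivative R1 s) (at s)" if "s > 0" for s
  proof -
    have "((\<lambda>s::real. 1 / s) has_real_derivative - (1 / s\<^sup>2)) (at s)"
      using that by (auto intro!: derivative_eq_intros simp: power2_eq_square)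
    then have i: "((\<lambda>s. complex_of_real (1 / s)) has_vector_derivative of_real (- (1 / s\<^sup>2))) (at s)"
      by (rule has_vector_derivative_of_real)
    have "((\<lambda>s. \<psi> s * f s * of_real (1 / s)) has_vector_derivative
       \<psi> s * f s * of_real (- (1 / s\<^sup>2)) + (\<psi> s * (\<psi> s * f s) + - (poly (pderiv p) (of_real (1 / s)) / of_real (s\<^sup>2)) * f s) * of_real (1 / s)) (at s)"
      by (intro has_vector_derivative_mult df d\<psi> i that)
    moreover have "\<psi> s * f s * of_real (- (1 / s\<^sup>2)) + (\<psi> s * (\<psi> s * f s) + - (poly (pderiv p) (of_real (1 / s)) / of_real (s\<^sup>2)) * f s) * of_real (1 / s) = R1 s"
      using that by (simp add: R1_def field_simps power2_eq_square)
    ultimately show ?thesis by (simp add: R_def)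
  qed
  have cf: "continuous_on {0<..} f" "continuous_on {0<..} \<psi>"
    using df d\<psi> has_vector_derivative_continuous by (blast intro!: continuous_at_imp_continuous_on)+
  have cR1: "continuous_on {0<..} R1"
    unfolding R1_def using cf by (auto intro!: continuous_intros)
  define u where "u = (\<lambda>x :: real ^ 'n. f (japanese_bracket x))"
  note h2 = has2_radial[OF df' dR cR1, where 'n = 'n]
  have C2: "C2 u"
    unfolding u_def using h2 by (intro C2_if_locally_has2) blast
  have lap: "laplacian u x + l * u x = of_real (1 / japanese_bracket x) ^ Suc m *
      poly r (of_real (1 / japanese_bracket x)) * u x" for x
  proof -
    define s where "s = japanese_bracket x"
    define t where "t = complex_of_real (1 / s)"
    have s: "s > 0" using japanese_bracket_ge_1[of x] by (simp add: s_def)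
    have st: "of_real s * t = 1" using s by (simp add: t_def)
    have ti: "a / of_real s = a * t" "a / of_real (s\<^sup>2) = a * t\<^sup>2" for a
      by (auto simp: t_def divide_inverse power_inverse)
    have n2: "(norm x)\<^sup>2 / s = s - 1 / s"
      using japanese_bracket_power2[of x] s by (simp add: s_def field_simps power2_eq_square)
    have R: "R s = poly p t * u x * t"
      unfolding R_def ti by (simp add: \<psi>_def t_def u_def s_def)
    have R1: "R1 s = (- (poly (pderiv p) t * t\<^sup>2) + (poly p t)\<^sup>2 - poly p t * t) * u x * t"
      unfolding R1_def ti by (simp add: \<psi>_def t_def u_def s_def)
    have "laplacian u x = real CARD('n) *\<^sub>R R s + ((norm x)\<^sup>2 / s) *\<^sub>R R1 s"
      using has2_laplacian[OF h2, of x] by (simp add: u_def s_def)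
    also have "\<dots> = (d + 1) * (poly p t * u x * t) + (of_real s - t) * R1 s"
      unfolding n2 R by (simp add: scaleR_conv_of_real d_def t_def)
    \<comment> \<open>The relation s * t = 1 turns the radial formula into the left side of the
      polynomial identity.\<close>
    also have "\<dots> = (((poly p t)\<^sup>2 - t\<^sup>2 * poly (pderiv p) t) * (1 - t\<^sup>2) + poly p t * (d * t + t ^ 3)) * u x"
      unfolding R1 using st by algebra
    also have "\<dots> = (k\<^sup>2 + t ^ Suc m * poly r t) * u x" unfolding p(2) ..
    finally show ?thesis unfolding k2 by (simp add: t_def s_def algebra_simps)
  qed
  have "compact (poly r ` complex_of_real ` {0..1})"
    by (intro compact_continuous_image continuous_intros compact_Icc)
  then obtain C0 where C0: "\<And>t. 0 \<le> t \<Longrightarrow> t \<le> 1 \<Longrightarrow> norm (poly r (of_real t)) \<le> C0"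
    unfolding bounded_iff[THEN iffD1, OF compact_imp_bounded]
    using compact_imp_bounded bounded_iff by (metis (no_types, lifting) atLeastAtMost_iff imageI)
  define C where "C = max C0 1"
  have C_pos: "C > 0" by (simp add: C_def)
  have bound: "norm (laplacian u x + l * u x) \<le> C * japanese_bracket x powr (- N) * norm (u x)" for x
  proof -
    let ?s = "japanese_bracket x"
    have s: "?s \<ge> 1" by (rule japanese_bracket_ge_1)
    have "norm (poly r (of_real (1 / ?s))) \<le> C" using C0[of "1 / ?s"] s by (auto simp: C_def)
    moreover have "(1 / ?s) ^ Suc m \<le> ?s powr (- N)"
    proof -
      have "(1 / ?s) ^ Suc m = ?s powr (- real (Suc m))"
        using s by (simp add: powr_minus powr_realpow power_divide inverse_eq_divide del: of_nat_Suc power_Suc)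
      also have "\<dots> \<le> ?s powr (- N)"
        using s by (intro powr_mono) (auto simp: m_def, linarith)
      finally show ?thesis .
    qed
    ultimately have "(1 / ?s) ^ Suc m * norm (poly r (of_real (1 / ?s))) \<le> ?s powr (- N) * C"
      using s by (intro mult_mono) (auto simp: C_def)
    then show ?thesis
      unfolding lap norm_mult norm_power norm_of_real
      using s by (intro mult_right_mono) (auto simp: mult.commute simp del: power_Suc)
  qed
  obtain V where V: "eigen_solution V (\<lambda>_. 0) l u" "\<And>x. norm (V x) \<le> C * japanese_bracket x powr (- N)"
    using exists_potential[OF C2 bound C_pos] by auto
  have "(\<psi> \<longlongrightarrow> poly p (of_real 0)) at_top"
    unfolding \<psi>_def
    by (intro tendsto_poly tendsto_of_real tendsto_divide_0[OF tendsto_const] filterlim_at_top_imp_at_infinity filterlim_ident)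
  then have "(\<psi> \<longlongrightarrow> - k) at_top" using p(1) by simp
  then obtain D where D: "D > 0" "\<forall>\<^sub>F s in at_top. norm (exp (\<phi> s)) \<le> D * exp (- (Re k / 2) * s)"
    using norm_exp_decay[OF \<phi> _ Rek] by blast
  have "\<forall>\<^sub>F x in at_infinity. norm (u x) \<le> D * exp (- (Re k / 2) * norm x)"
    using eventually_compose_filterlim[OF D(2) filterlim_japanese_bracket]
  proof eventually_elim
    case (elim x)
    also have "D * exp (- (Re k / 2) * japanese_bracket x) \<le> D * exp (- (Re k / 2) * norm x)"
      using D(1) Rek norm_le_japanese_bracket[of x] by simp
    finally show ?case by (simp add: u_def f_def)
  qed
  then have "\<exists>C>0. \<exists>c>0. \<forall>\<^sub>F x in at_infinity. norm (u x) \<le> C * exp (- c * norm x)"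
    using D(1) Rek half_gt_zero by blast
  moreover have "u x \<noteq> 0" for x by (simp add: u_def f_def)
  ultimately show ?thesis using V C_pos by blast
qed

section \<open>Angular modes in the plane\<close>

lemma has_derivative_cmod:
  fixes z :: complex
  assumes "z \<noteq> 0"
  shows "(norm has_derivative (\<lambda>h. sgn z \<bullet> h)) (at z)"
  using has_derivative_norm[OF assms] by (simp add: inner_commute)

text \<open>For sgn z = exp (i arg z) the differential of arg is Im (h / z), the imaginary part of
  the differential of log z. Working with \<open>sgn\<close> needs no branch of arg.\<close>

lemma has_derivative_sgn_complex:
  fixes z :: complex
  assumes "z \<noteq> 0"
  shows "(sgn has_derivative (\<lambda>h. sgn z * (\<i> * of_real (Im (h / z))))) (at z)"
proof -
  have "((\<lambda>z. z * of_real (inverse (norm z))) has_derivative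
     (\<lambda>h. z * of_real (- (inverse (norm z) * (sgn z \<bullet> h) * inverse (norm z))) + h * of_real (inverse (norm z)))) (at z)"
    using assms
    by (intro has_derivative_mult[OF has_derivative_ident has_derivative_of_real[OF
          Deriv.has_derivative_inverse[OF _ has_derivative_cmod]]]) simp_all
  moreover have "(\<lambda>z::complex. z * of_real (inverse (norm z))) = sgn"
    by (auto simp: sgn_div_norm scaleR_conv_of_real mult.commute)
  moreover have "z * of_real (- (inverse (norm z) * (sgn z \<bullet> h) * inverse (norm z))) + h * of_real (inverse (norm z))
     = sgn z * (\<i> * of_real (Im (h / z)))" for h
  proof -
    define q where "q = h / z"
    have h: "h = q * z" using assms by (simp add: q_def)
    have "z \<bullet> h = Re q * (norm z)\<^sup>2"
      unfolding h cmod_power2 by (simp add: inner_complex_def power2_eq_square algebra_simps)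
    then have i: "inverse (norm z) * (sgn z \<bullet> h) * inverse (norm z) = Re q * inverse (norm z)"
      using assms by (simp add: sgn_div_norm power2_eq_square field_simps)
    have sg: "sgn z = z * of_real (inverse (norm z))"
      by (simp add: sgn_div_norm scaleR_conv_of_real mult.commute)
    define r where "r = complex_of_real (inverse (norm z))"
    have "z * of_real (- (Re q * inverse (norm z))) + q * z * r = (q - of_real (Re q)) * (z * r)"
      by (simp add: r_def algebra_simps)
    also have "q - of_real (Re q) = \<i> * of_real (Im q)" by (simp add: complex_eq_iff)
    finally show ?thesis
      unfolding i q_def[symmetric] unfolding sg r_def[symmetric] unfolding h by (simp only: ac_simps)
  qed
  ultimately show ?thesis by simp
qed

lemma has_derivative_ln_norm:
  fixes z :: complex
  assumes "z \<noteq> 0"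
  shows "((\<lambda>z. ln (norm z)) has_derivative (\<lambda>h. Re (h / z))) (at z)"
proof -
  have "((\<lambda>z. ln (norm z)) has_derivative (\<lambda>h. (sgn z \<bullet> h) * inverse (norm z))) (at z)"
    using assms by (intro has_derivative_ln has_derivative_cmod) auto
  moreover have "(sgn z \<bullet> h) * inverse (norm z) = Re (h / z)" for h
    using assms by (simp add: sgn_div_norm inner_complex_def Re_divide' power2_eq_square field_simps)
  ultimately show ?thesis by simp
qed

text \<open>The function P(log r) exp (i n \<theta>); an integer power of \<open>sgn z\<close> makes
  it single-valued on the punctured plane for either sign of \<open>n\<close>.\<close>

definition mode :: "(real \<Rightarrow> complex) \<Rightarrow> int \<Rightarrow> complex \<Rightarrow> complex" where
  "mode P n z = P (ln (norm z)) * sgn z powi n"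

lemma has_derivative_mode:
  fixes z :: complex
  assumes "z \<noteq> 0" "(P has_vector_derivative P1 (ln (norm z))) (at (ln (norm z)))"
  shows "(mode P n has_derivative (\<lambda>h. mode P1 n z * of_real (Re (h / z))
     + \<i> * of_int n * mode P n z * of_real (Im (h / z)))) (at z)"
proof -
  have s0: "sgn z \<noteq> 0" using assms(1) by (simp add: sgn_zero_iff)
  have s: "((\<lambda>z. sgn z powi n) has_derivative (\<lambda>h. (sgn z * (\<i> * of_real (Im (h / z)))) * (of_int n * sgn z powi (n - 1)))) (at z)"
    by (rule has_derivative_power_int[OF s0 has_derivative_sgn_complex[OF assms(1)]])
  have P: "((\<lambda>z. P (ln (norm z))) has_derivative (\<lambda>h. Re (h / z) *\<^sub>R P1 (ln (norm z)))) (at z)"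
    using has_derivative_compose[OF has_derivative_ln_norm[OF assms(1)],
        of P "\<lambda>y. y *\<^sub>R P1 (ln (norm z))"] assms(2)
    unfolding has_vector_derivative_def by simp
  have "sgn z powi n = sgn z * sgn z powi (n - 1)"
    using s0 by (simp add: power_int_diff)
  then have "P (ln (norm z)) * ((sgn z * (\<i> * of_real (Im (h / z)))) * (of_int n * sgn z powi (n - 1)))
      + Re (h / z) *\<^sub>R P1 (ln (norm z)) * sgn z powi n
    = mode P1 n z * of_real (Re (h / z)) + \<i> * of_int n * mode P n z * of_real (Im (h / z))" for h
    unfolding mode_def scaleR_conv_of_real by (auto simp: algebra_simps)
  with has_derivative_mult[OF P s] show ?thesis
    unfolding mode_def by simp
qed

lemma continuous_on_mode:
  assumes "\<And>\<rho>. isCont P \<rho>"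
  shows "continuous_on (- {0}) (mode P n)"
proof -
  have P: "continuous_on UNIV P"
    using assms by (simp add: continuous_at_imp_continuous_on)
  have "continuous_on (- {0}) (\<lambda>z::complex. ln (norm z))"
    by (intro continuous_intros) auto
  then have "continuous_on (- {0}) (\<lambda>z::complex. P (ln (norm z)))"
    by (rule continuous_on_compose2[OF P]) auto
  moreover have "continuous_on (- {0}) (sgn :: complex \<Rightarrow> complex)"
    using has_derivative_continuous[OF has_derivative_sgn_complex]
    by (intro continuous_at_imp_continuous_on) auto
  then have "continuous_on (- {0}) (\<lambda>z::complex. sgn z powi n)"
    by (rule continuous_on_power_int) (auto simp: sgn_zero_iff)
  ultimately show ?thesis
    unfolding mode_def by (rule continuous_on_mult)
qed

locale plane =
  fixes i1 i2 :: "'n::finite"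
  assumes distinct: "i1 \<noteq> i2" and UNIV_eq: "UNIV = {i1, i2}"
begin

definition Z :: "real ^ 'n \<Rightarrow> complex" where "Z x = Complex (x $ i1) (x $ i2)"

text \<open>The image under \<open>Z\<close> of the basis vector with index
  \<open>j\<close>.\<close>

definition w :: "'n \<Rightarrow> complex" where "w j = (if j = i1 then 1 else \<i>)"

lemma sum_plane: "(\<Sum>j\<in>UNIV. f j) = f i1 + f i2"
  using distinct by (simp add: UNIV_eq)

lemma sum_w: "(\<Sum>j\<in>UNIV. h $ j *\<^sub>R w j) = Z h"
  using distinct by (simp add: sum_plane w_def Z_def complex_eq_iff)

lemma linear_Z: "linear Z"
  by (rule linearI) (auto simp: Z_def complex_eq_iff)

lemma has_derivative_Z: "(Z has_derivative Z) (at x)"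
  using linear_Z linear_conv_bounded_linear by (blast intro: bounded_linear_imp_has_derivative)

lemma norm_Z: "norm (Z x) = norm x"
  by (simp add: Z_def complex_norm norm_vec_def L2_set_def sum_plane)

lemma Z_eq_0: "Z x = 0 \<longleftrightarrow> x = 0"
  using norm_Z[of x] by (metis norm_eq_zero)

lemma continuous_on_Z: "continuous_on A Z"
  using has_derivative_Z has_derivative_continuous by (blast intro: continuous_at_imp_continuous_on)

lemma sum_Re_Im:
  fixes a b :: complex
  shows "(\<Sum>j\<in>UNIV. h $ j *\<^sub>R (a * of_real (Re (w j * c)) + b * of_real (Im (w j * c))))
    = a * of_real (Re (Z h * c)) + b * of_real (Im (Z h * c))"
  using distinct unfolding sum_plane
  by (simp add: w_def Z_def complex_eq_iff algebra_simps)

text \<open>In log-polar coordinates r^2 \<Delta> is the sum of the second derivatives in log r and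
  \<theta>, and the latter acts on exp (i n \<theta>) as - n^2.\<close>

lemma has2_mode:
  assumes P: "\<And>\<rho>. (P has_vector_derivative P1 \<rho>) (at \<rho>)"
    and P1: "\<And>\<rho>. (P1 has_vector_derivative P2 \<rho>) (at \<rho>)"
    and P2: "\<And>\<rho>. isCont P2 \<rho>"
  shows "has2 (- {0}) (\<lambda>x. mode P n (Z x))
    (\<lambda>j x. mode P1 n (Z x) * of_real (Re (w j / Z x)) + (\<i> * of_int n * mode P n (Z x)) * of_real (Im (w j / Z x)))
    (\<lambda>x. (mode P2 n (Z x) - (of_int n)\<^sup>2 * mode P n (Z x)) / of_real ((norm x)\<^sup>2))"
proof -
  \<comment> \<open>The first two lines differentiate the amplitudes along log r and \<theta>; the
    last one comes from the derivative of \<open>w j / Z x\<close>, which is - w_j w_k /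
    Z^2.\<close>
  define q where "q = (\<lambda>j k x.
     (mode P2 n (Z x) * of_real (Re (w j / Z x)) + \<i> * of_int n * mode P1 n (Z x) * of_real (Im (w j / Z x))) * of_real (Re (w k * inverse (Z x)))
   + (\<i> * of_int n * mode P1 n (Z x) * of_real (Re (w j / Z x)) - (of_int n)\<^sup>2 * mode P n (Z x) * of_real (Im (w j / Z x))) * of_real (Im (w k * inverse (Z x)))
   - (mode P1 n (Z x) * of_real (Re (w k * (w j / (Z x)\<^sup>2))) + (\<i> * of_int n * mode P n (Z x)) * of_real (Im (w k * (w j / (Z x)\<^sup>2)))))"
  show ?thesis
    unfolding has2_def
  proof (intro conjI exI[of _ q] allI ballI)
    fix x :: "real ^ 'n" assume "x \<in> - {0}"
    then have x: "Z x \<noteq> 0" by (simp add: Z_eq_0)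
    have dm: "((\<lambda>x. mode P n (Z x)) has_derivative (\<lambda>h. mode P1 n (Z x) * of_real (Re (Z h / Z x))
        + \<i> * of_int n * mode P n (Z x) * of_real (Im (Z h / Z x)))) (at x)"
      by (rule has_derivative_compose[OF has_derivative_Z has_derivative_mode]) (use x P in auto)
    have dm1: "((\<lambda>x. mode P1 n (Z x)) has_derivative (\<lambda>h. mode P2 n (Z x) * of_real (Re (Z h / Z x))
        + \<i> * of_int n * mode P1 n (Z x) * of_real (Im (Z h / Z x)))) (at x)"
      by (rule has_derivative_compose[OF has_derivative_Z has_derivative_mode]) (use x P1 in auto)
    show "((\<lambda>x. mode P n (Z x)) has_derivative (\<lambda>h. \<Sum>j\<in>UNIV. h $ j *\<^sub>R
       (mode P1 n (Z x) * of_real (Re (w j / Z x)) + (\<i> * of_int n * mode P n (Z x)) * of_real (Im (w j / Z x))))) (at x)"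
      using dm unfolding divide_inverse sum_Re_Im by simp
    fix j
    have "((\<lambda>x. w j / Z x) has_derivative (\<lambda>h. - (w j * Z h / (Z x)\<^sup>2))) (at x)"
      using x by (auto intro!: derivative_eq_intros has_derivative_Z simp: power2_eq_square field_simps)
    note d = this
    have dRe: "((\<lambda>x. complex_of_real (Re (w j / Z x))) has_derivative (\<lambda>h. of_real (Re (- (w j * Z h / (Z x)\<^sup>2))))) (at x)"
      by (rule has_derivative_of_real[OF bounded_linear.has_derivative[OF bounded_linear_Re d]])
    have dIm: "((\<lambda>x. complex_of_real (Im (w j / Z x))) has_derivative (\<lambda>h. of_real (Im (- (w j * Z h / (Z x)\<^sup>2))))) (at x)"
      by (rule has_derivative_of_real[OF bounded_linear.has_derivative[OF bounded_linear_Im d]])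
    have dp: "((\<lambda>x. mode P1 n (Z x) * of_real (Re (w j / Z x)) + (\<i> * of_int n * mode P n (Z x)) * of_real (Im (w j / Z x)))
      has_derivative (\<lambda>h. (mode P1 n (Z x) * of_real (Re (- (w j * Z h / (Z x)\<^sup>2))) +
         (mode P2 n (Z x) * of_real (Re (Z h / Z x)) + \<i> * of_int n * mode P1 n (Z x) * of_real (Im (Z h / Z x))) * of_real (Re (w j / Z x)))
        + ((\<i> * of_int n * mode P n (Z x)) * of_real (Im (- (w j * Z h / (Z x)\<^sup>2)))
         + (\<i> * of_int n * (mode P1 n (Z x) * of_real (Re (Z h / Z x)) + \<i> * of_int n * mode P n (Z x) * of_real (Im (Z h / Z x)))) * of_real (Im (w j / Z x))))) (at x)"
      by (rule has_derivative_add[OF has_derivative_mult[OF dm1 dRe]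
          has_derivative_mult[OF has_derivative_mult_right[OF dm] dIm]])
    have "(\<Sum>k\<in>UNIV. h $ k *\<^sub>R q j k x) = (mode P1 n (Z x) * of_real (Re (- (w j * Z h / (Z x)\<^sup>2))) +
         (mode P2 n (Z x) * of_real (Re (Z h / Z x)) + \<i> * of_int n * mode P1 n (Z x) * of_real (Im (Z h / Z x))) * of_real (Re (w j / Z x)))
        + ((\<i> * of_int n * mode P n (Z x)) * of_real (Im (- (w j * Z h / (Z x)\<^sup>2)))
         + (\<i> * of_int n * (mode P1 n (Z x) * of_real (Re (Z h / Z x)) + \<i> * of_int n * mode P n (Z x) * of_real (Im (Z h / Z x)))) * of_real (Im (w j / Z x)))" for h
    proof -
      have e: "Z h * inverse (Z x) = Z h / Z x" "Z h * (w j / (Z x)\<^sup>2) = w j * Z h / (Z x)\<^sup>2"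
        by (simp_all add: divide_inverse ac_simps)
      define A where "A = mode P n (Z x)"
      define B where "B = mode P1 n (Z x)"
      define C where "C = mode P2 n (Z x)"
      define n' where "n' = complex_of_int n"
      define r1 where "r1 = complex_of_real (Re (Z h / Z x))"
      define r2 where "r2 = complex_of_real (Im (Z h / Z x))"
      define r3 where "r3 = complex_of_real (Re (w j / Z x))"
      define r4 where "r4 = complex_of_real (Im (w j / Z x))"
      define r5 where "r5 = complex_of_real (Re (w j * Z h / (Z x)\<^sup>2))"
      define r6 where "r6 = complex_of_real (Im (w j * Z h / (Z x)\<^sup>2))"
      have i2: "\<i> * \<i> = -1" by simp
      have "(\<Sum>k\<in>UNIV. h $ k *\<^sub>R q j k x)
        = (C * r3 + \<i> * n' * B * r4) * r1 + (\<i> * n' * B * r3 - n'\<^sup>2 * A * r4) * r2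
          - (B * r5 + (\<i> * n' * A) * r6)"
        unfolding q_def scaleR_diff_right sum_subtractf sum_Re_Im e
        by (simp only: A_def B_def C_def n'_def r1_def r2_def r3_def r4_def r5_def r6_def)
      also have "\<dots> = (B * (- r5) + (C * r1 + \<i> * n' * B * r2) * r3)
          + ((\<i> * n' * A) * (- r6) + (\<i> * n' * (B * r1 + \<i> * n' * A * r2)) * r4)"
        using i2 by algebra
      finally show ?thesis
        unfolding uminus_complex.sel of_real_minus
        by (simp only: A_def B_def C_def n'_def r1_def r2_def r3_def r4_def r5_def r6_def)
    qed
    with dp show "((\<lambda>x. mode P1 n (Z x) * of_real (Re (w j / Z x)) + (\<i> * of_int n * mode P n (Z x)) * of_real (Im (w j / Z x)))
      has_derivative (\<lambda>h. \<Sum>k\<in>UNIV. h $ k *\<^sub>R q j k x)) (at x)" by simp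
  next
    have [simp]: "continuous_on (- {0}) (\<lambda>x. mode Q n (Z x))" if "\<And>\<rho>. isCont Q \<rho>" for Q
      by (rule continuous_on_compose2[OF continuous_on_mode[OF that] continuous_on_Z]) (auto simp: Z_eq_0)
    have [simp]: "isCont P \<rho>" "isCont P1 \<rho>" for \<rho>
      using P P1 has_vector_derivative_continuous by blast+
    show "continuous_on (- {0}) (q j k)" for j k
      unfolding q_def using P2
      by (intro continuous_intros continuous_on_Z) (auto simp: Z_eq_0)
  next
    fix x :: "real ^ 'n" assume "x \<in> - {0}"
    then have x: "Z x \<noteq> 0" by (simp add: Z_eq_0)
    define c where "c = inverse (Z x)"
    have c: "of_real ((Re c)\<^sup>2 + (Im c)\<^sup>2) = inverse (complex_of_real ((norm x)\<^sup>2))"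
      unfolding norm_Z[symmetric] c_def cmod_power2[symmetric] by (simp add: norm_inverse power_inverse)
    have wi: "w i1 = 1" "w i2 = \<i>" using distinct by (auto simp: w_def)
    have e: "w j / Z x = w j * c" "w j * (w j / (Z x)\<^sup>2) = (w j * w j) * c\<^sup>2" for j
      by (simp_all add: c_def divide_inverse power_inverse)
    define A where "A = mode P n (Z x)"
    define B where "B = mode P1 n (Z x)"
    define C where "C = mode P2 n (Z x)"
    define n' where "n' = complex_of_int n"
    define r1 where "r1 = complex_of_real (Re c)"
    define r2 where "r2 = complex_of_real (Im c)"
    define r3 where "r3 = complex_of_real (Re (c\<^sup>2))"
    define r4 where "r4 = complex_of_real (Im (c\<^sup>2))"
    have qj: "q j j x = (C * of_real (Re (w j * c)) + \<i> * n' * B * of_real (Im (w j * c))) * of_real (Re (w j * c))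
        + (\<i> * n' * B * of_real (Re (w j * c)) - n'\<^sup>2 * A * of_real (Im (w j * c))) * of_real (Im (w j * c))
        - (B * of_real (Re (w j * w j * c\<^sup>2)) + (\<i> * n' * A) * of_real (Im (w j * w j * c\<^sup>2)))" for j
      unfolding q_def e c_def[symmetric] by (simp only: A_def B_def C_def n'_def)
    have q1: "q i1 i1 x = (C * r1 + \<i> * n' * B * r2) * r1 + (\<i> * n' * B * r1 - n'\<^sup>2 * A * r2) * r2
        - (B * r3 + (\<i> * n' * A) * r4)"
      unfolding qj wi by (simp only: r1_def r2_def r3_def r4_def mult_1)
    have ii: "\<i> * \<i> * c\<^sup>2 = - (c\<^sup>2)" "Re (\<i> * c) = - Im c" "Im (\<i> * c) = Re c"
      by (simp_all add: power2_eq_square)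
    have q2: "q i2 i2 x = (C * (- r2) + \<i> * n' * B * r1) * (- r2) + (\<i> * n' * B * (- r2) - n'\<^sup>2 * A * r1) * r1
        - (B * (- r3) + (\<i> * n' * A) * (- r4))"
      unfolding qj wi ii uminus_complex.sel of_real_minus
      by (simp only: r1_def r2_def r3_def r4_def)
    \<comment> \<open>The squares of the two \<open>w\<close> add up to 0, so the terms with c^2 and
      the mixed terms cancel in the trace; only |c|^2 = 1 / r^2 survives.\<close>
    have "(\<Sum>j\<in>UNIV. q j j x) = (C - n'\<^sup>2 * A) * (r1\<^sup>2 + r2\<^sup>2)"
      unfolding sum_plane q1 q2 by algebra
    then have "(\<Sum>j\<in>UNIV. q j j x) = (mode P2 n (Z x) - (of_int n)\<^sup>2 * mode P n (Z x)) * of_real ((Re c)\<^sup>2 + (Im c)\<^sup>2)"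
      by (simp only: A_def C_def n'_def r1_def r2_def of_real_add of_real_power)
    then show "(mode P2 n (Z x) - (of_int n)\<^sup>2 * mode P n (Z x)) / of_real ((norm x)\<^sup>2) = (\<Sum>j\<in>UNIV. q j j x)"
      unfolding c by (simp add: divide_inverse)
  qed auto
qed

lemma has2_power:
  "has2 UNIV (\<lambda>x. c * Z x ^ n) (\<lambda>j x. c * of_nat n * Z x ^ (n - 1) * w j) (\<lambda>x. 0)"
proof -
  have d: "((\<lambda>x. a * Z x ^ m) has_derivative (\<lambda>h. a * of_nat m * Z x ^ (m - 1) * Z h)) (at x)" for a m x
  proof -
    have "((\<lambda>x. Z x ^ m) has_derivative (\<lambda>h. of_nat m * Z h * Z x ^ (m - 1))) (at x)"
      by (rule has_derivative_power[OF has_derivative_Z])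
    from has_derivative_mult_right[OF this, of a] show ?thesis by (simp add: ac_simps)
  qed
  have s: "(\<Sum>j\<in>UNIV. h $ j *\<^sub>R (a * w j)) = a * Z h" for a h
    unfolding sum_w[symmetric] sum_distrib_left by (simp add: mult.commute)
  show ?thesis
    unfolding has2_def
  proof (intro conjI exI[of _ "\<lambda>j k x. c * of_nat n * of_nat (n - 1) * Z x ^ (n - 1 - 1) * w j * w k"] allI ballI)
    fix x
    show "((\<lambda>x. c * Z x ^ n) has_derivative (\<lambda>h. \<Sum>j\<in>UNIV. h $ j *\<^sub>R (c * of_nat n * Z x ^ (n - 1) * w j))) (at x)"
      unfolding s by (rule d)
    show "((\<lambda>x. c * of_nat n * Z x ^ (n - 1) * w j) has_derivative
       (\<lambda>h. \<Sum>k\<in>UNIV. h $ k *\<^sub>R (c * of_nat n * of_nat (n - 1) * Z x ^ (n - 1 - 1) * w j * w k))) (at x)" for j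
      unfolding s using d[of "c * of_nat n * w j" "n - 1" x] by (simp add: ac_simps)
    show "0 = (\<Sum>j\<in>UNIV. c * of_nat n * of_nat (n - 1) * Z x ^ (n - 1 - 1) * w j * w j)"
      using distinct by (simp add: sum_plane w_def mult.assoc)
  qed (auto intro!: continuous_intros continuous_on_Z)
qed

text \<open>\<open>a\<close> and \<open>b\<close> are the derivatives along log r and \<theta>.
  Evaluating the differential at z and at i z recovers them, each as a sum of two products of at
  most |z| times the gradient; hence the constant 4.\<close>

lemma polar_gradient_ge:
  fixes a b :: complex
  assumes "x \<noteq> 0"
  shows "norm a + norm b \<le> 4 * norm x * norm (\<chi> j. a * of_real (Re (w j / Z x)) + b * of_real (Im (w j / Z x)))"
proof -
  define p where "p = (\<lambda>j. a * of_real (Re (w j / Z x)) + b * of_real (Im (w j / Z x)))"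
  define z where "z = Z x"
  have z: "z \<noteq> 0" using assms by (simp add: z_def Z_eq_0)
  have e: "a * of_real (Re (y / z)) + b * of_real (Im (y / z)) = p i1 * of_real (Re y) + p i2 * of_real (Im y)" for y
  proof -
    define c where "c = inverse z"
    show ?thesis
      unfolding p_def w_def z_def[symmetric] divide_inverse c_def[symmetric] using distinct
      by (simp add: algebra_simps)
  qed
  have a: "a = p i1 * of_real (Re z) + p i2 * of_real (Im z)"
    using e[of z] z by simp
  have b: "b = p i1 * of_real (- Im z) + p i2 * of_real (Re z)"
    using e[of "\<i> * z"] z by simp
  have pn: "norm (p j) \<le> norm (\<chi> j. p j)" for j
    using Finite_Cartesian_Product.norm_nth_le[of "\<chi> j. p j" j] by simp
  have nz: "norm x = norm z" by (simp add: z_def norm_Z)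
  have t: "norm (p i1 * of_real s + p i2 * of_real t) \<le> norm (\<chi> j. p j) * norm z + norm (\<chi> j. p j) * norm z"
    if "\<bar>s\<bar> \<le> norm z" "\<bar>t\<bar> \<le> norm z" for s t
    using that by (intro order_trans[OF norm_triangle_ineq] add_mono) (auto simp: norm_mult intro!: mult_mono pn)
  have "norm a \<le> norm (\<chi> j. p j) * norm z + norm (\<chi> j. p j) * norm z"
    unfolding a by (rule t) (auto simp: abs_Re_le_cmod abs_Im_le_cmod)
  moreover have "norm b \<le> norm (\<chi> j. p j) * norm z + norm (\<chi> j. p j) * norm z"
    unfolding b by (rule t) (auto simp: abs_Re_le_cmod abs_Im_le_cmod)
  ultimately show ?thesis unfolding p_def nz by (simp add: algebra_simps)
qed

end

section \<open>Smooth transitions and the radial profile\<close>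

definition tpow :: "nat \<Rightarrow> real \<Rightarrow> real" where "tpow n s = (max 0 s) ^ n"

lemma tpow_nonpos: "s \<le> 0 \<Longrightarrow> n > 0 \<Longrightarrow> tpow n s = 0"
  and tpow_nonneg: "s \<ge> 0 \<Longrightarrow> tpow n s = s ^ n"
  by (auto simp: tpow_def max_def)

text \<open>Only the joint s = 0 needs an argument: the difference quotient there is at most
  |h|^(n+1).\<close>

lemma tpow_deriv: "(tpow (Suc (Suc n)) has_real_derivative real (Suc (Suc n)) * tpow (Suc n) s) (at s)"
proof -
  consider "s < 0" | "s = 0" | "s > 0" by linarith
  then show ?thesis
  proof cases
    case 1
    have "((\<lambda>_. 0 :: real) has_real_derivative 0) (at s)" by simp
    then have "(tpow (Suc (Suc n)) has_real_derivative 0) (at s)"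
      by (rule has_field_derivative_transform_within_open[where S = "{..<0}"])
         (use 1 in \<open>auto simp: tpow_nonpos\<close>)
    then show ?thesis using 1 by (simp add: tpow_nonpos)
  next
    case 2
    have "((\<lambda>h. (tpow (Suc (Suc n)) (0 + h) - tpow (Suc (Suc n)) 0) / h) \<longlongrightarrow> 0) (at 0)"
    proof (rule Lim_null_comparison)
      show "\<forall>\<^sub>F h in at 0. norm ((tpow (Suc (Suc n)) (0 + h) - tpow (Suc (Suc n)) 0) / h) \<le> \<bar>h\<bar> ^ Suc n"
      proof (intro always_eventually allI)
        fix h :: real
        show "norm ((tpow (Suc (Suc n)) (0 + h) - tpow (Suc (Suc n)) 0) / h) \<le> \<bar>h\<bar> ^ Suc n"
        proof (cases "h \<ge> 0")
          case True
          then show ?thesis by (auto simp: tpow_nonneg abs_mult power_abs)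
        next
          case False
          then show ?thesis by (simp add: tpow_nonpos del: power_Suc)
        qed
      qed
      have "((\<lambda>h::real. \<bar>h\<bar> ^ Suc n) \<longlongrightarrow> \<bar>0\<bar> ^ Suc n) (at 0)"
        by (intro tendsto_intros)
      then show "((\<lambda>h::real. \<bar>h\<bar> ^ Suc n) \<longlongrightarrow> 0) (at 0)" by simp
    qed
    then show ?thesis using 2 by (simp add: DERIV_def tpow_nonpos)
  next
    case 3
    have "((\<lambda>s. s ^ Suc (Suc n)) has_real_derivative real (Suc (Suc n)) * s ^ Suc n) (at s)"
      by (rule DERIV_cong[OF DERIV_pow]) simp
    then have "(tpow (Suc (Suc n)) has_real_derivative real (Suc (Suc n)) * s ^ Suc n) (at s)"
      by (rule has_field_derivative_transform_within_open[where S = "{0<..}"])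
         (use 3 in \<open>auto simp: tpow_nonneg simp del: power_Suc\<close>)
    then show ?thesis using 3 by (simp add: tpow_nonneg)
  qed
qed

text \<open>The quintic smoothstep written in truncated powers, which makes it visibly \<open>C\<^sup>2\<close>.\<close>

definition smoothstep :: "real \<Rightarrow> real" where
  "smoothstep s = 10 * tpow 3 s - 15 * tpow 4 s + 6 * tpow 5 s
     - (10 * tpow 3 (s - 1) + 15 * tpow 4 (s - 1) + 6 * tpow 5 (s - 1))"

definition smoothstep1 :: "real \<Rightarrow> real" where
  "smoothstep1 s = 30 * tpow 2 s - 60 * tpow 3 s + 30 * tpow 4 s
     - (30 * tpow 2 (s - 1) + 60 * tpow 3 (s - 1) + 30 * tpow 4 (s - 1))"

definition smoothstep2 :: "real \<Rightarrow> real" where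
  "smoothstep2 s = 60 * tpow 1 s - 180 * tpow 2 s + 120 * tpow 3 s
     - (60 * tpow 1 (s - 1) + 180 * tpow 2 (s - 1) + 120 * tpow 3 (s - 1))"

lemma tpow_deriv_chain [derivative_intros]:
  assumes "n \<ge> 2" "(f has_real_derivative f') (at s)"
  shows "((\<lambda>s. tpow n (f s)) has_real_derivative real n * tpow (n - 1) (f s) * f') (at s)"
proof -
  obtain m where "n = Suc (Suc m)" using assms(1) by (metis add_2_eq_Suc le_Suc_ex)
  then show ?thesis using DERIV_chain2[OF tpow_deriv[of m "f s"] assms(2)] by simp
qed

lemma smoothstep_deriv: "(smoothstep has_real_derivative smoothstep1 s) (at s)"
  unfolding smoothstep_def[abs_def] smoothstep1_def
  by (rule derivative_eq_intros refl | simp)+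

lemma smoothstep1_deriv: "(smoothstep1 has_real_derivative smoothstep2 s) (at s)"
  unfolding smoothstep2_def smoothstep1_def[abs_def]
  by (rule derivative_eq_intros refl | simp)+

lemma smoothstep2_cont: "isCont smoothstep2 s"
  unfolding smoothstep2_def[abs_def] tpow_def by (intro continuous_intros)

lemma smoothstep_le_0:
  assumes "s \<le> 0"
  shows "smoothstep s = 0" "smoothstep1 s = 0" "smoothstep2 s = 0"
  using assms by (auto simp: smoothstep_def smoothstep1_def smoothstep2_def tpow_nonpos)

lemma smoothstep_ge_1:
  assumes "s \<ge> 1"
  shows "smoothstep s = 1" "smoothstep1 s = 0" "smoothstep2 s = 0"
  using assms by (auto simp: smoothstep_def smoothstep1_def smoothstep2_def tpow_nonneg) algebra+

lemma smoothstep_between: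
  assumes "0 \<le> s" "s \<le> 1"
  shows "smoothstep s = 10 * s ^ 3 - 15 * s ^ 4 + 6 * s ^ 5"
    "smoothstep1 s = 30 * s ^ 2 - 60 * s ^ 3 + 30 * s ^ 4"
    "smoothstep2 s = 60 * s - 180 * s ^ 2 + 120 * s ^ 3"
  using assms by (auto simp: smoothstep_def smoothstep1_def smoothstep2_def tpow_nonneg tpow_nonpos)

text \<open>The variable x = 1 - 2 s is centred at the midpoint, where the zeros of the solution
  will lie: 1 - 2 * smoothstep is odd in x, the first derivative is even, and the second is odd and
  so vanishes there.\<close>

lemma smoothstep_centred:
  fixes x :: real
  assumes "\<bar>x\<bar> \<le> 1"
  defines "s \<equiv> (1 - x) / 2"
  shows "smoothstep s = (1 - x * (15 - 10 * x\<^sup>2 + 3 * x ^ 4) / 8) / 2"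
    "smoothstep1 s = 15 / 8 * (1 - x\<^sup>2)\<^sup>2" "smoothstep2 s = 15 * x * (1 - x\<^sup>2)"
proof -
  have s: "0 \<le> s" "s \<le> 1" "x = 1 - 2 * s" using assms by (auto simp: field_simps)
  show "smoothstep s = (1 - x * (15 - 10 * x\<^sup>2 + 3 * x ^ 4) / 8) / 2"
    "smoothstep1 s = 15 / 8 * (1 - x\<^sup>2)\<^sup>2" "smoothstep2 s = 15 * x * (1 - x\<^sup>2)"
    unfolding smoothstep_between[OF s(1,2)] s(3) by (simp_all add: field_simps) algebra+
qed

text \<open>Cutoff for the third harmonic: it vanishes with two derivatives at both ends of a cell
  and is 1 at the midpoint. Being 1 - (1 - 2 S)^2 for the smoothstep S, it differs from 1 only
  quadratically in 1 - 2 S.\<close>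

definition bump :: "real \<Rightarrow> real" where "bump s = 4 * smoothstep s * (1 - smoothstep s)"
definition bump1 :: "real \<Rightarrow> real" where "bump1 s = 4 * smoothstep1 s * (1 - 2 * smoothstep s)"
definition bump2 :: "real \<Rightarrow> real" where "bump2 s = 4 * smoothstep2 s * (1 - 2 * smoothstep s) - 8 * (smoothstep1 s)\<^sup>2"

lemma bump_deriv: "(bump has_real_derivative bump1 s) (at s)"
  unfolding bump_def[abs_def] bump1_def
  by (rule derivative_eq_intros smoothstep_deriv refl | simp add: algebra_simps)+

lemma bump1_deriv: "(bump1 has_real_derivative bump2 s) (at s)"
  unfolding bump1_def[abs_def] bump2_def
  by (rule derivative_eq_intros smoothstep_deriv smoothstep1_deriv refl | simp add: algebra_simps power2_eq_square)+

lemma bump2_cont: "isCont bump2 s"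
  unfolding bump2_def[abs_def]
  using DERIV_isCont[OF smoothstep_deriv] DERIV_isCont[OF smoothstep1_deriv] smoothstep2_cont
  by (intro continuous_intros)

lemma einterval_antiderivative_UNIV:
  fixes f :: "real \<Rightarrow> complex"
  assumes "\<And>x. isCont f x"
  shows "\<exists>F. \<forall>x. (F has_vector_derivative f x) (at x)"
  using einterval_antiderivative[of "-\<infinity>" \<infinity> f] assms by auto

text \<open>For \<open>t \<ge> n\<close> the shift by \<open>\<mu> / 2\<close> in \<open>K = J + \<mu> / 2\<close> cancels the first-order term of the radial
  operator; for \<open>t \<le> n - 1\<close> the factor \<open>exp (- \<Phi>)\<close> is the monomial \<open>r\<^bsup>n\<^sup>2\<^esup>\<close>, up to a constant.\<close>

locale profile =
  fixes \<mu> :: real and l :: complex and n :: nat and J J1 K K1 \<Phi> :: "real \<Rightarrow> complex"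
  assumes mu: "1 / 2 < \<mu>" "\<mu> \<le> 1"
    and n: "even n" "n \<ge> 1000"
    and dK: "\<And>\<rho>. (K has_vector_derivative K1 \<rho>) (at \<rho>)"
    and cK1: "\<And>\<rho>. isCont K1 \<rho>"
    and dPhi: "\<And>\<rho>. (\<Phi> has_vector_derivative K \<rho>) (at \<rho>)"
    and K_inner: "\<And>\<rho>. exp (\<mu> * \<rho>) \<le> real n - 1 \<Longrightarrow> K \<rho> = - of_nat (n\<^sup>2) \<and> K1 \<rho> = 0"
    and K_outer: "\<And>\<rho>. exp (\<mu> * \<rho>) \<ge> real n \<Longrightarrow> K \<rho> = J \<rho> + of_real (\<mu> / 2) \<and> K1 \<rho> = J1 \<rho>"
    and dJ: "\<And>\<rho>. exp (\<mu> * \<rho>) \<ge> real n \<Longrightarrow> (J has_vector_derivative J1 \<rho>) (at \<rho>)"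
    and J_square: "\<And>\<rho>. exp (\<mu> * \<rho>) \<ge> real n \<Longrightarrow>
      (J \<rho>)\<^sup>2 = of_real (exp (\<mu> * \<rho>) ^ 4) - l * of_real (exp \<rho> ^ 2)"
    and J_approx: "\<And>\<rho>. exp (\<mu> * \<rho>) \<ge> real n \<Longrightarrow>
      norm (J \<rho> - of_real (exp (\<mu> * \<rho>) ^ 2)) \<le> exp (\<mu> * \<rho>) ^ 2 / 64"
    and J1_bound: "\<And>\<rho>. exp (\<mu> * \<rho>) \<ge> real n \<Longrightarrow> norm (J1 \<rho>) \<le> 3 * exp (\<mu> * \<rho>) ^ 2"

text \<open>J is a square root of t^4 - \<lambda> r^2, chosen so that \<lambda> drops out of the
  radial operator. Once t is large the second term is a small perturbation, which keeps the radicand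
  off the branch cut and J close to t^2.\<close>

lemma profile_exists:
  assumes mu: "1 / 2 < \<mu>" "\<mu> \<le> 1"
  shows "\<exists>n J J1 K K1 \<Phi>. profile \<mu> l n J J1 K K1 \<Phi>"
proof -
  define G where "G = (\<lambda>\<rho>. of_real (exp (\<mu> * \<rho>) ^ 4) - l * of_real (exp \<rho> ^ 2))"
  define G1 where "G1 = (\<lambda>\<rho>. of_real (4 * \<mu> * exp (\<mu> * \<rho>) ^ 4) - l * of_real (2 * exp \<rho> ^ 2))"
  define J where "J = (\<lambda>\<rho>. csqrt (G \<rho>))"
  define J1 where "J1 = (\<lambda>\<rho>. G1 \<rho> / (2 * J \<rho>))"
  \<comment> \<open>From here on t^4 / r^2 = exp ((4\<mu> - 2) \<rho>) is at least 64 |l| + 1; this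
    uses \<mu> > 1/2.\<close>
  define \<rho>0 where "\<rho>0 = ln (64 * norm l + 1) / (4 * \<mu> - 2)"
  obtain n0 where n0: "exp (\<mu> * \<rho>0) \<le> real n0" using real_arch_simple by blast
  \<comment> \<open>Even, so that the first frequency is + n^2 and the solution starts as a power of
    z; at least 1000, so that 1 / t is negligible in the numerical estimates; and so large that the
    bounds on J already hold on the interpolation zone n - 1 <= t <= n.\<close>
  define n where "n = 2 * (n0 + 1000)"
  have nbig: "real n - 2 \<ge> exp (\<mu> * \<rho>0)" "n \<ge> 1000" "even n"
  proof -
    show "real n - 2 \<ge> exp (\<mu> * \<rho>0)"
      using n0 unfolding n_def by simp
  qed (auto simp: n_def)
  have small: "64 * (norm l * exp \<rho> ^ 2) \<le> exp (\<mu> * \<rho>) ^ 4" if "exp (\<mu> * \<rho>) \<ge> real n - 2" for \<rho>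
  proof -
    have "exp (\<mu> * \<rho>) \<ge> exp (\<mu> * \<rho>0)" using that nbig(1) by linarith
    then have "\<rho> \<ge> \<rho>0" using mu by simp
    then have "ln (64 * norm l + 1) \<le> (4 * \<mu> - 2) * \<rho>"
      using mu by (simp add: \<rho>0_def field_simps)
    then have "exp (ln (64 * norm l + 1)) \<le> exp ((4 * \<mu> - 2) * \<rho>)" by simp
    then have "64 * norm l + 1 \<le> exp ((4 * \<mu> - 2) * \<rho>)"
      by (subst (asm) exp_ln) (auto intro: add_nonneg_pos)
    then have "64 * norm l * exp (2 * \<rho>) \<le> exp ((4 * \<mu> - 2) * \<rho>) * exp (2 * \<rho>)"
      by (intro mult_right_mono) auto
    also have "\<dots> = exp (\<mu> * \<rho>) ^ 4"
    proof -
      have "exp (\<mu> * \<rho>) ^ 4 = exp (4 * (\<mu> * \<rho>))"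
        using exp_of_nat_mult[of 4 "\<mu> * \<rho>"] by simp
      then show ?thesis by (simp add: algebra_simps flip: exp_add)
    qed
    finally have "64 * norm l * exp (2 * \<rho>) \<le> exp (\<mu> * \<rho>) ^ 4" .
    moreover have "exp (2 * \<rho>) = exp \<rho> ^ 2" by (simp add: exp_double)
    ultimately show ?thesis by (simp only: mult.assoc)
  qed
  have approx: "Re (G \<rho>) > 0" "norm (J \<rho> - of_real (exp (\<mu> * \<rho>) ^ 2)) \<le> exp (\<mu> * \<rho>) ^ 2 / 64"
    "norm (J1 \<rho>) \<le> 3 * exp (\<mu> * \<rho>) ^ 2" "J \<rho> \<noteq> 0"
    if good: "exp (\<mu> * \<rho>) \<ge> real n - 2" for \<rho>
  proof -
    define t where "t = exp (\<mu> * \<rho>)"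
    have t: "t > 0" by (simp add: t_def)
    define e where "e = l * of_real (exp \<rho> ^ 2)"
    have e: "norm e \<le> t ^ 4 / 64"
      using small[OF good] by (simp add: e_def t_def norm_mult norm_power)
    have G: "G \<rho> = of_real (t ^ 4) - e" by (simp add: G_def t_def e_def)
    have "Re e \<le> t ^ 4 / 64" using e abs_Re_le_cmod[of e] by linarith
    moreover have "t ^ 4 > 0" using t by simp
    ultimately have "0 < t ^ 4 - Re e" by linarith
    then show "Re (G \<rho>) > 0" unfolding G by simp
    have J2: "(J \<rho>)\<^sup>2 = of_real (t ^ 4) - e" by (simp add: J_def G)
    have ReJ: "Re (J \<rho>) \<ge> 0" using csqrt_principal[of "G \<rho>"] by (auto simp: J_def)
    \<comment> \<open>Since Re J >= 0, the factor J + t^2 has size at least t^2, so J - t^2 is at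
      most |e| / t^2.\<close>
    have "(J \<rho> - of_real (t\<^sup>2)) * (J \<rho> + of_real (t\<^sup>2)) = - e"
      using J2 by (simp add: algebra_simps power2_eq_square power4_eq_xxxx)
    then have "norm (J \<rho> - of_real (t\<^sup>2)) * norm (J \<rho> + of_real (t\<^sup>2)) = norm e"
      by (metis norm_mult norm_minus_cancel)
    moreover have "t\<^sup>2 \<le> norm (J \<rho> + of_real (t\<^sup>2))"
      using ReJ complex_Re_le_cmod[of "J \<rho> + of_real (t\<^sup>2)"] by simp
    ultimately have "norm (J \<rho> - of_real (t\<^sup>2)) * t\<^sup>2 \<le> t ^ 4 / 64"
      using e mult_left_mono[of "t\<^sup>2" "norm (J \<rho> + of_real (t\<^sup>2))" "norm (J \<rho> - of_real (t\<^sup>2))"]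
      by simp
    then have "norm (J \<rho> - of_real (t\<^sup>2)) * t\<^sup>2 \<le> (t\<^sup>2 / 64) * t\<^sup>2"
      by (simp add: power2_eq_square power4_eq_xxxx)
    then have a: "norm (J \<rho> - of_real (t\<^sup>2)) \<le> t\<^sup>2 / 64"
      by (rule mult_right_le_imp_le) (use t in simp)
    then show "norm (J \<rho> - of_real (exp (\<mu> * \<rho>) ^ 2)) \<le> exp (\<mu> * \<rho>) ^ 2 / 64"
      by (simp add: t_def)
    have "norm (of_real (t\<^sup>2) :: complex) \<le> norm (J \<rho>) + norm (J \<rho> - of_real (t\<^sup>2))"
      by (metis norm_triangle_sub norm_minus_commute)
    moreover have "norm (of_real (t\<^sup>2) :: complex) = t\<^sup>2"
      unfolding norm_of_real by simp
    ultimately have nJ: "norm (J \<rho>) \<ge> 63 / 64 * t\<^sup>2" using a by linarith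
    moreover have "63 / 64 * t\<^sup>2 > 0" using t by simp
    ultimately have nJ0: "norm (J \<rho>) > 0" by linarith
    then show "J \<rho> \<noteq> 0" by simp
    have "G1 \<rho> = of_real (4 * \<mu> * t ^ 4) - 2 * e" by (simp add: G1_def t_def e_def)
    then have "norm (G1 \<rho>) \<le> norm (complex_of_real (4 * \<mu> * t ^ 4)) + norm (2 * e)"
      using norm_triangle_ineq4 by metis
    also have "norm (complex_of_real (4 * \<mu> * t ^ 4)) = 4 * \<mu> * t ^ 4"
      unfolding norm_of_real using mu t by simp
    also have "4 * \<mu> * t ^ 4 + norm (2 * e) \<le> 4 * t ^ 4 + t ^ 4 / 32"
      using e mu t by (intro add_mono) (auto simp: norm_mult)
    also have "\<dots> \<le> 3 * t\<^sup>2 * (2 * (63 / 64 * t\<^sup>2))"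
      using t by (simp add: power2_eq_square power4_eq_xxxx)
    also have "\<dots> \<le> 3 * t\<^sup>2 * (2 * norm (J \<rho>))"
      using nJ t by (intro mult_left_mono) auto
    finally have "norm (G1 \<rho>) \<le> 3 * t\<^sup>2 * (2 * norm (J \<rho>))" .
    then show "norm (J1 \<rho>) \<le> 3 * exp (\<mu> * \<rho>) ^ 2"
      using nJ0 by (simp add: J1_def norm_divide norm_mult divide_le_eq t_def)
  qed
  have dG: "(G has_vector_derivative G1 \<rho>) (at \<rho>)" for \<rho>
  proof -
    have "((\<lambda>\<rho>. exp (\<mu> * \<rho>) ^ 4) has_real_derivative 4 * \<mu> * exp (\<mu> * \<rho>) ^ 4) (at \<rho>)"
      by (rule derivative_eq_intros refl | simp add: power_Suc eval_nat_numeral)+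
    moreover have "((\<lambda>\<rho>::real. exp \<rho> ^ 2) has_real_derivative 2 * exp \<rho> ^ 2) (at \<rho>)"
      by (rule derivative_eq_intros refl | simp add: power2_eq_square)+
    ultimately show ?thesis
      unfolding G_def G1_def
      by (intro has_vector_derivative_diff has_vector_derivative_mult_right has_vector_derivative_of_real)
  qed
  have dJ: "(J has_vector_derivative J1 \<rho>) (at \<rho>)" if "exp (\<mu> * \<rho>) \<ge> real n - 2" for \<rho>
  proof -
    have "G \<rho> \<notin> \<real>\<^sub>\<le>\<^sub>0" using approx(1)[OF that] by (auto simp: complex_nonpos_Reals_iff)
    from field_vector_diff_chain_at[OF dG has_field_derivative_csqrt[OF this]]
    show ?thesis by (simp add: J_def J1_def o_def field_simps)
  qed
  have cG: "isCont G \<rho>" "isCont G1 \<rho>" for \<rho>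
    using has_vector_derivative_continuous[OF dG] unfolding G1_def by (auto intro!: continuous_intros)
  have cJ: "isCont J \<rho>" "isCont J1 \<rho>" if "exp (\<mu> * \<rho>) \<ge> real n - 2" for \<rho>
  proof -
    show "isCont J \<rho>" using has_vector_derivative_continuous[OF dJ[OF that]] .
    then show "isCont J1 \<rho>"
      unfolding J1_def using cG approx(4)[OF that] by (intro continuous_intros) auto
  qed
  \<comment> \<open>Fixed by the outer value of K: - n^2 + (J + c) = J + \<mu> / 2.\<close>
  define c where "c = complex_of_real (\<mu> / 2) + of_nat (n\<^sup>2)"
  define \<sigma> where "\<sigma> = (\<lambda>\<rho>. exp (\<mu> * \<rho>) - (real n - 1))"
  define K where "K = (\<lambda>\<rho>. - of_nat (n\<^sup>2) + of_real (smoothstep (\<sigma> \<rho>)) * (J \<rho> + c))"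
  define K1 where "K1 = (\<lambda>\<rho>. of_real (smoothstep (\<sigma> \<rho>)) * J1 \<rho> + of_real (smoothstep1 (\<sigma> \<rho>) * (\<mu> * exp (\<mu> * \<rho>))) * (J \<rho> + c))"
  have ds: "(\<sigma> has_real_derivative \<mu> * exp (\<mu> * \<rho>)) (at \<rho>)" for \<rho>
    unfolding \<sigma>_def by (rule derivative_eq_intros refl | simp)+
  have inner: "K \<rho> = - of_nat (n\<^sup>2)" "K1 \<rho> = 0" if "exp (\<mu> * \<rho>) \<le> real n - 1" for \<rho>
    using that by (auto simp: K_def K1_def \<sigma>_def smoothstep_le_0)
  have outer: "K \<rho> = J \<rho> + of_real (\<mu> / 2)" "K1 \<rho> = J1 \<rho>" if "exp (\<mu> * \<rho>) \<ge> real n" for \<rho>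
    using that by (auto simp: K_def K1_def \<sigma>_def c_def smoothstep_ge_1)
  have op: "open {\<rho>. exp (\<mu> * \<rho>) < real n - 1}"
    by (intro open_Collect_less continuous_intros)
  have dK: "(K has_vector_derivative K1 \<rho>) (at \<rho>)" for \<rho>
  proof (cases "exp (\<mu> * \<rho>) < real n - 1")
    case True
    have "((\<lambda>_. - of_nat (n\<^sup>2) :: complex) has_vector_derivative 0) (at \<rho>)" by simp
    then have "(K has_vector_derivative 0) (at \<rho>)"
      by (rule has_vector_derivative_transform_within_open[OF _ op]) (use True in \<open>auto simp: inner\<close>)
    then show ?thesis using True by (simp add: inner)
  next
    case False
    then have g: "exp (\<mu> * \<rho>) \<ge> real n - 2" by simp
    have "((\<lambda>\<rho>. smoothstep (\<sigma> \<rho>)) has_real_derivative smoothstep1 (\<sigma> \<rho>) * (\<mu> * exp (\<mu> * \<rho>))) (at \<rho>)"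
      by (rule DERIV_chain2[OF smoothstep_deriv ds])
    then have "((\<lambda>\<rho>. complex_of_real (smoothstep (\<sigma> \<rho>))) has_vector_derivative of_real (smoothstep1 (\<sigma> \<rho>) * (\<mu> * exp (\<mu> * \<rho>)))) (at \<rho>)"
      by (rule has_vector_derivative_of_real)
    from has_vector_derivative_mult[OF this has_vector_derivative_add[OF dJ[OF g] has_vector_derivative_const[of c]]]
    have "((\<lambda>\<rho>. of_real (smoothstep (\<sigma> \<rho>)) * (J \<rho> + c)) has_vector_derivative K1 \<rho>) (at \<rho>)"
      by (simp add: K1_def)
    from has_vector_derivative_add[OF has_vector_derivative_const[of "- of_nat (n\<^sup>2)"] this]
    show ?thesis by (simp add: K_def)
  qed
  have cK1: "isCont K1 \<rho>" for \<rho>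
  proof (cases "exp (\<mu> * \<rho>) < real n - 1")
    case True
    have "\<forall>\<^sub>F r in nhds \<rho>. exp (\<mu> * r) < real n - 1"
      using eventually_nhds_in_open[OF op, of \<rho>] True by simp
    then have "\<forall>\<^sub>F r in nhds \<rho>. K1 r = 0"
      by (rule eventually_mono) (simp add: inner(2))
    then show ?thesis using isCont_cong[of K1 "\<lambda>_. 0" \<rho>] by simp
  next
    case False
    then have g: "exp (\<mu> * \<rho>) \<ge> real n - 2" by simp
    have s: "isCont \<sigma> \<rho>" using DERIV_isCont[OF ds] .
    have "isCont (\<lambda>\<rho>. smoothstep (\<sigma> \<rho>)) \<rho>" "isCont (\<lambda>\<rho>. smoothstep1 (\<sigma> \<rho>)) \<rho>"
      using isCont_o2[OF s DERIV_isCont[OF smoothstep_deriv]] isCont_o2[OF s DERIV_isCont[OF smoothstep1_deriv]] by auto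
    then show ?thesis
      unfolding K1_def using cJ[OF g] by (intro continuous_intros) auto
  qed
  obtain \<Phi> where Phi: "\<And>\<rho>. (\<Phi> has_vector_derivative K \<rho>) (at \<rho>)"
    using einterval_antiderivative_UNIV[of K] has_vector_derivative_continuous[OF dK] by auto
  have "profile \<mu> l n J J1 K K1 \<Phi>"
  proof
    fix \<rho>
    assume "exp (\<mu> * \<rho>) \<ge> real n"
    then have g: "exp (\<mu> * \<rho>) \<ge> real n - 2" by simp
    show "(J has_vector_derivative J1 \<rho>) (at \<rho>)" by (rule dJ[OF g])
    show "(J \<rho>)\<^sup>2 = of_real (exp (\<mu> * \<rho>) ^ 4) - l * of_real (exp \<rho> ^ 2)"
      unfolding J_def power2_csqrt G_def ..
    show "norm (J \<rho> - of_real (exp (\<mu> * \<rho>) ^ 2)) \<le> exp (\<mu> * \<rho>) ^ 2 / 64"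
      "norm (J1 \<rho>) \<le> 3 * exp (\<mu> * \<rho>) ^ 2"
      using approx[OF g] by blast+
  qed (use mu nbig dK cK1 Phi inner outer in blast)+
  then show ?thesis by blast
qed

section \<open>A single transition between angular modes\<close>

lemma power4_diff_le:
  fixes x y :: real
  assumes "0 \<le> x" "x \<le> y"
  shows "y ^ 4 - x ^ 4 \<le> 4 * y ^ 3 * (y - x)"
proof -
  have "y ^ 4 - x ^ 4 = (y - x) * (y ^ 3 + y\<^sup>2 * x + y * x\<^sup>2 + x ^ 3)" by algebra
  also have "\<dots> \<le> (y - x) * (y ^ 3 + y\<^sup>2 * y + y * y\<^sup>2 + y ^ 3)"
    using assms by (intro mult_left_mono add_mono power_mono) auto
  finally show ?thesis by (simp add: power2_eq_square power3_eq_cube algebra_simps)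
qed

text \<open>The average of two bounds. The combination is (1 + \<zeta>) / 2 + (1/2 - S)(1 - \<zeta>)
  with orthogonal summands, so it is at least |1 + \<zeta>| / 2; by the reverse triangle inequality
  it is at least |1 - 2 S|. This quantifies that it vanishes only at \<zeta> = -1, S = 1/2.\<close>

lemma norm_convex_unimodular_ge:
  fixes \<zeta> :: complex and S :: real
  assumes z: "norm \<zeta> = 1" and S: "0 \<le> S" "S \<le> 1"
  shows "norm (of_real (1 - S) + of_real S * \<zeta>) \<ge> norm (1 + \<zeta>) / 4 + \<bar>1 - 2 * S\<bar> / 2"
proof -
  let ?g = "of_real (1 - S) + of_real S * \<zeta>"
  have "(norm ?g)\<^sup>2 = (norm (1 + \<zeta>) / 2)\<^sup>2 + (1/2 - S)\<^sup>2 * (norm (1 - \<zeta>))\<^sup>2"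
  proof -
    have "(Re \<zeta>)\<^sup>2 + (Im \<zeta>)\<^sup>2 = 1" using z by (metis cmod_power2 one_power2)
    then show ?thesis
      unfolding power_divide cmod_power2 by simp algebra
  qed
  then have "(norm (1 + \<zeta>) / 2)\<^sup>2 \<le> (norm ?g)\<^sup>2" by simp
  then have "norm (1 + \<zeta>) / 2 \<le> norm ?g" by (rule power2_le_imp_le) simp
  moreover have "\<bar>1 - 2 * S\<bar> \<le> norm ?g"
  proof -
    have "\<bar>norm (complex_of_real (1 - S)) - norm (of_real S * \<zeta>)\<bar> \<le> norm (of_real (1 - S) - (- (of_real S * \<zeta>)))"
      by (metis norm_triangle_ineq3 norm_minus_cancel)
    then show ?thesis using z S by (simp add: norm_mult del: of_real_diff)
  qed
  ultimately show ?thesis by simp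
qed

lemma norm_add4_le: "norm (a + b + c + d) \<le> norm a + norm b + norm c + norm d" for a b c d :: complex
  by (metis add_mono norm_triangle_ineq norm_triangle_mono order_refl)

section \<open>The coefficient t * J and the amplitude of the third harmonic\<close>

context profile
begin

definition Jt :: "real \<Rightarrow> complex" where "Jt \<tau> = J (ln \<tau> / \<mu>)"

lemma exp_ln_mu: "\<tau> > 0 \<Longrightarrow> exp (\<mu> * (ln \<tau> / \<mu>)) = \<tau>"
  using mu by simp

lemma Jt_exp: "Jt (exp (\<mu> * \<rho>)) = J \<rho>"
  using mu by (simp add: Jt_def)

lemma Jt_norm:
  assumes "\<tau> \<ge> real n"
  shows "norm (Jt \<tau>) \<le> 65 / 64 * \<tau>\<^sup>2"
proof -
  have t: "\<tau> > 0" using assms n by linarith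
  have "norm (Jt \<tau> - of_real (\<tau>\<^sup>2)) \<le> \<tau>\<^sup>2 / 64"
    using J_approx[of "ln \<tau> / \<mu>"] assms unfolding exp_ln_mu[OF t] by (simp add: Jt_def)
  moreover have "norm (Jt \<tau>) \<le> norm (complex_of_real (\<tau>\<^sup>2)) + norm (Jt \<tau> - of_real (\<tau>\<^sup>2))"
    by (metis norm_triangle_sub)
  moreover have "norm (complex_of_real (\<tau>\<^sup>2)) = \<tau>\<^sup>2" unfolding norm_of_real by simp
  ultimately show ?thesis by linarith
qed

text \<open>The t-derivative of t * Jt is J1 / \<mu> + Jt, of order t^2, one order below t * Jt
  itself. So the coefficient may be frozen at the midpoint j + 1/2, where \<open>alpha\<close> is
  defined, at a cost proportional to the distance.\<close>

lemma Jt_lipschitz: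
  assumes "real n \<le> real j" and x: "real j \<le> \<tau>" "\<tau> \<le> real j + 1" and y: "real j \<le> \<tau>'" "\<tau>' \<le> real j + 1"
  shows "norm (Jt \<tau> * of_real \<tau> - Jt \<tau>' * of_real \<tau>') \<le> 8 * (real j + 1)\<^sup>2 * \<bar>\<tau> - \<tau>'\<bar>"
proof -
  define F where "F = (\<lambda>\<tau>. Jt \<tau> * of_real \<tau>)"
  define F1 where "F1 = (\<lambda>\<tau>. J1 (ln \<tau> / \<mu>) / of_real \<mu> + Jt \<tau>)"
  have der: "(F has_vector_derivative F1 \<tau>) (at \<tau>)" if "\<tau> \<in> {real j..real j + 1}" for \<tau>
  proof -
    have t: "\<tau> > 0" "\<tau> \<ge> real n" using that assms n by auto
    have "((\<lambda>\<tau>. ln \<tau> / \<mu>) has_real_derivative 1 / \<tau> / \<mu>) (at \<tau>)"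
      using t by (intro DERIV_cdivide DERIV_ln_divide)
    then have "((\<lambda>\<tau>. ln \<tau> / \<mu>) has_vector_derivative 1 / \<tau> / \<mu>) (at \<tau>)"
      by (simp add: has_real_derivative_iff_has_vector_derivative)
    from vector_diff_chain_at[OF this dJ[of "ln \<tau> / \<mu>", unfolded exp_ln_mu[OF t(1)], OF t(2)]]
    have "(Jt has_vector_derivative (1 / \<tau> / \<mu>) *\<^sub>R J1 (ln \<tau> / \<mu>)) (at \<tau>)"
      by (simp add: o_def Jt_def[abs_def])
    moreover have "((\<lambda>\<tau>. complex_of_real \<tau>) has_vector_derivative of_real 1) (at \<tau>)"
      by (intro has_vector_derivative_of_real) simp
    ultimately have "(F has_vector_derivative (Jt \<tau> * of_real 1 + (1 / \<tau> / \<mu>) *\<^sub>R J1 (ln \<tau> / \<mu>) * of_real \<tau>)) (at \<tau>)"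
      unfolding F_def by (rule has_vector_derivative_mult)
    moreover have "Jt \<tau> * of_real 1 + (1 / \<tau> / \<mu>) *\<^sub>R J1 (ln \<tau> / \<mu>) * of_real \<tau> = F1 \<tau>"
      using t mu by (simp add: F1_def scaleR_conv_of_real field_simps)
    ultimately show ?thesis by simp
  qed
  have bound: "norm (F1 \<tau>) \<le> 8 * (real j + 1)\<^sup>2" if "\<tau> \<in> {real j..real j + 1}" for \<tau>
  proof -
    have t: "\<tau> > 0" "\<tau> \<ge> real n" using that assms n by auto
    have "norm (J1 (ln \<tau> / \<mu>)) \<le> 3 * \<tau>\<^sup>2"
      using J1_bound[of "ln \<tau> / \<mu>"] t(2) unfolding exp_ln_mu[OF t(1)] by simp
    then have "norm (J1 (ln \<tau> / \<mu>) / of_real \<mu>) \<le> 3 * \<tau>\<^sup>2 / (1 / 2)"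
      using mu unfolding norm_divide norm_of_real by (intro frac_le) auto
    also have "3 * \<tau>\<^sup>2 / (1 / 2) = 6 * \<tau>\<^sup>2" by simp
    finally have "norm (F1 \<tau>) \<le> 8 * \<tau>\<^sup>2"
      using Jt_norm[OF t(2)] norm_triangle_ineq[of "J1 (ln \<tau> / \<mu>) / of_real \<mu>" "Jt \<tau>"] zero_le_power2[of \<tau>]
      unfolding F1_def by linarith
    also have "8 * \<tau>\<^sup>2 \<le> 8 * (real j + 1)\<^sup>2"
      using that t by (intro mult_left_mono power_mono) auto
    finally show ?thesis .
  qed
  have "norm (F \<tau> - F \<tau>') \<le> 8 * (real j + 1)\<^sup>2 * norm (\<tau> - \<tau>')"
  proof (rule differentiable_bound[where S = "{real j..real j + 1}"])
    fix \<tau> assume t: "\<tau> \<in> {real j..real j + 1}"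
    show "(F has_derivative (\<lambda>h. h *\<^sub>R F1 \<tau>)) (at \<tau> within {real j..real j + 1})"
      using der[OF t] unfolding has_vector_derivative_def by (rule has_derivative_at_withinI)
    show "onorm (\<lambda>h. h *\<^sub>R F1 \<tau>) \<le> 8 * (real j + 1)\<^sup>2"
      by (rule onorm_le) (use bound[OF t] in \<open>auto simp: mult.commute intro: mult_left_mono\<close>)
  qed (use x y in auto)
  then show ?thesis by (simp add: F_def)
qed

text \<open>The amplitude of the third harmonic is chosen so that the error of the equation vanishes
  at the zeros of the solution, which lie on the circle \<open>t = j + 1/2\<close>.\<close>

definition alpha :: "nat \<Rightarrow> complex" where
  "alpha j = (of_real (15 / 2 * \<mu> * (real j + 1 / 2)) * Jt (real j + 1 / 2)
      + of_real ((real (j + 1) ^ 4 - real j ^ 4) / 2))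
    / of_real (4 * real (j + 1) ^ 2 * (real j ^ 2 + real (j + 1) ^ 2))"

text \<open>Numerator of order j^3, denominator of order j^4. The third harmonic is thus a small
  perturbation, while its frequency mismatch of order j^4 still contributes at the critical order
  j^3.\<close>

lemma alpha_bound:
  assumes "n \<le> j"
  shows "norm (alpha j) \<le> 3 / (real j + 1)"
proof -
  define b where "b = real j + 1"
  have b: "b > 0" "real j = b - 1" "real (j + 1) = b" "real j + 1 / 2 \<ge> real n"
    using assms by (auto simp: b_def)
  have "norm (of_real (15 / 2 * \<mu> * (real j + 1 / 2)) * Jt (real j + 1 / 2)) \<le> (15 / 2 * b) * (65 / 64 * b\<^sup>2)"
    unfolding norm_mult
  proof (rule mult_mono)
    have "15 / 2 * \<mu> * (real j + 1 / 2) \<le> 15 / 2 * 1 * b"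
      using mu by (intro mult_mono) (auto simp: b_def)
    then show "norm (complex_of_real (15 / 2 * \<mu> * (real j + 1 / 2))) \<le> 15 / 2 * b"
      unfolding norm_of_real using mu by (simp add: abs_mult)
    have "(real j + 1 / 2)\<^sup>2 \<le> b\<^sup>2" by (intro power_mono) (auto simp: b_def)
    then show "norm (Jt (real j + 1 / 2)) \<le> 65 / 64 * b\<^sup>2" using Jt_norm[OF b(4)] by linarith
  qed (use b in auto)
  also have "(15 / 2 * b) * (65 / 64 * b\<^sup>2) \<le> 8 * b ^ 3"
    using b(1) by (simp add: power2_eq_square power3_eq_cube)
  finally have 1: "norm (of_real (15 / 2 * \<mu> * (real j + 1 / 2)) * Jt (real j + 1 / 2)) \<le> 8 * b ^ 3" .
  have "real (j + 1) ^ 4 - real j ^ 4 \<le> 4 * b ^ 3"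
    using power4_diff_le[of "real j" "real (j + 1)"] by (simp add: b_def add.commute)
  moreover have "real (j + 1) ^ 4 - real j ^ 4 \<ge> 0" by (simp add: power_mono)
  ultimately have 2: "norm (complex_of_real ((real (j + 1) ^ 4 - real j ^ 4) / 2)) \<le> 2 * b ^ 3"
    unfolding norm_of_real by simp
  have "norm (of_real (15 / 2 * \<mu> * (real j + 1 / 2)) * Jt (real j + 1 / 2)
      + of_real ((real (j + 1) ^ 4 - real j ^ 4) / 2)) \<le> 10 * b ^ 3"
    using norm_triangle_ineq[of "of_real (15 / 2 * \<mu> * (real j + 1 / 2)) * Jt (real j + 1 / 2)"
        "complex_of_real ((real (j + 1) ^ 4 - real j ^ 4) / 2)"] 1 2 by linarith
  moreover have "4 * b ^ 2 * b ^ 2 \<le> norm (complex_of_real (4 * real (j + 1) ^ 2 * (real j ^ 2 + real (j + 1) ^ 2)))"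
  proof -
    have "norm (complex_of_real (4 * b ^ 2 * (real j ^ 2 + b ^ 2))) = 4 * b ^ 2 * (real j ^ 2 + b ^ 2)"
      unfolding norm_of_real by (intro abs_of_nonneg) auto
    moreover have "4 * b ^ 2 * b ^ 2 \<le> 4 * b ^ 2 * (real j ^ 2 + b ^ 2)" by (intro mult_left_mono) auto
    ultimately show ?thesis unfolding b(3) by linarith
  qed
  ultimately have "norm (alpha j) \<le> 10 * b ^ 3 / (4 * b\<^sup>2 * b\<^sup>2)"
    unfolding alpha_def norm_divide using b(1) by (intro frac_le) auto
  also have "\<dots> \<le> 3 / b" using b(1) by (simp add: field_simps power2_eq_square power3_eq_cube)
  finally show ?thesis by (simp add: b_def)
qed

text \<open>The balance that defines \<open>alpha\<close>. At the midpoint the smoothstep is 1/2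
  with derivatives 15/8 and 0, and the bump is 1; at \<zeta> = -1 the error is then 15/2 * \<mu> t J
  + (b^2 - a^2) / 2 - alpha * (m^2 - a^2), where m = 2 b + a is the absolute frequency of the third
  harmonic.\<close>

lemma alpha_eq:
  fixes a b :: real and j :: nat
  defines "a \<equiv> real j ^ 2" and "b \<equiv> real (j + 1) ^ 2"
  shows "alpha j * of_real ((2 * b + a)\<^sup>2 - a\<^sup>2)
    = of_real (15 / 2 * \<mu>) * (Jt (real j + 1 / 2) * of_real (real j + 1 / 2)) + of_real ((b\<^sup>2 - a\<^sup>2) / 2)"
proof -
  have "b > 0" "a \<ge> 0" by (auto simp: a_def b_def)
  then have nz: "4 * b * (a + b) \<noteq> 0" by (auto simp: add_nonneg_eq_0_iff)
  have e: "(2 * b + a)\<^sup>2 - a\<^sup>2 = 4 * b * (a + b)" by algebra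
  have "a\<^sup>2 = real j ^ 4" "b\<^sup>2 = real (j + 1) ^ 4"
    by (simp_all add: a_def b_def flip: power_mult)
  then have "alpha j = (of_real (15 / 2 * \<mu>) * (Jt (real j + 1 / 2) * of_real (real j + 1 / 2))
      + of_real ((b\<^sup>2 - a\<^sup>2) / 2)) / of_real (4 * b * (a + b))"
    unfolding alpha_def a_def[symmetric] b_def[symmetric]
    by (simp only: of_real_mult mult_ac)
  then show ?thesis unfolding e using nz
    by (metis nonzero_eq_divide_eq of_real_eq_0_iff)
qed

end

text \<open>One transition \<open>j \<le> t \<le> j + 1\<close>: with \<open>\<zeta>\<close> the ratio of consecutive harmonics the solution is
  \<open>A0 + A1 \<zeta> + A2 \<zeta>\<^sup>2\<close> up to a nonvanishing factor.\<close>

locale transition = profile +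
  fixes j :: nat and \<rho> t s S y x a b m :: real
  assumes nj: "n \<le> j" and t_def: "t = exp (\<mu> * \<rho>)" and tj: "real j \<le> t" "t \<le> real j + 1"
    and s_def: "s = t - real j" and S_def: "S = smoothstep s" and y_def: "y = 1 - 2 * S" and x_def: "x = 1 - 2 * s"
    and a_def: "a = real j ^ 2" and b_def: "b = real (j + 1) ^ 2" and m_def: "m = 2 * b + a"
begin

lemma t_ge: "t \<ge> 1000" and j_ge: "real j \<ge> 1000" and t_ge_n: "t \<ge> real n"
  using nj tj n by auto

lemma x_bound: "\<bar>x\<bar> \<le> 1"
  using tj by (simp add: x_def s_def)

lemma centred: "S = (1 - x * (15 - 10 * x\<^sup>2 + 3 * x ^ 4) / 8) / 2"
    "smoothstep1 s = 15 / 8 * (1 - x\<^sup>2)\<^sup>2" "smoothstep2 s = 15 * x * (1 - x\<^sup>2)"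
proof -
  have e: "s = (1 - x) / 2" by (simp add: x_def)
  show "S = (1 - x * (15 - 10 * x\<^sup>2 + 3 * x ^ 4) / 8) / 2"
    "smoothstep1 s = 15 / 8 * (1 - x\<^sup>2)\<^sup>2" "smoothstep2 s = 15 * x * (1 - x\<^sup>2)"
    unfolding S_def e by (rule smoothstep_centred[OF x_bound])+
qed

lemma x2: "0 \<le> x\<^sup>2" "x\<^sup>2 \<le> 1"
  using x_bound abs_square_le_1 by auto

lemma y_eq: "y = x * ((15 - 10 * x\<^sup>2 + 3 * (x\<^sup>2)\<^sup>2) / 8)"
proof -
  define c where "c = 15 - 10 * x\<^sup>2 + 3 * x ^ 4"
  have "x ^ 4 = (x\<^sup>2)\<^sup>2" by simp
  moreover have "y = 1 - 2 * ((1 - x * c / 8) / 2)" unfolding y_def centred(1) c_def ..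
  then have "y = x * (c / 8)" by (simp add: field_simps)
  ultimately show ?thesis by (simp only: c_def)
qed

text \<open>The quotient y / x is at least 1, by 7 - 10 x^2 + 3 x^4 = (1 - x^2)(7 - 3 x^2) >= 0.
  Hence error terms that vanish with x are controlled by |y|, which also bounds the solution from
  below.\<close>

lemma x_le_y: "\<bar>x\<bar> \<le> \<bar>y\<bar>"
proof -
  have "(1 - x\<^sup>2) * (7 - 3 * x\<^sup>2) \<ge> 0" using x2 by (intro mult_nonneg_nonneg) auto
  then have "15 - 10 * x\<^sup>2 + 3 * (x\<^sup>2)\<^sup>2 \<ge> 8" by (simp add: algebra_simps power2_eq_square)
  then have "(15 - 10 * x\<^sup>2 + 3 * (x\<^sup>2)\<^sup>2) / 8 \<ge> 1" by simp
  then have "\<bar>x\<bar> * 1 \<le> \<bar>x\<bar> * \<bar>(15 - 10 * x\<^sup>2 + 3 * (x\<^sup>2)\<^sup>2) / 8\<bar>" by (intro mult_left_mono) auto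
  then show ?thesis unfolding y_eq abs_mult by simp
qed

lemma S_bounds: "0 \<le> S" "S \<le> 1"
proof -
  have s: "0 \<le> s" "s \<le> 1" using tj by (auto simp: s_def)
  have inc: "smoothstep u \<le> smoothstep v" if "0 \<le> u" "u \<le> v" "v \<le> 1" for u v
  proof (rule DERIV_nonneg_imp_nondecreasing[OF that(2)])
    fix r assume "u \<le> r" "r \<le> v"
    then have r: "0 \<le> r" "r \<le> 1" using that by auto
    have "smoothstep1 r = 30 * (r * (1 - r))\<^sup>2" unfolding smoothstep_between(2)[OF r] by algebra
    then show "\<exists>d. (smoothstep has_real_derivative d) (at r) \<and> 0 \<le> d" using smoothstep_deriv[of r] by auto
  qed
  show "0 \<le> S" using inc[of 0 s] s smoothstep_le_0(1)[of 0] by (simp add: S_def)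
  show "S \<le> 1" using inc[of s 1] s smoothstep_ge_1(1)[of 1] by (simp add: S_def)
qed

lemma y_bound: "\<bar>y\<bar> \<le> 1" using S_bounds by (simp add: y_def)

lemma bump_y: "bump s = 1 - y\<^sup>2" "bump1 s = 4 * smoothstep1 s * y" "bump2 s = 4 * smoothstep2 s * y - 8 * (smoothstep1 s)\<^sup>2"
  by (auto simp: bump_def bump1_def bump2_def y_def S_def power2_eq_square algebra_simps)

lemma smoothstep1_bound: "\<bar>smoothstep1 s\<bar> \<le> 2" and smoothstep2_bound: "\<bar>smoothstep2 s\<bar> \<le> 15"
proof -
  have "(1 - x\<^sup>2)\<^sup>2 \<le> 1" using x2 by (simp add: abs_square_le_1)
  then show "\<bar>smoothstep1 s\<bar> \<le> 2" unfolding centred by simp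
  have "\<bar>x\<bar> * \<bar>1 - x\<^sup>2\<bar> \<le> 1 * 1" using x2 x_bound by (intro mult_mono) auto
  then show "\<bar>smoothstep2 s\<bar> \<le> 15" unfolding centred by (simp add: abs_mult)
qed

lemma bump_bounds: "\<bar>bump s\<bar> \<le> 1" "\<bar>bump1 s\<bar> \<le> 8" "\<bar>bump2 s\<bar> \<le> 92"
proof -
  have y2: "0 \<le> y\<^sup>2" "y\<^sup>2 \<le> 1" using y_bound abs_square_le_1 by auto
  then show "\<bar>bump s\<bar> \<le> 1" unfolding bump_y by simp
  have "\<bar>smoothstep1 s\<bar> * \<bar>y\<bar> \<le> 2 * 1" "\<bar>smoothstep2 s\<bar> * \<bar>y\<bar> \<le> 15 * 1"
    using smoothstep1_bound smoothstep2_bound y_bound by (intro mult_mono; simp)+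
  then have 1: "\<bar>smoothstep1 s * y\<bar> \<le> 2" "\<bar>smoothstep2 s * y\<bar> \<le> 15" by (auto simp: abs_mult)
  then show "\<bar>bump1 s\<bar> \<le> 8" unfolding bump_y by simp
  have "(smoothstep1 s)\<^sup>2 \<le> 2\<^sup>2" using smoothstep1_bound by (metis abs_le_square_iff abs_numeral)
  then have "0 \<le> (smoothstep1 s)\<^sup>2" "(smoothstep1 s)\<^sup>2 \<le> 4" by auto
  then show "\<bar>bump2 s\<bar> \<le> 92" unfolding bump_y using 1(2) unfolding abs_le_iff by linarith
qed

lemma alpha_small: "norm (alpha j) \<le> 3 / 1000"
proof -
  have "3 / (real j + 1) \<le> 3 / 1000" using j_ge by (intro frac_le) auto
  then show ?thesis using alpha_bound[OF nj] by linarith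
qed

lemma j1_cube: "(real j + 1) ^ 3 \<le> 101 / 100 * t ^ 3"
proof -
  have "real j + 1 \<le> 1001 / 1000 * t" using tj j_ge by simp
  then have "(real j + 1) ^ 3 \<le> (1001 / 1000 * t) ^ 3" by (intro power_mono) auto
  also have "\<dots> \<le> 101 / 100 * t ^ 3"
    using t_ge by (simp add: power_mult_distrib power3_eq_cube)
  finally show ?thesis .
qed

lemma t2_le: "t\<^sup>2 \<le> t ^ 3 / 1000" "1 \<le> t\<^sup>2"
proof -
  have "t\<^sup>2 * 1000 \<le> t\<^sup>2 * t" using t_ge by (intro mult_left_mono) auto
  then show "t\<^sup>2 \<le> t ^ 3 / 1000" by (simp add: power2_eq_square power3_eq_cube)
  show "1 \<le> t\<^sup>2" using t_ge by simp
qed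

section \<open>The radial operator on one cell\<close>

abbreviation "JJ \<equiv> J \<rho>"
abbreviation "KK \<equiv> K \<rho>"

lemma good: "exp (\<mu> * \<rho>) \<ge> real n" using t_ge_n by (simp add: t_def)

lemma JJ_approx: "norm (JJ - of_real (t\<^sup>2)) \<le> t\<^sup>2 / 64"
  using J_approx[OF good] by (simp add: t_def)

lemma JJ_Jt: "JJ = Jt t" by (simp add: t_def Jt_exp)

lemma JJ_norm: "norm JJ \<le> 65 / 64 * t\<^sup>2"
  unfolding JJ_Jt by (rule Jt_norm[OF t_ge_n])

lemma KK_eq: "KK = JJ + of_real (\<mu> / 2)" "K1 \<rho> = J1 \<rho>"
  using K_outer[OF good] by auto

text \<open>On exp (- \<Phi>) exp (i q \<theta>) the operator r^2 (\<Delta> + \<lambda>) is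
  multiplication by \<open>Y\<close> - q^2.\<close>

definition Y :: complex where "Y = KK\<^sup>2 - K1 \<rho> + l * of_real (exp \<rho> ^ 2)"

text \<open>The - \<lambda> r^2 in J^2 cancels the term with \<open>l\<close>. What remains, \<mu> J
  + \<mu>^2 / 4 - J1, is of order t^2 and so below the critical order t^3.\<close>

lemma Y_approx: "norm (Y - of_real (t ^ 4)) \<le> 6 * t\<^sup>2"
proof -
  have "Y - of_real (t ^ 4) = of_real \<mu> * JJ + of_real (\<mu>\<^sup>2 / 4) - J1 \<rho>"
    using J_square[OF good] unfolding Y_def KK_eq t_def
    by (simp add: power2_eq_square algebra_simps)
  then have "norm (Y - of_real (t ^ 4)) \<le> norm (of_real \<mu> * JJ) + norm (complex_of_real (\<mu>\<^sup>2 / 4)) + norm (J1 \<rho>)"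
    by (metis (no_types, lifting) add_mono_thms_linordered_semiring(3) norm_triangle_ineq norm_triangle_ineq4 order_trans)
  moreover have "norm (of_real \<mu> * JJ) \<le> 1 * (65 / 64 * t\<^sup>2)"
    unfolding norm_mult norm_of_real using mu JJ_norm by (intro mult_mono) auto
  moreover have "norm (complex_of_real (\<mu>\<^sup>2 / 4)) \<le> 1"
  proof -
    have "\<mu>\<^sup>2 \<le> 1" using mu by (simp add: abs_square_le_1)
    then show ?thesis unfolding norm_of_real by simp
  qed
  moreover have "norm (J1 \<rho>) \<le> 3 * t\<^sup>2" using J1_bound[OF good] by (simp add: t_def)
  ultimately show ?thesis using t2_le by linarith
qed

lemma a2: "a\<^sup>2 = real j ^ 4" and b2: "b\<^sup>2 = (real j + 1) ^ 4"
  by (simp_all add: a_def b_def add.commute flip: power_mult)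

lemma fourth_powers: "0 \<le> t ^ 4 - a\<^sup>2" "t ^ 4 - a\<^sup>2 \<le> 4 * t ^ 3" "0 \<le> b\<^sup>2 - t ^ 4" "b\<^sup>2 - t ^ 4 \<le> 41 / 10 * t ^ 3"
  "0 \<le> b\<^sup>2 - a\<^sup>2" "b\<^sup>2 - a\<^sup>2 \<le> 41 / 10 * t ^ 3"
proof -
  have t0: "t \<ge> 0" using t_ge by simp
  have "t ^ 4 - real j ^ 4 \<le> 4 * t ^ 3 * (t - real j)" by (rule power4_diff_le) (use tj in auto)
  also have "\<dots> \<le> 4 * t ^ 3 * 1" using tj t0 by (intro mult_left_mono) auto
  finally show "t ^ 4 - a\<^sup>2 \<le> 4 * t ^ 3" by (simp add: a2)
  have "(real j + 1) ^ 4 - t ^ 4 \<le> 4 * (real j + 1) ^ 3 * (real j + 1 - t)" by (rule power4_diff_le) (use tj t0 in auto)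
  also have "\<dots> \<le> 4 * (real j + 1) ^ 3 * 1" using tj by (intro mult_left_mono) auto
  finally show "b\<^sup>2 - t ^ 4 \<le> 41 / 10 * t ^ 3" using j1_cube t0 zero_le_power[OF t0, of 3] unfolding b2 by linarith
  have "(real j + 1) ^ 4 - real j ^ 4 \<le> 4 * (real j + 1) ^ 3 * (real j + 1 - real j)" by (rule power4_diff_le) auto
  also have "\<dots> = 4 * (real j + 1) ^ 3" by simp
  finally show "b\<^sup>2 - a\<^sup>2 \<le> 41 / 10 * t ^ 3" using j1_cube t0 zero_le_power[OF t0, of 3] unfolding a2 b2 by linarith
  show "0 \<le> t ^ 4 - a\<^sup>2" "0 \<le> b\<^sup>2 - t ^ 4" "0 \<le> b\<^sup>2 - a\<^sup>2"
    unfolding a2 b2 using tj t0 by (auto intro!: power_mono)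
qed

text \<open>On a unit cell t^4 stays within about 4 t^3 of the squared frequencies of both main
  modes; this is the price for frequencies that do not follow t continuously.\<close>

lemma Y_bounds: "norm (Y - of_real (a\<^sup>2)) \<le> 5 * t ^ 3" "norm (Y - of_real (b\<^sup>2)) \<le> 5 * t ^ 3"
proof -
  have *: "norm (Y - of_real c) \<le> 6 * t\<^sup>2 + \<bar>t ^ 4 - c\<bar>" for c
  proof -
    have "Y - of_real c = (Y - of_real (t ^ 4)) + of_real (t ^ 4 - c)" by simp
    then have "norm (Y - of_real c) \<le> norm (Y - of_real (t ^ 4)) + norm (complex_of_real (t ^ 4 - c))"
      by (metis norm_triangle_ineq)
    then show ?thesis using Y_approx unfolding norm_of_real by linarith
  qed
  have "t ^ 3 \<ge> 0" using t_ge by simp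
  then show "norm (Y - of_real (a\<^sup>2)) \<le> 5 * t ^ 3" "norm (Y - of_real (b\<^sup>2)) \<le> 5 * t ^ 3"
    using *[of "a\<^sup>2"] *[of "b\<^sup>2"] fourth_powers t2_le(1) by linarith+
qed

text \<open>The part of the radial operator that involves derivatives of the amplitude.\<close>

definition R :: "real \<Rightarrow> real \<Rightarrow> complex" where
  "R p1 p2 = of_real (\<mu>\<^sup>2 * t\<^sup>2 * p2) - 2 * JJ * of_real (\<mu> * t * p1)"

lemma R_bound: "norm (R p1 p2) \<le> t\<^sup>2 * \<bar>p2\<bar> + 65 / 32 * t ^ 3 * \<bar>p1\<bar>"
proof -
  have t0: "t > 0" using t_ge by simp
  have "norm (complex_of_real (\<mu>\<^sup>2 * t\<^sup>2 * p2)) \<le> 1 * t\<^sup>2 * \<bar>p2\<bar>"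
  proof -
    have "\<mu>\<^sup>2 \<le> 1" using mu by (simp add: abs_square_le_1)
    then have "\<mu>\<^sup>2 * t\<^sup>2 * \<bar>p2\<bar> \<le> 1 * t\<^sup>2 * \<bar>p2\<bar>" by (intro mult_right_mono) auto
    then show ?thesis unfolding norm_of_real by (simp add: abs_mult)
  qed
  moreover have "norm (2 * JJ * of_real (\<mu> * t * p1)) \<le> 2 * (65 / 64 * t\<^sup>2) * (1 * t * \<bar>p1\<bar>)"
  proof -
    have "\<mu> * t * \<bar>p1\<bar> \<le> 1 * t * \<bar>p1\<bar>" using mu t0 by (intro mult_right_mono) auto
    then have "norm (complex_of_real (\<mu> * t * p1)) \<le> 1 * t * \<bar>p1\<bar>"
      unfolding norm_of_real using mu t0 by (simp add: abs_mult)
    then show ?thesis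
      unfolding norm_mult[of "2 * JJ"] using JJ_norm t0 by (intro mult_mono) (auto simp: norm_mult)
  qed
  moreover have "2 * (65 / 64 * t\<^sup>2) * (1 * t * \<bar>p1\<bar>) = 65 / 32 * t ^ 3 * \<bar>p1\<bar>"
    by (simp add: power2_eq_square power3_eq_cube)
  ultimately show ?thesis
    unfolding R_def using norm_triangle_ineq4[of "complex_of_real (\<mu>\<^sup>2 * t\<^sup>2 * p2)" "2 * JJ * of_real (\<mu> * t * p1)"] by linarith
qed

text \<open>The third harmonic enters as \<zeta>^2 - 1, which vanishes at \<zeta> = -1, so it leaves
  the zeros of (1 - S) + S * \<zeta> in place.\<close>

definition A0 :: complex where "A0 = of_real (1 - S) - alpha j * of_real (bump s)"
definition A1 :: complex where "A1 = of_real S"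
definition A2 :: complex where "A2 = alpha j * of_real (bump s)"

text \<open>The coefficients of 1, \<zeta>, \<zeta>^2 in the error r^2 (\<Delta> + \<lambda>) u, up
  to the same factor as for the solution: \<open>R\<close> collects the changing amplitudes,
  \<open>Y\<close> the frequency mismatch.\<close>

definition C0 :: complex where
  "C0 = - R (smoothstep1 s) (smoothstep2 s) - alpha j * R (bump1 s) (bump2 s) + (Y - of_real (a\<^sup>2)) * A0"
definition C1 :: complex where
  "C1 = R (smoothstep1 s) (smoothstep2 s) + (Y - of_real (b\<^sup>2)) * A1"
definition C2 :: complex where
  "C2 = alpha j * R (bump1 s) (bump2 s) + (Y - of_real (m\<^sup>2)) * A2"

lemma R_smoothstep_bound: "norm (R (smoothstep1 s) (smoothstep2 s)) \<le> 5 * t ^ 3"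
  and R_bump_bound: "norm (R (bump1 s) (bump2 s)) \<le> 17 * t ^ 3"
proof -
  have t0: "t ^ 3 \<ge> 0" "t\<^sup>2 \<ge> 0" using t_ge by auto
  have "t\<^sup>2 * \<bar>smoothstep2 s\<bar> \<le> t\<^sup>2 * 15" "65 / 32 * t ^ 3 * \<bar>smoothstep1 s\<bar> \<le> 65 / 32 * t ^ 3 * 2"
    "t\<^sup>2 * \<bar>bump2 s\<bar> \<le> t\<^sup>2 * 92" "65 / 32 * t ^ 3 * \<bar>bump1 s\<bar> \<le> 65 / 32 * t ^ 3 * 8"
    using t0 smoothstep1_bound smoothstep2_bound bump_bounds by (intro mult_left_mono; simp)+
  then show "norm (R (smoothstep1 s) (smoothstep2 s)) \<le> 5 * t ^ 3" "norm (R (bump1 s) (bump2 s)) \<le> 17 * t ^ 3"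
    using R_bound[of "smoothstep1 s" "smoothstep2 s"] R_bound[of "bump1 s" "bump2 s"] t2_le(1) t0(1) by linarith+
qed

lemma A2_norm: "norm A2 \<le> 3 / 1000"
  using mult_mono[OF alpha_small bump_bounds(1)] by (simp add: A2_def norm_mult)

lemma C1_bound: "norm C1 \<le> 10 * t ^ 3"
proof -
  have "norm ((Y - of_real (b\<^sup>2)) * A1) \<le> 5 * t ^ 3 * 1"
    unfolding norm_mult A1_def norm_of_real using Y_bounds S_bounds t_ge by (intro mult_mono) auto
  then show ?thesis unfolding C1_def
    using norm_triangle_ineq[of "R (smoothstep1 s) (smoothstep2 s)" "(Y - of_real (b\<^sup>2)) * A1"] R_smoothstep_bound by linarith
qed

lemma C2_bound: "norm C2 \<le> 31 * t ^ 3"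
proof -
  have t0: "t ^ 3 \<ge> 0" using t_ge by auto
  have 1: "norm (alpha j * R (bump1 s) (bump2 s)) \<le> 3 / 1000 * (17 * t ^ 3)"
    unfolding norm_mult using alpha_small R_bump_bound by (intro mult_mono) auto
  have "Y - of_real (m\<^sup>2) = (Y - of_real (a\<^sup>2)) - of_real (m\<^sup>2 - a\<^sup>2)" by simp
  then have 2: "(Y - of_real (m\<^sup>2)) * A2 = (Y - of_real (a\<^sup>2)) * A2 - of_real (m\<^sup>2 - a\<^sup>2) * A2"
    by (simp only: left_diff_distrib)
  have 3: "norm ((Y - of_real (a\<^sup>2)) * A2) \<le> 5 * t ^ 3 * (3 / 1000)"
    unfolding norm_mult using Y_bounds A2_norm t0 by (intro mult_mono) auto
  have ab: "0 \<le> a" "a \<le> b" by (auto simp: a_def b_def intro!: power_mono)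
  have "m\<^sup>2 - a\<^sup>2 = 4 * b * (a + b)" unfolding m_def by algebra
  also have "\<dots> \<le> 4 * b * (b + b)" using ab by (intro mult_left_mono add_right_mono) auto
  also have "\<dots> = 8 * (real j + 1) ^ 4" using b2 by (simp add: power2_eq_square)
  finally have "m\<^sup>2 - a\<^sup>2 \<le> 8 * (real j + 1) ^ 4" .
  moreover have "0 \<le> m\<^sup>2 - a\<^sup>2" unfolding m_def using ab by (simp add: power_mono)
  ultimately have "norm (complex_of_real (m\<^sup>2 - a\<^sup>2)) \<le> 8 * (real j + 1) ^ 4"
    unfolding norm_of_real by simp
  \<comment> \<open>The uniform bound on \<open>alpha\<close> is too weak here: m^2 - a^2 is of
    order j^4, and the factor 1 / (j + 1) brings the product down to order j^3.\<close>
  moreover have "norm A2 \<le> 3 / (real j + 1) * 1"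
    unfolding A2_def norm_mult norm_of_real using alpha_bound[OF nj] bump_bounds(1) by (intro mult_mono) auto
  ultimately have "norm (of_real (m\<^sup>2 - a\<^sup>2) * A2) \<le> (8 * (real j + 1) ^ 4) * (3 / (real j + 1) * 1)"
    unfolding norm_mult by (intro mult_mono) auto
  also have "\<dots> = 24 * (real j + 1) ^ 3"
    by (simp add: field_simps power4_eq_xxxx power3_eq_cube)
  finally have 4: "norm (of_real (m\<^sup>2 - a\<^sup>2) * A2) \<le> 24 * (real j + 1) ^ 3" .
  have "norm C2 \<le> norm (alpha j * R (bump1 s) (bump2 s)) + (norm ((Y - of_real (a\<^sup>2)) * A2) + norm (of_real (m\<^sup>2 - a\<^sup>2) * A2))"
    unfolding C2_def 2 by (intro order_trans[OF norm_triangle_ineq] add_mono norm_triangle_ineq4 order_refl)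
  then show ?thesis using 1 3 4 j1_cube t0 by linarith
qed

text \<open>The error polynomial at \<zeta> = -1. Once \<open>alpha\<close> is eliminated, every
  summand has a factor that vanishes at the midpoint: y, x, the increment of t * Jt, or (1 - x^2)^2
  - 1 + y^2.\<close>

lemma C_alternating_eq: "C0 - C1 + C2 = (Y - of_real (a\<^sup>2)) * of_real y
    + of_real (- ((b\<^sup>2 - a\<^sup>2) / 2) * (y * (1 - y)) - 30 * \<mu>\<^sup>2 * t\<^sup>2 * (x * (1 - x\<^sup>2)))
    + of_real (15 / 2 * \<mu> * (1 - x\<^sup>2)\<^sup>2) * (Jt t * of_real t - Jt (real j + 1 / 2) * of_real (real j + 1 / 2))
    + of_real (15 / 2 * \<mu> * ((1 - x\<^sup>2)\<^sup>2 - 1 + y\<^sup>2)) * (Jt (real j + 1 / 2) * of_real (real j + 1 / 2))"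
proof -
  define TJ where "TJ = Jt (real j + 1 / 2) * of_real (real j + 1 / 2)"
  have al: "alpha j * of_real (m\<^sup>2 - a\<^sup>2) = of_real (15 / 2 * \<mu>) * TJ + of_real ((b\<^sup>2 - a\<^sup>2) / 2)"
    using alpha_eq[of j] unfolding m_def a_def b_def TJ_def .
  have S: "S = (1 - y) / 2" by (simp add: y_def)
  have R: "R (smoothstep1 s) (smoothstep2 s) = of_real (15 * \<mu>\<^sup>2 * t\<^sup>2 * (x * (1 - x\<^sup>2))) - Jt t * of_real t * of_real (15 / 4 * \<mu> * (1 - x\<^sup>2)\<^sup>2)"
    unfolding R_def centred JJ_Jt by (simp add: algebra_simps)
  have "C0 - C1 + C2 = - 2 * R (smoothstep1 s) (smoothstep2 s) + (Y - of_real (a\<^sup>2)) * of_real (1 - 2 * S)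
      + of_real (b\<^sup>2 - a\<^sup>2) * of_real S - alpha j * of_real (m\<^sup>2 - a\<^sup>2) * of_real (bump s)"
    unfolding C0_def C1_def C2_def A0_def A1_def A2_def by (simp add: algebra_simps)
  also have "\<dots> = (Y - of_real (a\<^sup>2)) * of_real y
    + of_real (- ((b\<^sup>2 - a\<^sup>2) / 2) * (y * (1 - y)) - 30 * \<mu>\<^sup>2 * t\<^sup>2 * (x * (1 - x\<^sup>2)))
    + of_real (15 / 2 * \<mu> * (1 - x\<^sup>2)\<^sup>2) * (Jt t * of_real t - TJ)
    + of_real (15 / 2 * \<mu> * ((1 - x\<^sup>2)\<^sup>2 - 1 + y\<^sup>2)) * TJ"
    unfolding al R bump_y(1) S by (simp add: field_simps power2_eq_square)
  finally show ?thesis unfolding TJ_def .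
qed

lemma C_alternating_bound: "norm (C0 - C1 + C2) \<le> 40 * t ^ 3 * \<bar>y\<bar>"
proof -
  define TJ where "TJ = Jt (real j + 1 / 2) * of_real (real j + 1 / 2)"
  have t0: "t ^ 3 \<ge> 0" "t > 0" using t_ge by auto
  have q: "0 \<le> 1 - x\<^sup>2" "1 - x\<^sup>2 \<le> 1" "0 \<le> (1 - x\<^sup>2)\<^sup>2" "(1 - x\<^sup>2)\<^sup>2 \<le> 1"
    using x2 by (auto simp: abs_square_le_1)
  have 1: "norm ((Y - of_real (a\<^sup>2)) * of_real y) \<le> 5 * t ^ 3 * \<bar>y\<bar>"
    unfolding norm_mult norm_of_real using Y_bounds(1) by (intro mult_right_mono) auto
  have "\<bar>(b\<^sup>2 - a\<^sup>2) / 2\<bar> * (\<bar>y\<bar> * \<bar>1 - y\<bar>) \<le> 41 / 20 * t ^ 3 * (\<bar>y\<bar> * 2)"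
    using fourth_powers(5,6) y_bound t0 by (intro mult_mono) auto
  then have 2: "\<bar>- ((b\<^sup>2 - a\<^sup>2) / 2) * (y * (1 - y))\<bar> \<le> 41 / 10 * t ^ 3 * \<bar>y\<bar>"
    by (simp add: abs_mult mult_ac)
  have "30 * \<mu>\<^sup>2 * t\<^sup>2 * (\<bar>x\<bar> * \<bar>1 - x\<^sup>2\<bar>) \<le> 30 * 1 * (t ^ 3 / 1000) * (\<bar>y\<bar> * 1)"
    using mu t0 t2_le x_le_y q by (intro mult_mono) (auto simp: abs_square_le_1)
  then have 3: "\<bar>30 * \<mu>\<^sup>2 * t\<^sup>2 * (x * (1 - x\<^sup>2))\<bar> \<le> 30 / 1000 * t ^ 3 * \<bar>y\<bar>"
    by (simp add: abs_mult)
  have xT: "\<bar>t - (real j + 1 / 2)\<bar> = \<bar>x\<bar> / 2"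
  proof -
    have "t - (real j + 1 / 2) = - (x / 2)" by (simp add: x_def s_def field_simps)
    then show ?thesis by (simp del: minus_divide_left)
  qed
  have j1: "(real j + 1)\<^sup>2 \<le> (real j + 1) ^ 3 / 1000"
  proof -
    have "(real j + 1)\<^sup>2 * 1000 \<le> (real j + 1)\<^sup>2 * (real j + 1)" using j_ge by (intro mult_left_mono) auto
    then show ?thesis by (simp add: power2_eq_square power3_eq_cube)
  qed
  have "norm (Jt t * of_real t - TJ) \<le> 8 * (real j + 1)\<^sup>2 * \<bar>t - (real j + 1 / 2)\<bar>"
    unfolding TJ_def by (rule Jt_lipschitz) (use nj tj in auto)
  also have "\<dots> = 4 * (real j + 1)\<^sup>2 * \<bar>x\<bar>" unfolding xT by simp
  also have "\<dots> \<le> 4 * (t ^ 3 / 500) * \<bar>y\<bar>"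
  proof -
    have "(real j + 1)\<^sup>2 \<le> t ^ 3 / 500" using j1 j1_cube t0(1) by linarith
    then show ?thesis using x_le_y t0(1) by (intro mult_mono) auto
  qed
  finally have d: "norm (Jt t * of_real t - TJ) \<le> 4 * (t ^ 3 / 500) * \<bar>y\<bar>" .
  have "\<bar>15 / 2 * \<mu> * (1 - x\<^sup>2)\<^sup>2\<bar> \<le> 15 / 2 * 1 * 1"
    using mu q unfolding abs_mult by (intro mult_mono) auto
  then have 4: "norm (of_real (15 / 2 * \<mu> * (1 - x\<^sup>2)\<^sup>2) * (Jt t * of_real t - TJ)) \<le> 15 / 2 * (4 * (t ^ 3 / 500) * \<bar>y\<bar>)"
    unfolding norm_mult[of "complex_of_real (15 / 2 * \<mu> * (1 - x\<^sup>2)\<^sup>2)"] norm_of_real using d by (intro mult_mono) auto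
  have jn: "real j + 1 / 2 \<ge> real n" using nj by simp
  have "norm TJ \<le> 65 / 64 * (real j + 1)\<^sup>2 * (real j + 1)"
  proof -
    have "(real j + 1 / 2)\<^sup>2 \<le> (real j + 1)\<^sup>2" by (intro power_mono) auto
    then have "norm (Jt (real j + 1 / 2)) \<le> 65 / 64 * (real j + 1)\<^sup>2" using Jt_norm[OF jn] by linarith
    then show ?thesis unfolding TJ_def norm_mult norm_of_real by (intro mult_mono) auto
  qed
  also have "\<dots> = 65 / 64 * (real j + 1) ^ 3" by (simp add: power2_eq_square power3_eq_cube)
  finally have TJ: "norm TJ \<le> 11 / 10 * t ^ 3" using j1_cube t0 by linarith
  have sq: "c\<^sup>2 \<le> \<bar>c\<bar>" if "\<bar>c\<bar> \<le> 1" for c :: real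
    using mult_left_mono[OF that abs_ge_zero[of c]] by (simp add: power2_eq_square)
  \<comment> \<open>The derivative of the smoothstep and the bump deviate from their midpoint values
    quadratically in x and y, hence by at most a multiple of |y|.\<close>
  have "(1 - x\<^sup>2)\<^sup>2 - 1 + y\<^sup>2 = y\<^sup>2 - x\<^sup>2 * (2 - x\<^sup>2)" by algebra
  moreover have "y\<^sup>2 \<le> \<bar>y\<bar>" using sq[OF y_bound] .
  moreover have "x\<^sup>2 * (2 - x\<^sup>2) \<le> \<bar>y\<bar> * 2"
  proof (rule mult_mono)
    have "x\<^sup>2 \<le> \<bar>x\<bar>" using sq[OF x_bound] .
    then show "x\<^sup>2 \<le> \<bar>y\<bar>" using x_le_y by linarith
  qed (use x2 in auto)
  moreover have "x\<^sup>2 * (2 - x\<^sup>2) \<ge> 0" "y\<^sup>2 \<ge> 0" using x2 by auto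
  ultimately have "\<bar>(1 - x\<^sup>2)\<^sup>2 - 1 + y\<^sup>2\<bar> \<le> 2 * \<bar>y\<bar>" by linarith
  then have "\<bar>15 / 2 * \<mu> * ((1 - x\<^sup>2)\<^sup>2 - 1 + y\<^sup>2)\<bar> \<le> 15 / 2 * 1 * (2 * \<bar>y\<bar>)"
    using mu unfolding abs_mult[of "15 / 2 * \<mu>"] by (intro mult_mono) auto
  then have 5: "norm (of_real (15 / 2 * \<mu> * ((1 - x\<^sup>2)\<^sup>2 - 1 + y\<^sup>2)) * TJ) \<le> 15 / 2 * 1 * (2 * \<bar>y\<bar>) * (11 / 10 * t ^ 3)"
    unfolding norm_mult[of "complex_of_real (15 / 2 * \<mu> * ((1 - x\<^sup>2)\<^sup>2 - 1 + y\<^sup>2))"] norm_of_real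
    using TJ by (intro mult_mono) auto
  define ty where "ty = t ^ 3 * \<bar>y\<bar>"
  have ty: "ty \<ge> 0" using t0 by (simp add: ty_def)
  have 23: "norm (complex_of_real (- ((b\<^sup>2 - a\<^sup>2) / 2) * (y * (1 - y)) - 30 * \<mu>\<^sup>2 * t\<^sup>2 * (x * (1 - x\<^sup>2)))) \<le> 42 / 10 * ty"
    unfolding norm_of_real using 2 3 ty unfolding ty_def by linarith
  have "norm (C0 - C1 + C2) \<le> 5 * ty + 42 / 10 * ty + 60 / 1000 * ty + 165 / 10 * ty"
    unfolding C_alternating_eq TJ_def[symmetric]
    by (rule order_trans[OF norm_add4_le]) (use 1 23 4 5 in \<open>auto simp: ty_def algebra_simps intro!: add_mono\<close>)
  then show ?thesis using ty unfolding ty_def by linarith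
qed

text \<open>The third harmonic contributes 1 + \<zeta> with a factor of at most 6 / 1000, which is
  absorbed by weakening the constant 1/4 of the two main harmonics to 1/8.\<close>

lemma solution_lower:
  assumes z: "norm \<zeta> = 1"
  shows "norm (1 + \<zeta>) / 8 + \<bar>y\<bar> / 2 \<le> norm (A0 + A1 * \<zeta> + A2 * \<zeta>\<^sup>2)"
proof -
  have e: "A0 + A1 * \<zeta> + A2 * \<zeta>\<^sup>2 = (of_real (1 - S) + of_real S * \<zeta>) - A2 * (1 - \<zeta>) * (1 + \<zeta>)"
    unfolding A0_def A1_def A2_def by (simp add: algebra_simps power2_eq_square)
  have "norm (1 - \<zeta>) \<le> 2" using norm_triangle_ineq4[of 1 \<zeta>] z by simp
  then have "norm (A2 * (1 - \<zeta>)) \<le> 3 / 1000 * 2"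
    unfolding norm_mult using A2_norm by (intro mult_mono) auto
  then have "norm (A2 * (1 - \<zeta>) * (1 + \<zeta>)) \<le> 3 / 1000 * 2 * norm (1 + \<zeta>)"
    unfolding norm_mult[of "A2 * (1 - \<zeta>)"] by (intro mult_right_mono) auto
  moreover have "norm (1 + \<zeta>) / 4 + \<bar>1 - 2 * S\<bar> / 2 \<le> norm (of_real (1 - S) + of_real S * \<zeta>)"
    by (rule norm_convex_unimodular_ge[OF z S_bounds])
  ultimately show ?thesis
    unfolding e using norm_triangle_ineq2[of "of_real (1 - S) + of_real S * \<zeta>" "A2 * (1 - \<zeta>) * (1 + \<zeta>)"]
      norm_ge_zero[of "1 + \<zeta>"] unfolding y_def by linarith
qed

text \<open>Dividing the error polynomial by 1 + \<zeta> leaves its value at -1, of size t^3 |y|.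
  The error is thus bounded by the same two quantities, |1 + \<zeta>| and |y|, that bound the
  solution from below; 600 comes from 72 <= 600 / 8.\<close>

lemma core_error:
  assumes z: "norm \<zeta> = 1"
  shows "norm (C0 + C1 * \<zeta> + C2 * \<zeta>\<^sup>2) \<le> 600 * t ^ 3 * norm (A0 + A1 * \<zeta> + A2 * \<zeta>\<^sup>2)"
proof -
  have t0: "t ^ 3 \<ge> 0" using t_ge by auto
  have e: "C0 + C1 * \<zeta> + C2 * \<zeta>\<^sup>2 = (C0 - C1 + C2) + (C1 + C2 * (\<zeta> - 1)) * (1 + \<zeta>)"
    by (simp add: algebra_simps power2_eq_square)
  have "norm (\<zeta> - 1) \<le> 2" using norm_triangle_ineq4[of \<zeta> 1] z by simp
  then have "norm (C2 * (\<zeta> - 1)) \<le> 31 * t ^ 3 * 2"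
    unfolding norm_mult using C2_bound t0 by (intro mult_mono) auto
  then have "norm (C1 + C2 * (\<zeta> - 1)) \<le> 72 * t ^ 3"
    using norm_triangle_ineq[of C1 "C2 * (\<zeta> - 1)"] C1_bound by linarith
  then have "norm ((C1 + C2 * (\<zeta> - 1)) * (1 + \<zeta>)) \<le> 72 * t ^ 3 * norm (1 + \<zeta>)"
    unfolding norm_mult by (intro mult_right_mono) auto
  then have "norm (C0 + C1 * \<zeta> + C2 * \<zeta>\<^sup>2) \<le> 40 * t ^ 3 * \<bar>y\<bar> + 72 * t ^ 3 * norm (1 + \<zeta>)"
    unfolding e using norm_triangle_ineq[of "C0 - C1 + C2" "(C1 + C2 * (\<zeta> - 1)) * (1 + \<zeta>)"] C_alternating_bound
    by linarith
  also have "\<dots> \<le> 600 * t ^ 3 * (norm (1 + \<zeta>) / 8 + \<bar>y\<bar> / 2)"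
    using t0 mult_nonneg_nonneg[OF t0 norm_ge_zero[of "1 + \<zeta>"]] mult_nonneg_nonneg[OF t0 abs_ge_zero[of y]]
    by (simp add: algebra_simps)
  also have "\<dots> \<le> 600 * t ^ 3 * norm (A0 + A1 * \<zeta> + A2 * \<zeta>\<^sup>2)"
    using t0 solution_lower[OF z] by (intro mult_left_mono) auto
  finally show ?thesis .
qed

lemma solution_upper:
  assumes "norm e0 = 1" "norm e1 = 1" "norm e2 = 1"
  shows "norm (A0 * e0 + A1 * e1 + A2 * e2) \<le> 3"
proof -
  have "norm A0 \<le> norm (complex_of_real (1 - S)) + norm A2"
    unfolding A0_def A2_def[symmetric] by (rule norm_triangle_ineq4)
  then have "norm A0 \<le> 1 + 3 / 1000" using A2_norm S_bounds unfolding norm_of_real by linarith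
  moreover have "norm A1 \<le> 1" unfolding A1_def norm_of_real using S_bounds by simp
  moreover have "norm (A0 * e0 + A1 * e1 + A2 * e2) \<le> norm A0 + norm A1 + norm A2"
    by (rule order_trans[OF norm_triangle_ineq], rule order_trans[OF add_right_mono[OF norm_triangle_ineq]])
       (use assms in \<open>simp add: norm_mult\<close>)
  ultimately show ?thesis using A2_norm by linarith
qed

section \<open>Nonvanishing of the gradient on one cell\<close>

definition D0 :: complex where "D0 = of_real (- (\<mu> * t * smoothstep1 s)) - alpha j * of_real (\<mu> * t * bump1 s)"
definition D1 :: complex where "D1 = of_real (\<mu> * t * smoothstep1 s)"
definition D2 :: complex where "D2 = alpha j * of_real (\<mu> * t * bump1 s)"

text \<open>F and G are the derivatives in log r and \<theta>, divided by exp (- \<Phi>). As K, a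
  and b are all close to t^2, each of the Cauchy-Riemann combinations F + \<sigma> i G and F -
  \<sigma> i G nearly annihilates one main mode and nearly doubles the other. Both are at most |F| +
  |G|, and their main parts have sizes about 2 t^2 (1 - S) and 2 t^2 S.\<close>

lemma core_gradient:
  fixes \<sigma> :: complex
  assumes e: "norm e0 = 1" "norm e1 = 1" "norm e2 = 1" and sg: "\<sigma> = 1 \<or> \<sigma> = - 1"
  defines "F \<equiv> (D0 - KK * A0) * e0 + (D1 - KK * A1) * e1 + (D2 - KK * A2) * e2"
    and "G \<equiv> \<i> * (\<sigma> * of_real a) * A0 * e0 - \<i> * (\<sigma> * of_real b) * A1 * e1 - \<i> * (\<sigma> * of_real m) * A2 * e2"
  shows "t\<^sup>2 / 2 \<le> norm F + norm G"
proof -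
  have t0: "t > 0" "t\<^sup>2 \<ge> 0" "t \<le> t\<^sup>2 / 1000" "1 \<le> t\<^sup>2 / 1000"
  proof -
    show "t > 0" "t\<^sup>2 \<ge> 0" using t_ge by auto
    have "1000 * t \<le> t * t" using t_ge by (intro mult_right_mono) auto
    then show "t \<le> t\<^sup>2 / 1000" by (simp add: power2_eq_square)
    then show "1 \<le> t\<^sup>2 / 1000" using t_ge by linarith
  qed
  have Kt: "norm (KK - of_real (t\<^sup>2)) \<le> t\<^sup>2 / 50"
  proof -
    have "KK - of_real (t\<^sup>2) = (JJ - of_real (t\<^sup>2)) + of_real (\<mu> / 2)" unfolding KK_eq by simp
    then have "norm (KK - of_real (t\<^sup>2)) \<le> norm (JJ - of_real (t\<^sup>2)) + norm (complex_of_real (\<mu> / 2))"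
      by (metis norm_triangle_ineq)
    moreover have "norm (complex_of_real (\<mu> / 2)) \<le> 1" unfolding norm_of_real using mu by simp
    ultimately show ?thesis using JJ_approx t0 by linarith
  qed
  have at: "\<bar>a - t\<^sup>2\<bar> \<le> t\<^sup>2 / 100" "\<bar>b - t\<^sup>2\<bar> \<le> t\<^sup>2 / 100"
  proof -
    have "a \<le> t\<^sup>2" unfolding a_def using tj by (intro power_mono) auto
    moreover have "(t - 1)\<^sup>2 \<le> a" unfolding a_def using tj t_ge by (intro power_mono) auto
    moreover have "t\<^sup>2 - 2 * t \<le> (t - 1)\<^sup>2" by (simp add: power2_eq_square algebra_simps)
    ultimately show "\<bar>a - t\<^sup>2\<bar> \<le> t\<^sup>2 / 100" using t0 by linarith
    have "t\<^sup>2 \<le> b" unfolding b_def using tj t0 by (intro power_mono) auto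
    moreover have "b \<le> (t + 1)\<^sup>2" unfolding b_def using tj by (intro power_mono) auto
    moreover have "(t + 1)\<^sup>2 = t\<^sup>2 + 2 * t + 1" by (simp add: power2_eq_square algebra_simps)
    ultimately show "\<bar>b - t\<^sup>2\<bar> \<le> t\<^sup>2 / 100" using t0 by linarith
  qed
  have minus: "norm (KK - of_real c) \<le> t\<^sup>2 / 50 + \<bar>c - t\<^sup>2\<bar>" for c
  proof -
    have "KK - of_real c = (KK - of_real (t\<^sup>2)) - of_real (c - t\<^sup>2)" by simp
    then have "norm (KK - of_real c) \<le> norm (KK - of_real (t\<^sup>2)) + norm (complex_of_real (c - t\<^sup>2))"
      by (metis norm_triangle_ineq4)
    then show ?thesis using Kt unfolding norm_of_real by linarith
  qed
  have plus: "norm (KK + of_real c) \<ge> 2 * t\<^sup>2 - t\<^sup>2 / 50 - \<bar>c - t\<^sup>2\<bar>" for c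
  proof -
    have "complex_of_real (2 * t\<^sup>2) = (KK + of_real c) - ((KK - of_real (t\<^sup>2)) + of_real (c - t\<^sup>2))" by simp
    then have "norm (complex_of_real (2 * t\<^sup>2)) \<le> norm (KK + of_real c) + (norm (KK - of_real (t\<^sup>2)) + norm (complex_of_real (c - t\<^sup>2)))"
      by (metis norm_triangle_ineq norm_triangle_ineq4 add_left_mono order_trans)
    then show ?thesis using Kt t0(2) unfolding norm_of_real by linarith
  qed
  have Ka: "norm (KK - of_real a) \<le> t\<^sup>2 / 25" "norm (KK - of_real b) \<le> t\<^sup>2 / 25"
    and Kp: "norm (KK + of_real a) \<ge> 19 / 10 * t\<^sup>2" "norm (KK + of_real b) \<ge> 19 / 10 * t\<^sup>2"
    using minus[of a] minus[of b] plus[of a] plus[of b] at t0 by linarith+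
  have Km: "norm (KK - of_real m) \<le> 6 * t\<^sup>2" "norm (KK - of_real (- m)) \<le> 6 * t\<^sup>2"
    using minus[of m] minus[of "- m"] at t0(2) unfolding m_def by linarith+
  have A0l: "norm A0 \<ge> 1 - S - 3 / 1000" "norm A0 \<le> 2"
    using norm_triangle_ineq2[of "complex_of_real (1 - S)" A2] norm_triangle_ineq4[of "complex_of_real (1 - S)" A2]
      A2_norm S_bounds unfolding A0_def A2_def[symmetric] norm_of_real by linarith+
  have A1n: "norm A1 = S" unfolding A1_def norm_of_real using S_bounds by simp
  have mt: "\<bar>\<mu> * t * p\<bar> \<le> t * \<bar>p\<bar>" for p
    using mu t0 by (simp add: abs_mult mult_right_mono)
  have D1n: "norm D1 \<le> 2 * t"
    using mt[of "smoothstep1 s"] mult_left_mono[OF smoothstep1_bound, of t] t0 unfolding D1_def norm_of_real by linarith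
  have D2n: "norm D2 \<le> t"
  proof -
    have "\<bar>\<mu> * t * bump1 s\<bar> \<le> 8 * t"
      using mt[of "bump1 s"] mult_left_mono[OF bump_bounds(2), of t] t0 by linarith
    then have "norm D2 \<le> 3 / 1000 * (8 * t)"
      unfolding D2_def norm_mult norm_of_real using alpha_small by (intro mult_mono) auto
    then show ?thesis using t0 by linarith
  qed
  have D0n: "norm D0 \<le> 3 * t"
  proof -
    have "D0 = - D1 - D2" by (simp add: D0_def D1_def D2_def)
    then show ?thesis using D1n D2n norm_triangle_ineq4[of "- D1" D2] by simp
  qed
  have ss: "\<sigma> * \<sigma> = 1" "norm \<sigma> = 1" using sg by auto
  have ii: "\<i> * \<i> = - 1" by simp
  have P: "F + \<sigma> * \<i> * G = - (KK + of_real a) * A0 * e0 - ((KK - of_real b) * A1 * e1 + (KK - of_real m) * A2 * e2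
      - D0 * e0 - D1 * e1 - D2 * e2)"
    unfolding F_def G_def using ss(1) ii by algebra
  have Q: "F - \<sigma> * \<i> * G = - (KK + of_real b) * A1 * e1 - ((KK - of_real a) * A0 * e0 + (KK - of_real (- m)) * A2 * e2
      - D0 * e0 - D1 * e1 - D2 * e2)"
    unfolding F_def G_def of_real_minus using ss(1) ii by algebra
  have rest: "norm (u * e + v * A2 * e2 - D0 * e0 - D1 * e1 - D2 * e2) \<le> norm u + 6 * t\<^sup>2 * (3 / 1000) + 6 * t"
    if "norm v \<le> 6 * t\<^sup>2" "norm e = 1" for u v e :: complex
  proof -
    have "norm (v * A2 * e2) \<le> 6 * t\<^sup>2 * (3 / 1000)"
      using mult_mono[OF that(1) A2_norm] t0 e by (simp add: norm_mult)
    moreover have "norm (u * e) = norm u" "norm (D0 * e0) = norm D0" "norm (D1 * e1) = norm D1" "norm (D2 * e2) = norm D2"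
      using e that by (auto simp: norm_mult)
    moreover have "norm (u * e + v * A2 * e2 - D0 * e0 - D1 * e1 - D2 * e2)
      \<le> norm (u * e) + norm (v * A2 * e2) + norm (D0 * e0) + norm (D1 * e1) + norm (D2 * e2)"
      by (intro order_trans[OF norm_triangle_ineq4] add_right_mono order_trans[OF norm_triangle_ineq] order_refl)
    ultimately show ?thesis using D0n D1n D2n by linarith
  qed
  have neg: "norm (- u * v * e) = norm (u * v)" if "norm e = 1" for u v e :: complex
    by (simp only: norm_mult norm_minus_cancel that mult_1_right)
  have S01: "0 \<le> S" "S \<le> 1" by (rule S_bounds)+
  have "norm (F + \<sigma> * \<i> * G) \<ge> norm ((KK + of_real a) * A0) - (norm ((KK - of_real b) * A1) + 6 * t\<^sup>2 * (3 / 1000) + 6 * t)"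
    using norm_triangle_ineq2[of "- (KK + of_real a) * A0 * e0" "(KK - of_real b) * A1 * e1 + (KK - of_real m) * A2 * e2
      - D0 * e0 - D1 * e1 - D2 * e2"] rest[OF Km(1) e(2), of "(KK - of_real b) * A1"] neg[OF e(1), of "KK + of_real a" A0]
    unfolding P[symmetric] by linarith
  moreover have "norm ((KK - of_real b) * A1) \<le> t\<^sup>2 / 25 * 1"
    unfolding norm_mult A1n using Ka S01 by (intro mult_mono) auto
  moreover have "norm ((KK + of_real a) * A0) \<ge> 19 / 10 * t\<^sup>2 * (1 - S) - 19 / 10 * t\<^sup>2 * (3 / 1000)"
  proof -
    have "19 / 10 * t\<^sup>2 * (1 - S - 3 / 1000) \<le> 19 / 10 * t\<^sup>2 * norm A0"
      using A0l t0 by (intro mult_left_mono) auto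
    also have "\<dots> \<le> norm (KK + of_real a) * norm A0"
      using Kp by (intro mult_right_mono) auto
    finally show ?thesis unfolding norm_mult by (simp add: algebra_simps)
  qed
  moreover have "norm (F - \<sigma> * \<i> * G) \<ge> norm ((KK + of_real b) * A1) - (norm ((KK - of_real a) * A0) + 6 * t\<^sup>2 * (3 / 1000) + 6 * t)"
    using norm_triangle_ineq2[of "- (KK + of_real b) * A1 * e1" "(KK - of_real a) * A0 * e0 + (KK - of_real (- m)) * A2 * e2
      - D0 * e0 - D1 * e1 - D2 * e2"] rest[OF Km(2) e(1), of "(KK - of_real a) * A0"] neg[OF e(2), of "KK + of_real b" A1]
    unfolding Q[symmetric] by linarith
  moreover have "norm ((KK - of_real a) * A0) \<le> t\<^sup>2 / 25 * 2"
    unfolding norm_mult using Ka A0l by (intro mult_mono) auto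
  moreover have "norm ((KK + of_real b) * A1) \<ge> 19 / 10 * t\<^sup>2 * S"
    unfolding norm_mult A1n using Kp S01 by (intro mult_right_mono) auto
  \<comment> \<open>The unknown S drops out when the two lower bounds are added.\<close>
  moreover have "19 / 10 * t\<^sup>2 * (1 - S) + 19 / 10 * t\<^sup>2 * S = 19 / 10 * t\<^sup>2" by algebra
  moreover have "norm (F + \<sigma> * \<i> * G) \<le> norm F + norm G" "norm (F - \<sigma> * \<i> * G) \<le> norm F + norm G"
    using norm_triangle_ineq[of F "\<sigma> * \<i> * G"] norm_triangle_ineq4[of F "\<sigma> * \<i> * G"] ss(2)
    by (auto simp: norm_mult)
  ultimately show ?thesis using t0 by linarith
qed

end

section \<open>The global solution\<close>

context plane
begin

text \<open>\<open>f\<close> and \<open>g\<close> are the derivatives with respect to \<open>log r\<close> and \<open>\<theta>\<close>.\<close>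

definition polar2 where
  "polar2 A u f g L \<longleftrightarrow> has2 A u
     (\<lambda>j x. f x * of_real (Re (w j / Z x)) + g x * of_real (Im (w j / Z x)))
     (\<lambda>x. L x / of_real ((norm x)\<^sup>2))"

lemma polar2_add:
  assumes "polar2 A u f g L" "polar2 A u' f' g' L'"
  shows "polar2 A (\<lambda>x. u x + u' x) (\<lambda>x. f x + f' x) (\<lambda>x. g x + g' x) (\<lambda>x. L x + L' x)"
  using has2_add[OF assms[unfolded polar2_def]] unfolding polar2_def
  by (simp add: algebra_simps add_divide_distrib)

lemma polar2_cmult:
  assumes "polar2 A u f g L"
  shows "polar2 A (\<lambda>x. c * u x) (\<lambda>x. c * f x) (\<lambda>x. c * g x) (\<lambda>x. c * L x)"
  using has2_cmult[OF assms[unfolded polar2_def], of c] unfolding polar2_def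
  by (simp add: algebra_simps)

lemma polar2_sum:
  assumes "finite I" "open A" "\<And>i. i \<in> I \<Longrightarrow> polar2 A (u i) (f i) (g i) (L i)"
  shows "polar2 A (\<lambda>x. \<Sum>i\<in>I. u i x) (\<lambda>x. \<Sum>i\<in>I. f i x) (\<lambda>x. \<Sum>i\<in>I. g i x) (\<lambda>x. \<Sum>i\<in>I. L i x)"
  using has2_sum[OF assms(1,2), of u "\<lambda>i j x. f i x * of_real (Re (w j / Z x)) + g i x * of_real (Im (w j / Z x))"
      "\<lambda>i x. L i x / of_real ((norm x)\<^sup>2)"] assms(3)
  unfolding polar2_def by (simp add: sum.distrib sum_distrib_right sum_divide_distrib)

end

locale construction = plane i1 i2 + profile \<mu> l n J J1 K K1 \<Phi>
  for i1 i2 :: "'n::finite" and \<mu> l n J J1 K K1 \<Phi>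
begin

definition E0 :: "real ^ 'n \<Rightarrow> complex" where "E0 x = exp (- \<Phi> (ln (norm x)))"
definition KX :: "real ^ 'n \<Rightarrow> complex" where "KX x = K (ln (norm x))"
definition KX1 :: "real ^ 'n \<Rightarrow> complex" where "KX1 x = K1 (ln (norm x))"
definition tau :: "real ^ 'n \<Rightarrow> real" where "tau x = exp (\<mu> * ln (norm x))"
definition angular :: "int \<Rightarrow> real ^ 'n \<Rightarrow> complex" where "angular q x = sgn (Z x) powi q"

text \<open>One template for four quantities: according to its coefficients it is the solution, its
  derivative in log r or in \<theta>, or r^2 times its Laplacian, each divided by \<open>E0\<close>.
  Telescoping is then proved once for all four. Only \<open>c0\<close> depends on the
  frequency.\<close>

definition trm where
  "trm c0 c1 c2 p p1 p2 q x =
    (c0 q * of_real (p (tau x)) + c1 * of_real (p1 (tau x)) + c2 * of_real (p2 (tau x))) * angular q x"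

text \<open>Alternating signs make neighbouring modes rotate in opposite directions, which keeps
  their gradients apart.\<close>

definition wave :: "nat \<Rightarrow> int" where "wave j = (if even j then int j ^ 2 else - (int j ^ 2))"
text \<open>The frequency that continues \<open>wave j\<close>, \<open>wave (Suc j)\<close> as an
  arithmetic progression, so that the three harmonics are 1, \<zeta>, \<zeta>^2 up to a common
  factor.\<close>

definition third :: "nat \<Rightarrow> int" where "third j = 2 * wave (Suc j) - wave j"

text \<open>The increment that replaces the harmonic \<open>wave i\<close> by its successor.
  Differences are spelled \<open>+ - 1 *\<close> so that rules for sums and scalar multiples
  suffice.\<close>

definition cell where
  "cell c0 c1 c2 i x =
     trm c0 c1 c2 (\<lambda>\<tau>. smoothstep (\<tau> - real i)) (\<lambda>\<tau>. smoothstep1 (\<tau> - real i)) (\<lambda>\<tau>. smoothstep2 (\<tau> - real i)) (wave (Suc i)) x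
     + - 1 * trm c0 c1 c2 (\<lambda>\<tau>. smoothstep (\<tau> - real i)) (\<lambda>\<tau>. smoothstep1 (\<tau> - real i)) (\<lambda>\<tau>. smoothstep2 (\<tau> - real i)) (wave i) x
     + alpha i * (trm c0 c1 c2 (\<lambda>\<tau>. bump (\<tau> - real i)) (\<lambda>\<tau>. bump1 (\<tau> - real i)) (\<lambda>\<tau>. bump2 (\<tau> - real i)) (third i) x
       + - 1 * trm c0 c1 c2 (\<lambda>\<tau>. bump (\<tau> - real i)) (\<lambda>\<tau>. bump1 (\<tau> - real i)) (\<lambda>\<tau>. bump2 (\<tau> - real i)) (wave i) x)"

text \<open>The sum telescopes: cells below \<open>\<tau>\<close> only exchange harmonics, those above \<open>\<tau>\<close> vanish.\<close>

definition comb where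
  "comb c0 c1 c2 m x = trm c0 c1 c2 (\<lambda>_. 1) (\<lambda>_. 0) (\<lambda>_. 0) (wave n) x + (\<Sum>i\<in>{n..<m}. cell c0 c1 c2 i x)"

text \<open>Chain rule with t' = \<mu> t and derivative - K of - \<Phi>: \<open>cu\<close> gives the
  function, \<open>cr\<close> and \<open>cr1\<close> the derivative in log r, \<open>ct\<close> that
  in \<theta>, and the three \<open>cl\<close> give r^2 times the Laplacian.\<close>

definition "cu = (\<lambda>(q::int) (x :: real ^ 'n). 1 :: complex)"
definition "cr = (\<lambda>(q::int) x. - KX x)"
definition "cr1 = (\<lambda>x. complex_of_real (\<mu> * tau x))"
definition "ct = (\<lambda>(q::int) (x :: real ^ 'n). \<i> * of_int q)"
definition "cl = (\<lambda>(q::int) x. (KX x)\<^sup>2 - KX1 x - (of_int q)\<^sup>2)"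
definition "cl1 = (\<lambda>x. of_real (\<mu>\<^sup>2 * tau x) - 2 * KX x * of_real (\<mu> * tau x))"
definition "cl2 = (\<lambda>x. complex_of_real (\<mu>\<^sup>2 * (tau x)\<^sup>2))"

lemma polar2_term:
  assumes p: "\<And>\<tau>. (p has_real_derivative p1 \<tau>) (at \<tau>)"
    and p1: "\<And>\<tau>. (p1 has_real_derivative p2 \<tau>) (at \<tau>)"
    and p2: "\<And>\<tau>. isCont p2 \<tau>"
  shows "polar2 (- {0}) (\<lambda>x. E0 x * trm (\<lambda>q. cu q x) 0 0 p p1 p2 q x)
     (\<lambda>x. E0 x * trm (\<lambda>q. cr q x) (cr1 x) 0 p p1 p2 q x)
     (\<lambda>x. E0 x * trm (\<lambda>q. ct q x) 0 0 p p1 p2 q x)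
     (\<lambda>x. E0 x * trm (\<lambda>q. cl q x) (cl1 x) (cl2 x) p p1 p2 q x)"
proof -
  define t where "t = (\<lambda>\<rho>. exp (\<mu> * \<rho>))"
  define e where "e = (\<lambda>\<rho>. exp (- \<Phi> \<rho>))"
  define P where "P = (\<lambda>\<rho>. e \<rho> * of_real (p (t \<rho>)))"
  define P1 where "P1 = (\<lambda>\<rho>. e \<rho> * (of_real (\<mu> * t \<rho> * p1 (t \<rho>)) - K \<rho> * of_real (p (t \<rho>))))"
  define P2 where "P2 = (\<lambda>\<rho>. e \<rho> * (of_real (\<mu>\<^sup>2 * (t \<rho>)\<^sup>2 * p2 (t \<rho>))
      + (of_real (\<mu>\<^sup>2 * t \<rho>) - 2 * K \<rho> * of_real (\<mu> * t \<rho>)) * of_real (p1 (t \<rho>))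
      + ((K \<rho>)\<^sup>2 - K1 \<rho>) * of_real (p (t \<rho>))))"
  have de: "(e has_vector_derivative - K \<rho> * e \<rho>) (at \<rho>)" for \<rho>
    using field_vector_diff_chain_at[OF has_vector_derivative_minus[OF dPhi] DERIV_exp]
    by (simp add: e_def o_def)
  have dt: "(t has_real_derivative \<mu> * t \<rho>) (at \<rho>)" for \<rho>
    unfolding t_def by (rule derivative_eq_intros refl | simp)+
  have dp: "((\<lambda>\<rho>. p (t \<rho>)) has_real_derivative p1 (t \<rho>) * (\<mu> * t \<rho>)) (at \<rho>)"
    and dp1: "((\<lambda>\<rho>. p1 (t \<rho>)) has_real_derivative p2 (t \<rho>) * (\<mu> * t \<rho>)) (at \<rho>)" for \<rho>
    using DERIV_chain2[OF p dt] DERIV_chain2[OF p1 dt] by auto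
  have dP: "(P has_vector_derivative P1 \<rho>) (at \<rho>)" for \<rho>
  proof -
    have "(P has_vector_derivative (e \<rho> * of_real (p1 (t \<rho>) * (\<mu> * t \<rho>)) + (- K \<rho> * e \<rho>) * of_real (p (t \<rho>)))) (at \<rho>)"
      unfolding P_def by (intro has_vector_derivative_mult has_vector_derivative_of_real de dp)
    then show ?thesis by (simp add: P1_def algebra_simps)
  qed
  have dP1: "(P1 has_vector_derivative P2 \<rho>) (at \<rho>)" for \<rho>
  proof -
    have "((\<lambda>\<rho>. \<mu> * t \<rho> * p1 (t \<rho>)) has_real_derivative \<mu> * t \<rho> * (p2 (t \<rho>) * (\<mu> * t \<rho>)) + \<mu> * (\<mu> * t \<rho>) * p1 (t \<rho>)) (at \<rho>)"
      by (rule derivative_eq_intros dt dp1 refl | simp add: algebra_simps)+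
    from has_vector_derivative_diff[OF has_vector_derivative_of_real[OF this]
        has_vector_derivative_mult[OF dK has_vector_derivative_of_real[OF dp]]]
    have "(P1 has_vector_derivative (e \<rho> * (of_real (\<mu> * t \<rho> * (p2 (t \<rho>) * (\<mu> * t \<rho>)) + \<mu> * (\<mu> * t \<rho>) * p1 (t \<rho>))
        - (K \<rho> * of_real (p1 (t \<rho>) * (\<mu> * t \<rho>)) + K1 \<rho> * of_real (p (t \<rho>))))
        + (- K \<rho> * e \<rho>) * (of_real (\<mu> * t \<rho> * p1 (t \<rho>)) - K \<rho> * of_real (p (t \<rho>))))) (at \<rho>)"
      unfolding P1_def by (intro has_vector_derivative_mult[OF de])
    then show ?thesis by (simp add: P2_def algebra_simps power2_eq_square)
  qed
  have cP2: "isCont P2 \<rho>" for \<rho>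
  proof -
    have ct: "isCont t \<rho>" using DERIV_isCont[OF dt] .
    have [continuous_intros]: "isCont e \<rho>" "isCont K \<rho>" "isCont K1 \<rho>" "isCont t \<rho>"
      using has_vector_derivative_continuous[OF de] has_vector_derivative_continuous[OF dK] cK1 ct by auto
    have [continuous_intros]: "isCont (\<lambda>\<rho>. p (t \<rho>)) \<rho>" "isCont (\<lambda>\<rho>. p1 (t \<rho>)) \<rho>" "isCont (\<lambda>\<rho>. p2 (t \<rho>)) \<rho>"
      using isCont_o2[OF ct DERIV_isCont[OF p]] isCont_o2[OF ct DERIV_isCont[OF p1]] isCont_o2[OF ct p2] by auto
    show ?thesis unfolding P2_def by (intro continuous_intros)
  qed
  have m: "mode P q (Z x) = E0 x * trm (\<lambda>q. cu q x) 0 0 p p1 p2 q x"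
    "mode P1 q (Z x) = E0 x * trm (\<lambda>q. cr q x) (cr1 x) 0 p p1 p2 q x"
    "\<i> * of_int q * mode P q (Z x) = E0 x * trm (\<lambda>q. ct q x) 0 0 p p1 p2 q x"
    "mode P2 q (Z x) - (of_int q)\<^sup>2 * mode P q (Z x) = E0 x * trm (\<lambda>q. cl q x) (cl1 x) (cl2 x) p p1 p2 q x" for x
    unfolding mode_def norm_Z P_def P1_def P2_def trm_def cu_def cr_def cr1_def ct_def cl_def cl1_def cl2_def
      E0_def KX_def KX1_def tau_def angular_def e_def t_def
    by (simp_all add: algebra_simps)
  show ?thesis
    using has2_mode[OF dP dP1 cP2, of q] unfolding polar2_def m(3,4) unfolding m(1,2) .
qed

lemma polar2_cell:
  "polar2 (- {0}) (\<lambda>x. E0 x * cell (\<lambda>q. cu q x) 0 0 i x)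
     (\<lambda>x. E0 x * cell (\<lambda>q. cr q x) (cr1 x) 0 i x)
     (\<lambda>x. E0 x * cell (\<lambda>q. ct q x) 0 0 i x)
     (\<lambda>x. E0 x * cell (\<lambda>q. cl q x) (cl1 x) (cl2 x) i x)"
proof -
  have shift: "((\<lambda>\<tau>. f (\<tau> - a)) has_real_derivative f' (\<tau> - a)) (at \<tau>)"
    if "\<And>\<tau>. (f has_real_derivative f' \<tau>) (at \<tau>)" for f f' :: "real \<Rightarrow> real" and a \<tau>
    using DERIV_shift[of f "f' (\<tau> - a)" \<tau> "- a"] that by simp
  have cshift: "isCont (\<lambda>\<tau>. f (\<tau> - a)) \<tau>" if "\<And>\<tau>. isCont f \<tau>" for f :: "real \<Rightarrow> real" and a \<tau>
    by (rule isCont_o2[OF _ that]) (intro continuous_intros)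
  have bs: "polar2 (- {0}) (\<lambda>x. E0 x * trm (\<lambda>q. cu q x) 0 0 (\<lambda>\<tau>. smoothstep (\<tau> - real i)) (\<lambda>\<tau>. smoothstep1 (\<tau> - real i)) (\<lambda>\<tau>. smoothstep2 (\<tau> - real i)) q x)
     (\<lambda>x. E0 x * trm (\<lambda>q. cr q x) (cr1 x) 0 (\<lambda>\<tau>. smoothstep (\<tau> - real i)) (\<lambda>\<tau>. smoothstep1 (\<tau> - real i)) (\<lambda>\<tau>. smoothstep2 (\<tau> - real i)) q x)
     (\<lambda>x. E0 x * trm (\<lambda>q. ct q x) 0 0 (\<lambda>\<tau>. smoothstep (\<tau> - real i)) (\<lambda>\<tau>. smoothstep1 (\<tau> - real i)) (\<lambda>\<tau>. smoothstep2 (\<tau> - real i)) q x)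
     (\<lambda>x. E0 x * trm (\<lambda>q. cl q x) (cl1 x) (cl2 x) (\<lambda>\<tau>. smoothstep (\<tau> - real i)) (\<lambda>\<tau>. smoothstep1 (\<tau> - real i)) (\<lambda>\<tau>. smoothstep2 (\<tau> - real i)) q x)" for q
    by (rule polar2_term) (rule shift cshift, rule smoothstep_deriv smoothstep1_deriv smoothstep2_cont)+
  have be: "polar2 (- {0}) (\<lambda>x. E0 x * trm (\<lambda>q. cu q x) 0 0 (\<lambda>\<tau>. bump (\<tau> - real i)) (\<lambda>\<tau>. bump1 (\<tau> - real i)) (\<lambda>\<tau>. bump2 (\<tau> - real i)) q x)
     (\<lambda>x. E0 x * trm (\<lambda>q. cr q x) (cr1 x) 0 (\<lambda>\<tau>. bump (\<tau> - real i)) (\<lambda>\<tau>. bump1 (\<tau> - real i)) (\<lambda>\<tau>. bump2 (\<tau> - real i)) q x)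
     (\<lambda>x. E0 x * trm (\<lambda>q. ct q x) 0 0 (\<lambda>\<tau>. bump (\<tau> - real i)) (\<lambda>\<tau>. bump1 (\<tau> - real i)) (\<lambda>\<tau>. bump2 (\<tau> - real i)) q x)
     (\<lambda>x. E0 x * trm (\<lambda>q. cl q x) (cl1 x) (cl2 x) (\<lambda>\<tau>. bump (\<tau> - real i)) (\<lambda>\<tau>. bump1 (\<tau> - real i)) (\<lambda>\<tau>. bump2 (\<tau> - real i)) q x)" for q
    by (rule polar2_term) (rule shift cshift, rule bump_deriv bump1_deriv bump2_cont)+
  have dist: "E0 x * cell c0 c1 c2 i x =
     E0 x * trm c0 c1 c2 (\<lambda>\<tau>. smoothstep (\<tau> - real i)) (\<lambda>\<tau>. smoothstep1 (\<tau> - real i)) (\<lambda>\<tau>. smoothstep2 (\<tau> - real i)) (wave (Suc i)) x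
     + - 1 * (E0 x * trm c0 c1 c2 (\<lambda>\<tau>. smoothstep (\<tau> - real i)) (\<lambda>\<tau>. smoothstep1 (\<tau> - real i)) (\<lambda>\<tau>. smoothstep2 (\<tau> - real i)) (wave i) x)
     + alpha i * (E0 x * trm c0 c1 c2 (\<lambda>\<tau>. bump (\<tau> - real i)) (\<lambda>\<tau>. bump1 (\<tau> - real i)) (\<lambda>\<tau>. bump2 (\<tau> - real i)) (third i) x
       + - 1 * (E0 x * trm c0 c1 c2 (\<lambda>\<tau>. bump (\<tau> - real i)) (\<lambda>\<tau>. bump1 (\<tau> - real i)) (\<lambda>\<tau>. bump2 (\<tau> - real i)) (wave i) x))"
    for c0 c1 c2 x
    unfolding cell_def by (simp add: algebra_simps)
  show ?thesis
    unfolding dist by (intro polar2_add polar2_cmult bs be)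
qed

lemma polar2_comb:
  "polar2 (- {0}) (\<lambda>x. E0 x * comb (\<lambda>q. cu q x) 0 0 m x)
     (\<lambda>x. E0 x * comb (\<lambda>q. cr q x) (cr1 x) 0 m x)
     (\<lambda>x. E0 x * comb (\<lambda>q. ct q x) 0 0 m x)
     (\<lambda>x. E0 x * comb (\<lambda>q. cl q x) (cl1 x) (cl2 x) m x)"
  unfolding comb_def distrib_left sum_distrib_left
  by (intro polar2_add polar2_sum polar2_cell polar2_term) (auto intro: derivative_eq_intros)

lemma cell_below:
  assumes "tau x \<ge> real i + 1"
  shows "cell c0 c1 c2 i x = c0 (wave (Suc i)) * angular (wave (Suc i)) x - c0 (wave i) * angular (wave i) x"
  using assms unfolding cell_def trm_def
  by (simp add: bump_def bump1_def bump2_def smoothstep_ge_1)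

lemma cell_above:
  assumes "tau x \<le> real i"
  shows "cell c0 c1 c2 i x = 0"
  using assms unfolding cell_def trm_def
  by (simp add: bump_def bump1_def bump2_def smoothstep_le_0)

lemma comb_inner:
  assumes "tau x \<le> real n"
  shows "comb c0 c1 c2 m x = c0 (wave n) * angular (wave n) x"
  using assms unfolding comb_def by (simp add: cell_above trm_def)

lemma comb_outer:
  assumes j: "n \<le> j" "j < m" and x: "real j \<le> tau x" "tau x \<le> real j + 1"
  shows "comb c0 c1 c2 m x = c0 (wave j) * angular (wave j) x + cell c0 c1 c2 j x"
proof -
  have "{n..<m} = {n..<j} \<union> {j..<m}" "{n..<j} \<inter> {j..<m} = {}" using j by auto
  then have "(\<Sum>i\<in>{n..<m}. cell c0 c1 c2 i x) = (\<Sum>i\<in>{n..<j}. cell c0 c1 c2 i x) + (\<Sum>i\<in>{j..<m}. cell c0 c1 c2 i x)"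
    by (simp add: sum.union_disjoint)
  also have "(\<Sum>i\<in>{n..<j}. cell c0 c1 c2 i x) = (\<Sum>i = n..<j. c0 (wave (Suc i)) * angular (wave (Suc i)) x - c0 (wave i) * angular (wave i) x)"
    using x by (intro sum.cong cell_below) auto
  also have "\<dots> = c0 (wave j) * angular (wave j) x - c0 (wave n) * angular (wave n) x"
    by (rule sum_Suc_diff'[OF j(1)])
  also have "(\<Sum>i\<in>{j..<m}. cell c0 c1 c2 i x) = cell c0 c1 c2 j x + (\<Sum>i\<in>{Suc j..<m}. cell c0 c1 c2 i x)"
    by (rule sum.atLeast_Suc_lessThan[OF j(2)])
  also have "(\<Sum>i\<in>{Suc j..<m}. cell c0 c1 c2 i x) = 0"
    using x by (intro sum.neutral ballI cell_above) auto
  finally show ?thesis unfolding comb_def by (simp add: trm_def)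
qed

lemma tau_pos: "tau x > 0" by (simp add: tau_def)

lemma floor_tau: "real (nat \<lfloor>tau x\<rfloor>) \<le> tau x" "tau x < real (nat \<lfloor>tau x\<rfloor>) + 1"
  using tau_pos[of x] by linarith+

text \<open>The number of cells in \<open>U\<close> depends on the point, but on an open set it may
  be replaced by any fixed larger number; so no infinite sum has to be differentiated.\<close>

lemma comb_eq:
  assumes "tau x < real m"
  shows "comb c0 c1 c2 m x = comb c0 c1 c2 (Suc (nat \<lfloor>tau x\<rfloor>)) x"
proof (cases "tau x \<le> real n")
  case True
  then show ?thesis by (simp add: comb_inner)
next
  case False
  then have "n \<le> nat \<lfloor>tau x\<rfloor>" using floor_tau[of x] by linarith
  moreover have "nat \<lfloor>tau x\<rfloor> < m" using assms floor_tau[of x] by linarith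
  ultimately show ?thesis using floor_tau[of x] by (simp add: comb_outer)
qed

definition U :: "real ^ 'n \<Rightarrow> complex" where
  "U x = E0 x * comb (\<lambda>q. cu q x) 0 0 (Suc (nat \<lfloor>tau x\<rfloor>)) x"

definition Fr :: "real ^ 'n \<Rightarrow> complex" where
  "Fr x = E0 x * comb (\<lambda>q. cr q x) (cr1 x) 0 (Suc (nat \<lfloor>tau x\<rfloor>)) x"

definition Ft :: "real ^ 'n \<Rightarrow> complex" where
  "Ft x = E0 x * comb (\<lambda>q. ct q x) 0 0 (Suc (nat \<lfloor>tau x\<rfloor>)) x"

definition Lp :: "real ^ 'n \<Rightarrow> complex" where
  "Lp x = E0 x * comb (\<lambda>q. cl q x) (cl1 x) (cl2 x) (Suc (nat \<lfloor>tau x\<rfloor>)) x"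

lemma continuous_on_tau: "continuous_on (- {0}) tau"
  unfolding tau_def by (intro continuous_intros) auto

lemma tau_less_open: "open {x \<in> - {0}. tau x < c}"
proof -
  have "open (- {0} \<inter> tau -` {..<c})"
    by (rule continuous_open_preimage[OF continuous_on_tau]) auto
  moreover have "{x \<in> - {0}. tau x < c} = - {0} \<inter> tau -` {..<c}" by auto
  ultimately show ?thesis by simp
qed

lemma U_local:
  "has2 {x \<in> - {0}. tau x < real m} U
     (\<lambda>j x. E0 x * comb (\<lambda>q. cr q x) (cr1 x) 0 m x * of_real (Re (w j / Z x))
        + E0 x * comb (\<lambda>q. ct q x) 0 0 m x * of_real (Im (w j / Z x)))
     (\<lambda>x. E0 x * comb (\<lambda>q. cl q x) (cl1 x) (cl2 x) m x / of_real ((norm x)\<^sup>2))"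
  by (rule has2_cong[OF has2_subset[OF polar2_comb[of m, unfolded polar2_def]]])
     (use tau_less_open in \<open>auto simp: U_def comb_eq\<close>)

lemma U_derivs:
  assumes "x \<noteq> 0"
  shows "gradient U x = (\<chi> j. Fr x * of_real (Re (w j / Z x)) + Ft x * of_real (Im (w j / Z x)))"
    and "laplacian U x = Lp x / of_real ((norm x)\<^sup>2)"
proof -
  have x: "x \<in> {x \<in> - {0}. tau x < real (Suc (nat \<lfloor>tau x\<rfloor>))}"
    using assms floor_tau[of x] by (simp add: add.commute)
  show "gradient U x = (\<chi> j. Fr x * of_real (Re (w j / Z x)) + Ft x * of_real (Im (w j / Z x)))"
    using has2_gradient[OF U_local, of x "Suc (nat \<lfloor>tau x\<rfloor>)"] x by (simp add: Fr_def Ft_def)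
  show "laplacian U x = Lp x / of_real ((norm x)\<^sup>2)"
    using has2_laplacian[OF U_local, of x "Suc (nat \<lfloor>tau x\<rfloor>)"] x by (simp add: Lp_def)
qed

section \<open>The solution near the origin\<close>

definition r1 :: real where "r1 = exp (ln (real n - 1) / \<mu>)"

lemma r1_pos: "r1 > 0" by (simp add: r1_def)

lemma tau_le_inner: "x \<noteq> 0 \<Longrightarrow> norm x < r1 \<Longrightarrow> tau x \<le> real n - 1"
proof -
  assume x: "x \<noteq> 0" "norm x < r1"
  have n1: "real n - 1 > 0" using n by simp
  have "ln (norm x) < ln (real n - 1) / \<mu>"
    using x by (metis r1_def ln_exp ln_less_cancel_iff r1_pos zero_less_norm_iff)
  then have "\<mu> * ln (norm x) \<le> ln (real n - 1)" using mu by (simp add: field_simps)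
  then have "exp (\<mu> * ln (norm x)) \<le> exp (ln (real n - 1))" by simp
  then show "tau x \<le> real n - 1" using n1 by (simp add: tau_def)
qed

lemma wave_n: "wave n = int (n\<^sup>2)" "n\<^sup>2 > 0" using n by (auto simp: wave_def)

text \<open>Near the origin \<open>U\<close> is a monomial, hence smooth there although polar coordinates degenerate.\<close>

lemma U_near_0: "\<exists>c. c \<noteq> 0 \<and> (\<forall>x. norm x < r1 \<longrightarrow> U x = c * Z x ^ (n\<^sup>2))"
proof -
  define S where "S = {\<rho>. exp (\<mu> * \<rho>) \<le> real n - 1}"
  have n1: "real n - 1 > 0" using n by simp
  have S: "S = {..ln (real n - 1) / \<mu>}"
  proof -
    have "exp (\<mu> * \<rho>) \<le> real n - 1 \<longleftrightarrow> \<rho> \<le> ln (real n - 1) / \<mu>" for \<rho>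
      using mu n1 by (subst ln_ge_iff[symmetric]) (auto simp: field_simps)
    then show ?thesis by (auto simp: S_def)
  qed
  \<comment> \<open>On this half-line \<Phi> has the constant slope - n^2.\<close>
  have "\<exists>d. \<forall>\<rho>\<in>S. \<Phi> \<rho> + of_real \<rho> * of_nat (n\<^sup>2) = d"
  proof (rule has_vector_derivative_zero_constant[of S])
    show "convex S" unfolding S by simp
    fix \<rho> assume "\<rho> \<in> S"
    then have "K \<rho> = - of_nat (n\<^sup>2)" using K_inner[of \<rho>] by (simp add: S_def)
    moreover have "((\<lambda>\<rho>. complex_of_real \<rho>) has_vector_derivative of_real 1) (at \<rho>)"
      by (intro has_vector_derivative_of_real) simp
    from has_vector_derivative_add[OF dPhi has_vector_derivative_mult_left[OF this]]
    have "((\<lambda>\<rho>. \<Phi> \<rho> + of_real \<rho> * of_nat (n\<^sup>2)) has_vector_derivative K \<rho> + of_real 1 * of_nat (n\<^sup>2)) (at \<rho>)" .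
    ultimately show "((\<lambda>\<rho>. \<Phi> \<rho> + of_real \<rho> * of_nat (n\<^sup>2)) has_vector_derivative 0) (at \<rho> within S)"
      by (simp add: has_vector_derivative_at_within)
  qed metis
  then obtain d where d: "\<And>\<rho>. \<rho> \<in> S \<Longrightarrow> \<Phi> \<rho> + of_real \<rho> * of_nat (n\<^sup>2) = d" by blast
  have "U x = exp (- d) * Z x ^ (n\<^sup>2)" if x: "norm x < r1" for x
  proof (cases "x = 0")
    case True
    have "Z 0 = 0" by (simp add: Z_eq_0)
    then have "angular (wave n) 0 = 0" using wave_n by (simp add: angular_def power_int_def)
    \<comment> \<open>Since \<open>ln 0 = 0\<close>, \<open>tau 0 = 1\<close> and the origin falls
      under the inner formula; \<open>angular\<close> vanishes there because
      \<open>sgn 0 = 0\<close> and the frequency is positive.\<close>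
    moreover have "tau 0 \<le> real n" using n by (simp add: tau_def)
    ultimately show ?thesis using True wave_n(2) by (simp add: U_def comb_inner Z_eq_0 zero_power)
  next
    case False
    then have t: "tau x \<le> real n - 1" using tau_le_inner x by blast
    then have "\<Phi> (ln (norm x)) = d - of_real (ln (norm x)) * of_nat (n\<^sup>2)"
      using d[of "ln (norm x)"] by (simp add: S_def tau_def algebra_simps)
    then have "E0 x = exp (of_nat (n\<^sup>2) * of_real (ln (norm x)) - d)" by (simp add: E0_def mult.commute)
    also have "\<dots> = exp (- d) * exp (of_nat (n\<^sup>2) * of_real (ln (norm x)))"
      by (simp only: exp_diff exp_minus divide_inverse mult.commute)
    also have "\<dots> = exp (- d) * exp (of_real (ln (norm x))) ^ (n\<^sup>2)"
      by (simp only: exp_of_nat_mult)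
    also have "exp (complex_of_real (ln (norm x))) = of_real (norm x)"
      using False by (simp add: exp_of_real)
    finally have "E0 x = exp (- d) * of_real (norm x) ^ (n\<^sup>2)" .
    moreover have "angular (wave n) x = sgn (Z x) ^ (n\<^sup>2)" by (simp add: angular_def wave_n del: of_nat_power)
    moreover have "of_real (norm x) * sgn (Z x) = Z x"
      using False by (simp add: sgn_div_norm norm_Z Z_eq_0 scaleR_conv_of_real)
    ultimately show ?thesis
      using t by (simp add: U_def comb_inner cu_def mult.assoc flip: power_mult_distrib)
  qed
  then show ?thesis by (intro exI[of _ "exp (- d)"]) simp
qed

lemma U_near_0_has2: "\<exists>p. has2 (ball 0 r1) U p (\<lambda>_. 0)"
proof -
  obtain c where c: "\<And>x. norm x < r1 \<Longrightarrow> U x = c * Z x ^ (n\<^sup>2)" using U_near_0 by blast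
  show ?thesis
    by (rule exI, rule has2_cong[OF has2_subset[OF has2_power[of c "n\<^sup>2"]]]) (use c in auto)
qed

lemma U_C2: "C2 U"
proof (rule C2_if_locally_has2)
  fix x :: "real ^ 'n"
  show "\<exists>A p L. x \<in> A \<and> has2 A U p L"
  proof (cases "x = 0")
    case True
    obtain p where "has2 (ball 0 r1) U p (\<lambda>_. 0)" using U_near_0_has2 by blast
    then show ?thesis using True r1_pos by (intro exI[of _ "ball 0 r1"] exI conjI) auto
  next
    case False
    then have "x \<in> {y \<in> - {0}. tau y < real (Suc (nat \<lfloor>tau x\<rfloor>))}"
      using floor_tau[of x] by (simp add: add.commute)
    then show ?thesis using U_local[of "Suc (nat \<lfloor>tau x\<rfloor>)"] by (intro exI conjI)
  qed
qed

lemma U_0: "U 0 = 0" "laplacian U 0 = 0"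
proof -
  obtain c where "\<And>x. norm x < r1 \<Longrightarrow> U x = c * Z x ^ (n\<^sup>2)" using U_near_0 by blast
  from this[of 0] show "U 0 = 0" using r1_pos wave_n(2) by (simp add: Z_eq_0 zero_power)
  obtain p where "has2 (ball 0 r1) U p (\<lambda>_. 0)" using U_near_0_has2 by blast
  from has2_laplacian[OF this, of 0] show "laplacian U 0 = 0" using r1_pos by simp
qed

lemma U_nonzero: "\<exists>x. U x \<noteq> 0"
proof -
  obtain c where c: "c \<noteq> 0" "\<And>x. norm x < r1 \<Longrightarrow> U x = c * Z x ^ (n\<^sup>2)" using U_near_0 by blast
  define x :: "real ^ 'n" where "x = (r1 / 2) *\<^sub>R axis i1 1"
  have "norm x < r1" "x \<noteq> 0" using r1_pos by (auto simp: x_def axis_eq_0_iff)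
  then show ?thesis using c by (intro exI[of _ x]) (simp add: Z_eq_0)
qed

end

section \<open>Estimates and conclusion\<close>

context construction
begin

lemma norm_angular: "x \<noteq> 0 \<Longrightarrow> norm (angular q x) = 1"
  by (simp add: angular_def norm_power_int norm_sgn Z_eq_0)

lemma angular_add: "x \<noteq> 0 \<Longrightarrow> angular (p + q) x = angular p x * angular q x"
  by (simp add: angular_def power_int_add sgn_zero_iff Z_eq_0)

text \<open>The factors \<open>E0\<close> and \<open>e0\<close> are common to the solution and its
  error, so the bounds reduce to those for polynomials in \<zeta> on one cell.\<close>

lemma outer_estimates:
  assumes x: "x \<noteq> 0" and out: "tau x \<ge> real n"
  shows "norm (Lp x + l * of_real ((norm x)\<^sup>2) * U x) \<le> 600 * tau x ^ 3 * norm (U x)"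
    and "norm (U x) \<le> 3 * norm (E0 x)"
    and "norm (E0 x) * ((tau x)\<^sup>2 / 2) \<le> norm (Fr x) + norm (Ft x)"
proof -
  define j where "j = nat \<lfloor>tau x\<rfloor>"
  have j: "n \<le> j" "real j \<le> tau x" "tau x \<le> real j + 1"
    using out floor_tau[of x] unfolding j_def by linarith+
  define s where "s = tau x - real j"
  interpret T: transition \<mu> l n J J1 K K1 \<Phi> j "ln (norm x)" "tau x" s "smoothstep s" "1 - 2 * smoothstep s" "1 - 2 * s"
    "real j ^ 2" "real (j + 1) ^ 2" "2 * real (j + 1) ^ 2 + real j ^ 2"
    by standard (use j in \<open>auto simp: tau_def s_def\<close>)
  define a where "a = real j ^ 2"
  define b where "b = real (j + 1) ^ 2"
  define m where "m = 2 * b + a"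
  \<comment> \<open>The sign of the outgoing frequency: even cells lead from j^2 to - (j + 1)^2, odd
    ones from - j^2 to (j + 1)^2.\<close>
  define \<sigma> :: complex where "\<sigma> = (if even j then 1 else - 1)"
  have sg: "\<sigma> = 1 \<or> \<sigma> = - 1" by (simp add: \<sigma>_def)
  have k: "of_int (wave j) = \<sigma> * of_real a" "of_int (wave (Suc j)) = - (\<sigma> * of_real b)"
    by (auto simp: wave_def \<sigma>_def a_def b_def)
  have kl: "of_int (third j) = - (\<sigma> * of_real m)"
    unfolding third_def of_int_diff of_int_mult k by (simp add: m_def algebra_simps)
  have k2: "(of_int (wave j))\<^sup>2 = complex_of_real (a\<^sup>2)" "(of_int (wave (Suc j)))\<^sup>2 = complex_of_real (b\<^sup>2)"
    "(of_int (third j))\<^sup>2 = complex_of_real (m\<^sup>2)"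
    unfolding k kl using sg by (auto simp: power_mult_distrib)
  define e0 where "e0 = angular (wave j) x"
  define e1 where "e1 = angular (wave (Suc j)) x"
  define e2 where "e2 = angular (third j) x"
  have ne: "norm e0 = 1" "norm e1 = 1" "norm e2 = 1" using norm_angular[OF x] by (auto simp: e0_def e1_def e2_def)
  define \<zeta> where "\<zeta> = angular (wave (Suc j) - wave j) x"
  have z: "norm \<zeta> = 1" using norm_angular[OF x] by (simp add: \<zeta>_def)
  have ez: "e1 = e0 * \<zeta>" "e2 = e0 * \<zeta>\<^sup>2"
    unfolding e0_def e1_def e2_def \<zeta>_def power2_eq_square angular_add[OF x, symmetric]
    by (simp_all add: third_def)
  have comb: "comb c0 c1 c2 (Suc (nat \<lfloor>tau x\<rfloor>)) x =
      (c0 (wave j) * T.A0 + (- (c1 * of_real (smoothstep1 s) + c2 * of_real (smoothstep2 s)) - alpha j * (c1 * of_real (bump1 s) + c2 * of_real (bump2 s)))) * e0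
      + (c0 (wave (Suc j)) * T.A1 + (c1 * of_real (smoothstep1 s) + c2 * of_real (smoothstep2 s))) * e1
      + (c0 (third j) * T.A2 + alpha j * (c1 * of_real (bump1 s) + c2 * of_real (bump2 s))) * e2" for c0 c1 c2
    using comb_outer[OF j(1) _ j(2,3), of "Suc (nat \<lfloor>tau x\<rfloor>)" c0 c1 c2]
    unfolding cell_def trm_def e0_def[symmetric] e1_def[symmetric] e2_def[symmetric] s_def[symmetric] T.A0_def T.A1_def T.A2_def
    by (simp add: j_def algebra_simps)
  have U: "U x = E0 x * (T.A0 * e0 + T.A1 * e1 + T.A2 * e2)"
    unfolding U_def comb cu_def by simp
  have Uz: "norm (U x) = norm (E0 x) * norm (T.A0 + T.A1 * \<zeta> + T.A2 * \<zeta>\<^sup>2)"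
  proof -
    have "U x = E0 x * e0 * (T.A0 + T.A1 * \<zeta> + T.A2 * \<zeta>\<^sup>2)" unfolding U ez by (simp add: algebra_simps)
    then show ?thesis using ne by (simp add: norm_mult)
  qed
  show "norm (U x) \<le> 3 * norm (E0 x)"
    unfolding U norm_mult using mult_left_mono[OF T.solution_upper[OF ne] norm_ge_zero[of "E0 x"]]
    by (simp add: mult.commute)
  have R: "cl1 x * of_real p1 + cl2 x * of_real p2 = T.R p1 p2" for p1 p2
    unfolding cl1_def cl2_def T.R_def KX_def T.KK_eq by (simp add: algebra_simps power2_eq_square)
  have Y: "T.Y = (KX x)\<^sup>2 - KX1 x + l * of_real ((norm x)\<^sup>2)"
    unfolding T.Y_def KX_def KX1_def using x by simp
  have "Lp x + l * of_real ((norm x)\<^sup>2) * U x = E0 x * (T.C0 * e0 + T.C1 * e1 + T.C2 * e2)"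
    unfolding Lp_def comb R U T.C0_def T.C1_def T.C2_def cl_def k2 Y
    unfolding a_def[symmetric] b_def[symmetric] unfolding m_def[symmetric]
    by (simp add: algebra_simps)
  also have "\<dots> = E0 x * e0 * (T.C0 + T.C1 * \<zeta> + T.C2 * \<zeta>\<^sup>2)" unfolding ez by (simp add: algebra_simps)
  finally have "norm (Lp x + l * of_real ((norm x)\<^sup>2) * U x) = norm (E0 x) * norm (T.C0 + T.C1 * \<zeta> + T.C2 * \<zeta>\<^sup>2)"
    using ne by (simp add: norm_mult)
  also have "\<dots> \<le> norm (E0 x) * (600 * tau x ^ 3 * norm (T.A0 + T.A1 * \<zeta> + T.A2 * \<zeta>\<^sup>2))"
    by (intro mult_left_mono T.core_error z) simp
  also have "\<dots> = 600 * tau x ^ 3 * norm (U x)" unfolding Uz by simp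
  finally show "norm (Lp x + l * of_real ((norm x)\<^sup>2) * U x) \<le> 600 * tau x ^ 3 * norm (U x)" .
  define F where "F = (T.D0 - KX x * T.A0) * e0 + (T.D1 - KX x * T.A1) * e1 + (T.D2 - KX x * T.A2) * e2"
  define G where "G = \<i> * (\<sigma> * of_real a) * T.A0 * e0 - \<i> * (\<sigma> * of_real b) * T.A1 * e1 - \<i> * (\<sigma> * of_real m) * T.A2 * e2"
  have "Fr x = E0 x * F"
    unfolding Fr_def comb cr_def cr1_def F_def T.D0_def T.D1_def T.D2_def by (simp add: algebra_simps)
  moreover have "Ft x = E0 x * G"
    unfolding Ft_def comb ct_def G_def k kl by (simp add: algebra_simps)
  moreover have "(tau x)\<^sup>2 / 2 \<le> norm F + norm G"
    using T.core_gradient[OF ne sg] unfolding F_def G_def KX_def a_def b_def m_def .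
  then have "norm (E0 x) * ((tau x)\<^sup>2 / 2) \<le> norm (E0 x) * (norm F + norm G)"
    by (intro mult_left_mono) auto
  ultimately show "norm (E0 x) * ((tau x)\<^sup>2 / 2) \<le> norm (Fr x) + norm (Ft x)"
    by (simp add: norm_mult distrib_left)
qed

definition r2 :: real where "r2 = exp (ln (real n) / \<mu>)"

lemma r2_ge_1: "r2 \<ge> 1"
  using n mu by (simp add: r2_def)

lemma tau_ge_iff: "x \<noteq> 0 \<Longrightarrow> tau x \<ge> real n \<longleftrightarrow> norm x \<ge> r2"
proof -
  assume x: "x \<noteq> 0"
  have "tau x \<ge> real n \<longleftrightarrow> \<mu> * ln (norm x) \<ge> ln (real n)"
    using n by (subst ln_le_cancel_iff[symmetric]) (auto simp: tau_def)
  also have "\<dots> \<longleftrightarrow> ln (norm x) \<ge> ln (real n) / \<mu>" using mu by (simp add: field_simps)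
  also have "\<dots> \<longleftrightarrow> norm x \<ge> r2" using x unfolding r2_def by (subst ln_ge_iff) auto
  finally show ?thesis .
qed

lemma tau_powr: "x \<noteq> 0 \<Longrightarrow> tau x = norm x powr \<mu>"
  by (simp add: tau_def powr_def)

lemma U_error:
  assumes "x \<noteq> 0"
  shows "norm (laplacian U x + l * U x) = norm (Lp x + l * of_real ((norm x)\<^sup>2) * U x) / (norm x)\<^sup>2"
proof -
  have "laplacian U x + l * U x = (Lp x + l * of_real ((norm x)\<^sup>2) * U x) / of_real ((norm x)\<^sup>2)"
    unfolding U_derivs(2)[OF assms] using assms by (simp add: field_simps)
  then show ?thesis by (simp add: norm_divide norm_power)
qed

lemma gradient_ge:
  assumes "x \<noteq> 0"
  shows "norm (Fr x) + norm (Ft x) \<le> 4 * norm x * norm (gradient U x)"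
  unfolding U_derivs(1)[OF assms] by (rule polar_gradient_ge[OF assms])

lemma outer_V:
  assumes "norm x \<ge> r2"
  shows "norm (laplacian U x + l * U x) \<le> 600 * norm x powr (3 * \<mu> - 2) * norm (U x)"
proof -
  have x: "x \<noteq> 0" "norm x > 0" using assms r2_ge_1 by auto
  then have t: "tau x \<ge> real n" using tau_ge_iff assms by blast
  have "tau x ^ 3 = norm x powr (3 * \<mu>)"
    using x by (simp add: tau_powr powr_powr mult.commute flip: powr_numeral)
  then have "norm x powr (3 * \<mu> - 2) = tau x ^ 3 / (norm x)\<^sup>2"
    using x by (simp add: powr_diff powr_numeral)
  moreover have "norm (laplacian U x + l * U x) \<le> 600 * tau x ^ 3 * norm (U x) / (norm x)\<^sup>2"
    unfolding U_error[OF x(1)] by (intro divide_right_mono outer_estimates(1)[OF x(1) t]) simp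
  ultimately show ?thesis by simp
qed

text \<open>The error is at most 1800 t^3 |E0| / r^2 and the gradient at least t^2 |E0| / (8 r), so
  the zeros of U need no care; the quotient is 14400 t / r.\<close>

lemma outer_W:
  assumes "norm x \<ge> r2"
  shows "norm (laplacian U x + l * U x) \<le> 14400 * norm x powr (\<mu> - 1) * norm (gradient U x)"
proof -
  have x: "x \<noteq> 0" "norm x > 0" using assms r2_ge_1 by auto
  then have t: "tau x \<ge> real n" using tau_ge_iff assms by blast
  have tpow: "tau x > 0" by (rule tau_pos)
  have "norm (E0 x) * ((tau x)\<^sup>2 / 2) \<le> 4 * norm x * norm (gradient U x)"
    using outer_estimates(3)[OF x(1) t] gradient_ge[OF x(1)] by linarith
  then have E: "norm (E0 x) * (tau x)\<^sup>2 \<le> 8 * norm x * norm (gradient U x)" by simp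
  have "norm (Lp x + l * of_real ((norm x)\<^sup>2) * U x) \<le> 600 * tau x ^ 3 * (3 * norm (E0 x))"
    using outer_estimates(1,2)[OF x(1) t] mult_left_mono[of "norm (U x)" "3 * norm (E0 x)" "600 * tau x ^ 3"] tpow
    by (meson order_trans less_imp_le mult_nonneg_nonneg zero_le_numeral zero_le_power)
  also have "\<dots> = 1800 * tau x * (norm (E0 x) * (tau x)\<^sup>2)" by (simp add: power2_eq_square power3_eq_cube)
  also have "\<dots> \<le> 1800 * tau x * (8 * norm x * norm (gradient U x))"
    using tpow by (intro mult_left_mono E) auto
  finally have "norm (laplacian U x + l * U x) \<le> 1800 * tau x * (8 * norm x * norm (gradient U x)) / (norm x)\<^sup>2"
    unfolding U_error[OF x(1)] by (intro divide_right_mono) auto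
  also have "\<dots> = 14400 * (tau x / norm x) * norm (gradient U x)"
    using x(2) by (simp add: power2_eq_square field_simps)
  also have "tau x / norm x = norm x powr (\<mu> - 1)"
    using x by (simp add: tau_powr powr_diff)
  finally show ?thesis .
qed

text \<open>Inside \<open>r2\<close> the solution is a single mode, and the error is U times M / r^2
  + \<lambda>. M is bounded on the annulus and vanishes below \<open>r1\<close>, where U is a
  harmonic monomial, so the division by r^2 is harmless.\<close>

lemma inner_V: "\<exists>C\<ge>0. \<forall>x. norm x \<le> r2 \<longrightarrow> norm (laplacian U x + l * U x) \<le> C * norm (U x)"
proof -
  define I where "I = {ln r1..ln r2}"
  define M where "M = (\<lambda>\<rho>. (K \<rho>)\<^sup>2 - K1 \<rho> - (of_int (wave n))\<^sup>2)"
  have cK: "isCont K \<rho>" for \<rho> using has_vector_derivative_continuous[OF dK] .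
  have "compact (M ` I)"
    unfolding M_def I_def
    by (intro compact_continuous_image continuous_at_imp_continuous_on ballI continuous_intros cK cK1 compact_Icc)
  then obtain B where B: "\<And>\<rho>. \<rho> \<in> I \<Longrightarrow> norm (M \<rho>) \<le> B"
    using compact_imp_bounded bounded_iff by (metis imageI)
  define C where "C = \<bar>B\<bar> / r1\<^sup>2 + norm l"
  have C: "C \<ge> 0" by (simp add: C_def)
  have "norm (laplacian U x + l * U x) \<le> C * norm (U x)" if r: "norm x \<le> r2" for x
  proof (cases "x = 0")
    case True
    then show ?thesis using U_0 by simp
  next
    case False
    then have t: "tau x \<le> real n"
    proof (cases "norm x = r2")
      case True
      then show ?thesis using n mu by (simp add: tau_def r2_def)
    qed (use tau_ge_iff[OF False] r in linarith)
    have "Lp x + l * of_real ((norm x)\<^sup>2) * U x = (M (ln (norm x)) + l * of_real ((norm x)\<^sup>2)) * U x"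
      unfolding Lp_def U_def comb_inner[OF t] by (simp add: cl_def cu_def M_def KX_def KX1_def algebra_simps)
    then have "norm (laplacian U x + l * U x) = norm (M (ln (norm x)) + l * of_real ((norm x)\<^sup>2)) * norm (U x) / (norm x)\<^sup>2"
      unfolding U_error[OF False] by (simp only: norm_mult)
    also have "\<dots> \<le> (C * (norm x)\<^sup>2) * norm (U x) / (norm x)\<^sup>2"
    proof (intro divide_right_mono mult_right_mono)
      have M: "norm (M (ln (norm x))) \<le> \<bar>B\<bar> / r1\<^sup>2 * (norm x)\<^sup>2"
      proof (cases "norm x < r1")
        case True
        then have "exp (\<mu> * ln (norm x)) \<le> real n - 1" using tau_le_inner[OF False] by (simp add: tau_def)
        from K_inner[OF this] have "M (ln (norm x)) = 0"
          unfolding M_def wave_n by simp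
        then show ?thesis by simp
      next
        case F: False
        then have "ln (norm x) \<in> I" using r r1_pos r2_ge_1 False by (auto simp: I_def)
        then have "norm (M (ln (norm x))) \<le> \<bar>B\<bar> * 1" using B by force
        also have "1 \<le> (norm x)\<^sup>2 / r1\<^sup>2" using F r1_pos by (simp add: power_mono)
        finally show ?thesis by (simp add: mult_left_mono)
      qed
      show "norm (M (ln (norm x)) + l * of_real ((norm x)\<^sup>2)) \<le> C * (norm x)\<^sup>2"
        using norm_triangle_ineq[of "M (ln (norm x))" "l * of_real ((norm x)\<^sup>2)"] M
        by (simp add: C_def norm_mult norm_power distrib_right)
    qed auto
    also have "\<dots> = C * norm (U x)" using False by simp
    finally show ?thesis .
  qed
  then show ?thesis using C by blast
qed

text \<open>The angular derivative of a single mode is i n^2 U, so the gradient controls U, and the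
  bound by U on the disc becomes one by the gradient.\<close>

lemma inner_gradient:
  assumes "norm x \<le> r2"
  shows "norm (U x) \<le> 4 * r2 * norm (gradient U x)"
proof (cases "x = 0")
  case True
  then show ?thesis using U_0 r2_ge_1 by simp
next
  case False
  then have t: "tau x \<le> real n"
  proof (cases "norm x = r2")
    case True
    then show ?thesis using n mu by (simp add: tau_def r2_def)
  qed (use tau_ge_iff[OF False] assms in linarith)
  have "Ft x = \<i> * of_int (wave n) * U x"
    unfolding Ft_def U_def comb_inner[OF t] by (simp add: ct_def cu_def)
  then have "norm (Ft x) = real (n\<^sup>2) * norm (U x)"
    unfolding wave_n by (simp add: norm_mult norm_power)
  moreover have "1 * norm (U x) \<le> real (n\<^sup>2) * norm (U x)"
    using wave_n(2) by (intro mult_right_mono) (linarith, simp)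
  ultimately have "norm (U x) \<le> 4 * norm x * norm (gradient U x)"
    using gradient_ge[OF False] norm_ge_zero[of "Fr x"] by linarith
  also have "\<dots> \<le> 4 * r2 * norm (gradient U x)"
    using assms by (intro mult_right_mono mult_left_mono) auto
  finally show ?thesis .
qed

text \<open>Re K is at least 63/64 t^2, which exceeds \<mu> t^2 / 2, the derivative of t^2 / 4 in
  log r. Hence Re \<Phi> - t^2 / 4 is nondecreasing, and t^2 = r^(2\<mu>).\<close>

lemma U_decay: "\<exists>C>0. \<forall>x. norm x \<ge> r2 \<longrightarrow> norm (U x) \<le> C * exp (- (1 / 4) * norm x powr (2 * \<mu>))"
proof -
  define h where "h = (\<lambda>\<rho>. Re (\<Phi> \<rho>) - exp (\<mu> * \<rho>) ^ 2 / 4)"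
  have dh: "(h has_real_derivative Re (K \<rho>) - \<mu> * exp (\<mu> * \<rho>) ^ 2 / 2) (at \<rho>)" for \<rho>
  proof -
    have "((\<lambda>\<rho>. Re (\<Phi> \<rho>)) has_real_derivative Re (K \<rho>)) (at \<rho>)"
      using bounded_linear.has_vector_derivative[OF bounded_linear_Re dPhi]
      unfolding has_real_derivative_iff_has_vector_derivative .
    moreover have "((\<lambda>\<rho>. exp (\<mu> * \<rho>) ^ 2 / 4) has_real_derivative \<mu> * exp (\<mu> * \<rho>) ^ 2 / 2) (at \<rho>)"
      by (rule derivative_eq_intros refl | simp add: power2_eq_square)+
    ultimately show ?thesis unfolding h_def by (rule DERIV_diff)
  qed
  have ReK: "Re (K \<rho>) - \<mu> * exp (\<mu> * \<rho>) ^ 2 / 2 \<ge> 0" if "exp (\<mu> * \<rho>) \<ge> real n" for \<rho>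
  proof -
    define t where "t = exp (\<mu> * \<rho>)"
    have "\<bar>Re (J \<rho> - of_real (t ^ 2))\<bar> \<le> t ^ 2 / 64"
      using J_approx[OF that] abs_Re_le_cmod order_trans unfolding t_def by blast
    moreover have "Re (J \<rho> - of_real (t ^ 2)) = Re (J \<rho>) - t ^ 2" by simp
    moreover have "Re (K \<rho>) = Re (J \<rho>) + \<mu> / 2" using K_outer[OF that] by simp
    moreover have "\<mu> * t ^ 2 \<le> 1 * t ^ 2" using mu by (intro mult_right_mono) auto
    ultimately show ?thesis using mu zero_le_power2[of t] unfolding t_def[symmetric] by linarith
  qed
  have mono: "h (ln r2) \<le> h \<rho>" if "ln r2 \<le> \<rho>" for \<rho>
  proof (rule DERIV_nonneg_imp_nondecreasing[OF that])
    fix y assume "ln r2 \<le> y" "y \<le> \<rho>"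
    then have "ln (real n) \<le> \<mu> * y" using mu by (simp add: r2_def field_simps)
    then have "exp (ln (real n)) \<le> exp (\<mu> * y)" by simp
    then have "exp (\<mu> * y) \<ge> real n" using n by simp
    then show "\<exists>d. (h has_real_derivative d) (at y) \<and> 0 \<le> d" using dh ReK by blast
  qed
  have "norm (U x) \<le> (3 * exp (- h (ln r2))) * exp (- (1 / 4) * norm x powr (2 * \<mu>))" if r: "norm x \<ge> r2" for x
  proof -
    have x: "x \<noteq> 0" "norm x > 0" using r r2_ge_1 by auto
    then have t: "tau x \<ge> real n" using tau_ge_iff r by blast
    have t2: "exp (\<mu> * ln (norm x)) ^ 2 = norm x powr (2 * \<mu>)"
      using x by (simp add: powr_def flip: exp_of_nat_mult)
    have "ln r2 \<le> ln (norm x)" using r r2_ge_1 by (intro ln_mono) auto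
    from mono[OF this] have "- Re (\<Phi> (ln (norm x))) \<le> - h (ln r2) + - (1 / 4) * norm x powr (2 * \<mu>)"
      unfolding h_def t2 by simp
    then have "norm (E0 x) \<le> exp (- h (ln r2)) * exp (- (1 / 4) * norm x powr (2 * \<mu>))"
      unfolding E0_def norm_exp_eq_Re exp_add[symmetric] by simp
    then show ?thesis using outer_estimates(2)[OF x(1) t] by simp
  qed
  then show ?thesis by (intro exI[of _ "3 * exp (- h (ln r2))"]) auto
qed

end

text \<open>Merges a constant bound on a ball and a power bound outside it into one weight; beyond
  radius 1 the bracket is at most 2 |x|.\<close>

lemma bracket_weight:
  fixes r A B N :: real
  assumes "r \<ge> 1" "A \<ge> 0" "B \<ge> 0" "N \<ge> 0"
  shows "\<exists>C>0. \<forall>x::'a::real_normed_vector.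
    (norm x \<le> r \<longrightarrow> A \<le> C * japanese_bracket x powr (- N)) \<and>
    (r \<le> norm x \<longrightarrow> B * norm x powr (- N) \<le> C * japanese_bracket x powr (- N))"
proof -
  define C where "C = (A + B + 1) * (2 * r) powr N"
  have C: "C > 0" using assms by (simp add: C_def)
  have br: "japanese_bracket x \<le> 2 * c" if "norm x \<le> c" "1 \<le> c" for x :: 'a and c
  proof -
    have "(norm x)\<^sup>2 \<le> c\<^sup>2" "1 \<le> c\<^sup>2" using that by (auto intro: power_mono)
    then have "1 + (norm x)\<^sup>2 \<le> (2 * c)\<^sup>2" by (simp add: power_mult_distrib)
    then show ?thesis using that unfolding japanese_bracket_def by (intro real_le_lsqrt) auto
  qed
  have pos: "japanese_bracket x > 0" for x :: 'a using japanese_bracket_ge_1[of x] by linarith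
  have conv: "a * japanese_bracket x powr N \<le> C \<Longrightarrow> a \<le> C * japanese_bracket x powr (- N)" for a and x :: 'a
    using pos[of x] by (simp add: powr_minus divide_simps flip: divide_inverse)
  have 1: "A \<le> C * japanese_bracket x powr (- N)" if "norm x \<le> r" for x :: 'a
  proof (rule conv)
    have "japanese_bracket x powr N \<le> (2 * r) powr N"
      using br[OF that assms(1)] pos[of x] assms(4) by (intro powr_mono2) auto
    then show "A * japanese_bracket x powr N \<le> C"
      unfolding C_def using assms by (intro mult_mono) auto
  qed
  have 2: "B * norm x powr (- N) \<le> C * japanese_bracket x powr (- N)" if "r \<le> norm x" for x :: 'a
  proof (rule conv)
    have n1: "norm x \<ge> 1" using that assms by linarith
    have "japanese_bracket x powr N \<le> (2 * norm x) powr N"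
      using br[OF order_refl n1] pos[of x] assms(4) by (intro powr_mono2) auto
    then have "norm x powr (- N) * japanese_bracket x powr N \<le> norm x powr (- N) * (2 powr N * norm x powr N)"
      using n1 by (intro mult_left_mono) (auto simp: powr_mult)
    also have "\<dots> = 2 powr N"
    proof -
      have "norm x powr N > 0" using n1 by (intro powr_gt_zero[THEN iffD2]) linarith
      then show ?thesis by (simp add: powr_minus)
    qed
    also have "\<dots> \<le> (2 * r) powr N" using assms by (intro powr_mono2) auto
    finally have "B * (norm x powr (- N) * japanese_bracket x powr N) \<le> (A + B + 1) * (2 * r) powr N"
      using assms by (intro mult_mono) auto
    then show "B * norm x powr (- N) * japanese_bracket x powr N \<le> C"
      by (simp add: C_def mult.assoc)
  qed
  show ?thesis using C 1 2 by blast
qed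

text \<open>The bound by u is stated for 3 \<mu> <= 2, where its weight is nonincreasing, as
  \<open>bracket_weight\<close> requires. For the gradient bound this follows from \<mu> <=
  1.\<close>

lemma meshkov_example:
  fixes l :: complex and \<mu> :: real
  assumes card: "CARD('n::finite) = 2" and mu: "1 / 2 < \<mu>" "\<mu> \<le> 1"
  shows "\<exists>u :: real ^ 'n \<Rightarrow> complex. C2 u \<and> (\<exists>x. u x \<noteq> 0) \<and>
    (\<exists>C>0. \<forall>\<^sub>F x in at_infinity. norm (u x) \<le> C * exp (- (1 / 4) * norm x powr (2 * \<mu>))) \<and>
    (3 * \<mu> \<le> 2 \<longrightarrow> (\<exists>C>0. \<forall>x. norm (laplacian u x + l * u x) \<le> C * japanese_bracket x powr (3 * \<mu> - 2) * norm (u x))) \<and>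
    (\<exists>C>0. \<forall>x. norm (laplacian u x + l * u x) \<le> C * japanese_bracket x powr (\<mu> - 1) * norm (gradient u x))"
proof -
  obtain i1 i2 :: 'n where i: "i1 \<noteq> i2" "UNIV = {i1, i2}"
    using card unfolding card_2_iff by blast
  obtain n J J1 K K1 \<Phi> where "profile \<mu> l n J J1 K K1 \<Phi>"
    using profile_exists[OF mu, of l] by blast
  then interpret profile \<mu> l n J J1 K K1 \<Phi> .
  interpret construction i1 i2 \<mu> l n J J1 K K1 \<Phi>
    by standard (use i in auto)
  obtain C0 where C0: "C0 \<ge> 0" "\<And>x. norm x \<le> r2 \<Longrightarrow> norm (laplacian U x + l * U x) \<le> C0 * norm (U x)"
    using inner_V by blast
  have V: "\<exists>C>0. \<forall>x. norm (laplacian U x + l * U x) \<le> C * japanese_bracket x powr (3 * \<mu> - 2) * norm (U x)"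
    if le: "3 * \<mu> \<le> 2"
  proof -
    obtain C where C: "C > 0" "\<And>x :: real ^ 'n. norm x \<le> r2 \<Longrightarrow> C0 \<le> C * japanese_bracket x powr (- (2 - 3 * \<mu>))"
      "\<And>x :: real ^ 'n. r2 \<le> norm x \<Longrightarrow> 600 * norm x powr (- (2 - 3 * \<mu>)) \<le> C * japanese_bracket x powr (- (2 - 3 * \<mu>))"
      using bracket_weight[OF r2_ge_1 C0(1), of 600 "2 - 3 * \<mu>"] le by auto
    have "norm (laplacian U x + l * U x) \<le> C * japanese_bracket x powr (3 * \<mu> - 2) * norm (U x)" for x
    proof (cases "norm x \<le> r2")
      case True
      then show ?thesis
        using C0(2)[OF True] mult_right_mono[OF C(2)[OF True] norm_ge_zero[of "U x"]] by simp
    next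
      case False
      then have "r2 \<le> norm x" by simp
      then show ?thesis
        using outer_V[of x] mult_right_mono[OF C(3)[of x] norm_ge_zero[of "U x"]] by simp
    qed
    then show ?thesis using C(1) by blast
  qed
  have W: "\<exists>C>0. \<forall>x. norm (laplacian U x + l * U x) \<le> C * japanese_bracket x powr (\<mu> - 1) * norm (gradient U x)"
  proof -
    have "C0 * (4 * r2) \<ge> 0" using C0(1) r2_ge_1 by simp
    from bracket_weight[OF r2_ge_1 this, of 14400 "1 - \<mu>"] mu(2)
    obtain C where C: "C > 0" "\<And>x :: real ^ 'n. norm x \<le> r2 \<Longrightarrow> C0 * (4 * r2) \<le> C * japanese_bracket x powr (- (1 - \<mu>))"
      "\<And>x :: real ^ 'n. r2 \<le> norm x \<Longrightarrow> 14400 * norm x powr (- (1 - \<mu>)) \<le> C * japanese_bracket x powr (- (1 - \<mu>))"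
      by auto
    have "norm (laplacian U x + l * U x) \<le> C * japanese_bracket x powr (\<mu> - 1) * norm (gradient U x)" for x
    proof (cases "norm x \<le> r2")
      case True
      have "norm (laplacian U x + l * U x) \<le> C0 * (4 * r2 * norm (gradient U x))"
        using C0(2)[OF True] mult_left_mono[OF inner_gradient[OF True] C0(1)] by linarith
      then show ?thesis
        using mult_right_mono[OF C(2)[OF True] norm_ge_zero[of "gradient U x"]] by (simp add: mult.assoc)
    next
      case False
      then have "r2 \<le> norm x" by simp
      then show ?thesis
        using outer_W[of x] mult_right_mono[OF C(3)[of x] norm_ge_zero[of "gradient U x"]] by simp
    qed
    then show ?thesis using C(1) by blast
  qed
  obtain D where D: "D > 0" "\<And>x. norm x \<ge> r2 \<Longrightarrow> norm (U x) \<le> D * exp (- (1 / 4) * norm x powr (2 * \<mu>))"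
    using U_decay by blast
  have "\<forall>\<^sub>F x in at_infinity. norm (U x) \<le> D * exp (- (1 / 4) * norm x powr (2 * \<mu>))"
    unfolding eventually_at_infinity using D(2) by blast
  then show ?thesis using U_C2 U_nonzero V W D(1) by blast
qed

theorem theorem2:
  fixes l :: complex and N P :: real
  assumes "N \<ge> 0" and "P \<ge> 0"
    and "(beta_0 N P = beta_c N P \<and> beta_c N P > 1 \<and> CARD('n::finite) = 2)
         \<or> (beta_c N P < 1 \<and> l \<notin> \<real>\<^sub>\<ge>\<^sub>0)"
  shows "\<exists>(V :: real ^ 'n \<Rightarrow> complex) (W :: real ^ 'n \<Rightarrow> complex ^ 'n) (u :: real ^ 'n \<Rightarrow> complex).
      ((\<forall>x. V x = 0) \<or> (\<forall>x. W x = 0)) \<and>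
      (\<exists>x. u x \<noteq> 0) \<and>
      eigen_solution V W l u \<and>
      (\<exists>C>0. \<forall>x. norm (V x) \<le> C * japanese_bracket x powr (- N)) \<and>
      (\<exists>C>0. \<forall>x. norm (W x) \<le> C * japanese_bracket x powr (- P)) \<and>
      (\<exists>A\<in>{-1, 0 :: int}. \<exists>C>0. \<exists>c>0. \<forall>\<^sub>F x in at_infinity.
         norm (u x) \<le> C * exp (- c * norm x powr beta_0 N P * ln (norm x) powi A))"
  using assms(3)
proof (elim disjE conjE)
  assume "beta_c N P < 1" "l \<notin> \<real>\<^sub>\<ge>\<^sub>0"
  then have b: "beta_0 N P = 1" by (simp add: beta_0_def)
  obtain V and u :: "real ^ 'n \<Rightarrow> complex" where V: "\<And>x. u x \<noteq> 0" "eigen_solution V (\<lambda>_. 0) l u"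
    "\<exists>C>0. \<forall>x. norm (V x) \<le> C * japanese_bracket x powr (- N)"
    and u: "\<exists>C>0. \<exists>c>0. \<forall>\<^sub>F x in at_infinity. norm (u x) \<le> C * exp (- c * norm x)"
    using fast_decaying_potential[OF \<open>l \<notin> \<real>\<^sub>\<ge>\<^sub>0\<close>, of N, where 'n = 'n] by blast
  from u have "\<exists>C>0. \<exists>c>0. \<forall>\<^sub>F x in at_infinity.
       norm (u x) \<le> C * exp (- c * norm x powr beta_0 N P * ln (norm x) powi 0)"
    by (simp add: b)
  moreover have "\<exists>C>0. \<forall>x :: real ^ 'n. norm (0 :: complex ^ 'n) \<le> C * japanese_bracket x powr (- P)"
    by (intro exI[of _ 1]) simp
  ultimately show ?thesis using V
    by (intro exI[of _ V] exI[of _ "\<lambda>_. 0"] exI[of _ u] conjI bexI[of _ "0 :: int"]) auto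
next
  assume b0: "beta_0 N P = beta_c N P" and b1: "beta_c N P > 1" and card: "CARD('n) = 2"
  \<comment> \<open>Makes t^2 = r^(2\<mu>) the decay exponent of the claim; N, P >= 0 give
    \<open>beta_c\<close> <= 2, hence \<mu> <= 1.\<close>
  define \<mu> where "\<mu> = beta_c N P / 2"
  have mu: "1 / 2 < \<mu>" "\<mu> \<le> 1" "2 * \<mu> = beta_0 N P"
    using b0 b1 assms(1,2) by (auto simp: \<mu>_def beta_c_def)
  obtain u :: "real ^ 'n \<Rightarrow> complex" where u: "C2 u" "\<exists>x. u x \<noteq> 0"
    "\<exists>C>0. \<forall>\<^sub>F x in at_infinity. norm (u x) \<le> C * exp (- (1 / 4) * norm x powr (2 * \<mu>))"
    "3 * \<mu> \<le> 2 \<Longrightarrow> \<exists>C>0. \<forall>x. norm (laplacian u x + l * u x) \<le> C * japanese_bracket x powr (3 * \<mu> - 2) * norm (u x)"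
    "\<exists>C>0. \<forall>x. norm (laplacian u x + l * u x) \<le> C * japanese_bracket x powr (\<mu> - 1) * norm (gradient u x)"
    using meshkov_example[OF card mu(1,2), of l] by blast
  have decay: "\<exists>C>0. \<exists>c>0. \<forall>\<^sub>F x in at_infinity.
       norm (u x) \<le> C * exp (- c * norm x powr beta_0 N P * ln (norm x) powi 0)"
  proof -
    obtain C where "C > 0" "\<forall>\<^sub>F x in at_infinity. norm (u x) \<le> C * exp (- (1 / 4) * norm x powr (2 * \<mu>))"
      using u(3) by blast
    then show ?thesis unfolding mu(3)
      by (intro exI[of _ C] conjI exI[of _ "1 / 4 :: real"]) auto
  qed
  have zero: "\<exists>C>0. \<forall>x :: real ^ 'n. 0 \<le> C * japanese_bracket x powr q" for q
    by (intro exI[of _ 1]) simp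
  \<comment> \<open>The entry that attains the maximum decides which potential carries the error;
    the other one is 0.\<close>
  have "2 * \<mu> = 2 - 2 * P \<or> 2 * \<mu> = (4 - 2 * N) / 3"
    unfolding \<mu>_def beta_c_def max_def by auto
  then consider (W) "2 * \<mu> = 2 - 2 * P" | (V) "2 * \<mu> = (4 - 2 * N) / 3" by blast
  then show ?thesis
  proof cases
    case W
    then have e: "\<mu> - 1 = - P" by simp
    obtain C where "C > 0" "\<And>x. norm (laplacian u x + l * u x) \<le> C * japanese_bracket x powr (- P) * norm (gradient u x)"
      using u(5) unfolding e by blast
    then obtain W where "eigen_solution (\<lambda>_. 0) W l u" "\<And>x. norm (W x) \<le> C * japanese_bracket x powr (- P)"
      using exists_drift[OF u(1), of l C "\<lambda>x. japanese_bracket x powr (- P)"] by auto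
    then show ?thesis using \<open>C > 0\<close> decay u(2) zero[of "- N"]
      by (intro exI[of _ "\<lambda>_. 0"] exI[of _ W] exI[of _ u] conjI bexI[of _ "0 :: int"]) auto
  next
    case V
    then have e: "3 * \<mu> - 2 = - N" by (simp add: field_simps)
    obtain C where "C > 0" "\<And>x. norm (laplacian u x + l * u x) \<le> C * japanese_bracket x powr (- N) * norm (u x)"
      using u(4) e assms(1) by (metis diff_le_0_iff_le neg_le_0_iff_le)
    then obtain V where "eigen_solution V (\<lambda>_. 0) l u" "\<And>x. norm (V x) \<le> C * japanese_bracket x powr (- N)"
      using exists_potential[OF u(1), of l C "\<lambda>x. japanese_bracket x powr (- N)"] by auto
    then show ?thesis using \<open>C > 0\<close> decay u(2) zero[of "- P"]
      by (intro exI[of _ V] exI[of _ "\<lambda>_. 0"] exI[of _ u] conjI bexI[of _ "0 :: int"]) auto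
  qed
qed

end
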